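(* Suppose that $S$ is a $k$-dimensional $C^1$ submanifold of $\mathbb{R}^n$ and $\pi$ is a $k$-dimensional subspace of $\mathbb{R}^n$ for which $$T_\xi S\cap\pi^\perp=\{0\}\quad\text{for all }\xi\in S,\tag{T}$$ and $$\langle\xi-\eta\rangle\cap\pi^\perp=\{0\}\quad\text{for all }\xi,\eta\in S.\tag{GT}$$ Let $g$ be a function on $S$, let $\nu$ be a measure on the tangent bundle $TS=\{(\xi,y):\xi\in S,\ y\in T_\xi S\}$ whose pushforward $\nu_S$ under the natural projection $TS\ni(\xi,y)\mapsto\xi\in S$ is given by $d\nu_S(\xi)=|g(\xi)|^2d\sigma(\xi)$, and let $\mu$ be the pushforward of $\nu$ under the map $TS\ni(\xi,y)\mapsto((T_\xi S)^\perp,y)\in\mathfrak{M}_{n-k,n}$, that is, $\int_{\mathfrak{M}_{n-k,n}}\varphi\,d\mu=\int_{TS}\varphi((T_\xi S)^\perp,y)\,d\nu(\xi,y)$. Then for any measure $\mu$ arising in this way, and $y\in\pi^\perp$, $$ T_{k,n}\big(|\widehat{gd\sigma}|^2\big)(\pi,y)=\int_S\frac{|g(\xi)|^2}{|(T_\xi S)^\perp\wedge\pi|}\,d\sigma(\xi)=T_{k,n}T_{n-k,n}^*(\mu)(\pi,y). $$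
   Context: $d\sigma$ denotes surface measure on $S$, and the Fourier extension operator is $\widehat{gd\sigma}(x)=\int_S g(\xi)e^{-2\pi i x\cdot\xi}\,d\sigma(\xi)$, $x\in\mathbb{R}^n$. Here $T_\xi S$ is the tangent space to $S$ at $\xi$, regarded as a linear subspace of $\mathbb{R}^n$, and $\langle\xi-\eta\rangle$ is the linear span of $\xi-\eta$. $\mathfrak{M}_{k,n}$ is the manifold of (affine) $k$-planes in $\mathbb{R}^n$, parametrised by a $k$-dimensional subspace $\pi$ and a translation parameter $y\in\pi^\perp$. The $k$-plane transform is $$T_{k,n}f(\pi,y)=\int_{\mathbb{R}^n}f(x)\,\delta_{\pi+\{y\}}(x)\,dx:=\int f(x+y)\,d\lambda_\pi(x),$$ where $\lambda_\pi$ is Lebesgue measure on $\pi$. The adjoint $(n-k)$-plane transform is $$T_{n-k,n}^*\mu(x)=\int_{\mathfrak{M}_{n-k,n}}\delta_{\theta+\{z\}}(x)\,d\mu(\theta,z),$$ a superposition of Dirac masses on $(n-k)$-planes. The composition is accordingly $$T_{k,n}T_{n-k,n}^*\mu(\pi,y)=\int_{\mathbb{R}^n}T_{n-k,n}^*\mu(x)\,\delta_{\pi+\{y\}}(x)\,dx=\int_{\mathfrak{M}_{n-k,n}}\Big(\int_{\mathbb{R}^n}\delta_{\pi+\{y\}}(x)\,\delta_{\theta+\{z\}}(x)\,dx\Big)d\mu(\theta,z).$$ For transverse subspaces $V,W$ of $\mathbb{R}^n$ of complementary dimensions $\ell$ and $m$, $|V\wedge W|:=|v_1\wedge\cdots\wedge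 v_\ell\wedge w_1\wedge\cdots\wedge w_m|$, where $\{v_j\}$, $\{w_j\}$ are orthonormal bases of $V$ and $W$ respectively. The measure $\mu$ is not required to be nonnegative. The simplest example of an admissible $\nu$ is $d\nu(\xi,y)=\delta_0(y)|g(\xi)|^2\,dy\,d\sigma(\xi)$.
   Formalization: g is taken integrable on S so that the extension operator is defined, and for measures that are not nonnegative the second equality is asserted only when the integral defining T_{k,n}T*_{n-k,n}μ(π,y) is not of the form ∞ − ∞. *)

theory Defs
  imports "HOL-Analysis.Analysis"
begin

section \<open>Submanifolds, tangent spaces and surface measure\<close>

text \<open>The dimension of a submanifold is the cardinality of the index type \<open>'k\<close>.\<close>

definition C1_parametrisation ::
  "(real^'k \<Rightarrow> real^'n) \<Rightarrow> (real^'k) set \<Rightarrow> (real^'n) set \<Rightarrow> bool" where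
  "C1_parametrisation \<psi> W S \<longleftrightarrow>
     open W \<and> openin (top_of_set S) (\<psi> ` W) \<and>
     (\<exists>\<phi>. homeomorphism W (\<psi> ` W) \<psi> \<phi>) \<and>
     (\<forall>u\<in>W. \<psi> differentiable at u) \<and>
     continuous_on W (\<lambda>u. jacobian \<psi> (at u)) \<and>
     (\<forall>u\<in>W. rank (jacobian \<psi> (at u)) = CARD('k))"

definition C1_submanifold :: "'k::finite itself \<Rightarrow> (real^'n) set \<Rightarrow> bool" where
  "C1_submanifold _ S \<longleftrightarrow>
     (\<forall>\<xi>\<in>S. \<exists>(\<psi> :: real^'k \<Rightarrow> real^'n) W. C1_parametrisation \<psi> W S \<and> \<xi> \<in> \<psi> ` W)"

definition tangent_space :: "(real^'n) set \<Rightarrow> real^'n \<Rightarrow> (real^'n) set" where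
  "tangent_space S \<xi> =
     {v. \<exists>\<gamma> :: real \<Rightarrow> real^'n. \<gamma> 0 = \<xi> \<and> (\<forall>\<^sub>F t in nhds 0. \<gamma> t \<in> S) \<and>
           (\<gamma> has_vector_derivative v) (at 0)}"

definition tangent_bundle :: "(real^'n) set \<Rightarrow> ((real^'n) \<times> (real^'n)) set" where
  "tangent_bundle S = {(\<xi>, v). \<xi> \<in> S \<and> v \<in> tangent_space S \<xi>}"

text \<open>Surface measure is the Borel measure on \<open>S\<close> given in every local parametrisation by the
  density \<open>sqrt (det (D\<psi>\<^sup>T D\<psi>))\<close>. It exists for every \<open>C\<^sup>1\<close> submanifold by the change of
  variables formula, and is unique because countably many parametrisations cover \<open>S\<close>.\<close>

definition surface_measure :: "'k::finite itself \<Rightarrow> (real^'n) set \<Rightarrow> (real^'n) measure" where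
  "surface_measure _ S =
     (THE M. sets M = sets (restrict_space borel S) \<and>
        (\<forall>(\<psi> :: real^'k \<Rightarrow> real^'n) W. C1_parametrisation \<psi> W S \<longrightarrow>
           (\<forall>A\<in>sets M. A \<subseteq> \<psi> ` W \<longrightarrow>
              emeasure M A =
                (\<integral>\<^sup>+u\<in>{u\<in>W. \<psi> u \<in> A}.
                   ennreal (sqrt (det (transpose (jacobian \<psi> (at u)) ** jacobian \<psi> (at u))))
                 \<partial>lborel))))"

definition fourier_extension ::
  "(real^'n) measure \<Rightarrow> (real^'n \<Rightarrow> complex) \<Rightarrow> real^'n \<Rightarrow> complex" where
  "fourier_extension \<sigma> g x =
     (\<integral>\<xi>. g \<xi> * exp (- (2 * complex_of_real pi * \<i> * complex_of_real (x \<bullet> \<xi>))) \<partial>\<sigma>)"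

section \<open>Subspaces\<close>

definition orthonormal_basis :: "(real^'n) set \<Rightarrow> (real^'n) set \<Rightarrow> bool" where
  "orthonormal_basis B V \<longleftrightarrow> pairwise orthogonal B \<and> (\<forall>b\<in>B. norm b = 1) \<and> span B = V"

text \<open>Lebesgue measure on \<open>V\<close>, as a Borel measure on the ambient space: the image of product
  Lebesgue measure under orthonormal coordinates (independent of the basis chosen). For
  \<open>V = {0}\<close> it is the unit mass at the origin.\<close>

definition subspace_lebesgue :: "(real^'n) set \<Rightarrow> (real^'n) measure" where
  "subspace_lebesgue V =
     (let B = (SOME B. orthonormal_basis B V)
      in distr (Pi\<^sub>M B (\<lambda>_. lborel)) borel (\<lambda>c. \<Sum>b\<in>B. c b *\<^sub>R b))"

text \<open>For subspaces of complementary dimensions, the norm of the exterior product of all the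
  vectors of an orthonormal basis of \<open>V\<close> and one of \<open>W\<close> is the absolute value of the
  determinant having these vectors as rows. The rows with index in \<open>I\<close> are the basis of \<open>V\<close>.\<close>

definition wedge_abs :: "(real^'n) set \<Rightarrow> (real^'n) set \<Rightarrow> real" where
  "wedge_abs V W =
     (THE c. \<exists>(f :: 'n \<Rightarrow> real^'n) I.
        inj_on f I \<and> orthonormal_basis (f ` I) V \<and>
        inj_on f (- I) \<and> orthonormal_basis (f ` (- I)) W \<and>
        c = \<bar>det (\<chi> i. f i)\<bar>)"

section \<open>Affine planes and plane transforms\<close>

definition affine_planes :: "nat \<Rightarrow> ((real^'n) set \<times> (real^'n)) set" where
  "affine_planes m = {(\<theta>, z). subspace \<theta> \<and> dim \<theta> = m \<and> z \<in> \<theta>\<^sup>\<bottom>}"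

text \<open>The Borel structure of the manifold of affine planes. A subspace is identified with the
  matrix of the orthogonal projection onto it, i.e. of its nearest point map; this embeds the
  Grassmannian in the space of matrices.\<close>

definition plane_space :: "nat \<Rightarrow> ((real^'n) set \<times> (real^'n)) measure" where
  "plane_space m =
     vimage_algebra (affine_planes m) (\<lambda>(\<theta>, z). (matrix (closest_point \<theta>), z)) borel"

text \<open>All functions to be transformed are nonnegative, and the transform may be infinite.\<close>

definition k_plane_transform ::
  "(real^'n \<Rightarrow> ennreal) \<Rightarrow> (real^'n) set \<Rightarrow> real^'n \<Rightarrow> ennreal" where
  "k_plane_transform f \<pi> y = (\<integral>\<^sup>+x. f (x + y) \<partial>subspace_lebesgue \<pi>)"

text \<open>The Dirac mass \<open>\<delta>\<close> on the plane \<open>\<theta> + {z}\<close>.\<close>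

definition plane_delta :: "(real^'n) set \<Rightarrow> real^'n \<Rightarrow> (real^'n) measure" where
  "plane_delta \<theta> z = distr (subspace_lebesgue \<theta>) borel (\<lambda>x. x + z)"

text \<open>The integral of the product of \<open>\<delta>\<close> on \<open>\<pi> + {y}\<close> with \<open>\<delta>\<close> on \<open>\<theta> + {z}\<close>
  is the plane transform at \<open>(\<pi>, y)\<close> of the measure \<open>plane_delta \<theta> z\<close>. As usual for
  products of distributions, it is the limit obtained on mollifying this measure, required to
  be the same for all mollifiers. It is left unspecified if there is no such common limit,
  which for complementary dimensions happens only if the planes meet and are not
  transverse.\<close>

definition mollifier :: "(real^'n \<Rightarrow> real) \<Rightarrow> bool" where
  "mollifier \<rho> \<longleftrightarrow> continuous_on UNIV \<rho> \<and> bounded {x. \<rho> x \<noteq> 0} \<and> (\<forall>x. 0 \<le> \<rho> x) \<and>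
     (\<integral>\<^sup>+x. ennreal (\<rho> x) \<partial>lborel) = 1"

definition mollify :: "(real^'n \<Rightarrow> real) \<Rightarrow> real \<Rightarrow> (real^'n) measure \<Rightarrow> real^'n \<Rightarrow> ennreal" where
  "mollify \<rho> \<epsilon> M x = (\<integral>\<^sup>+w. ennreal (\<rho> ((x - w) /\<^sub>R \<epsilon>) / \<epsilon> ^ CARD('n)) \<partial>M)"

definition delta_product_integral ::
  "(real^'n) set \<Rightarrow> real^'n \<Rightarrow> (real^'n) set \<Rightarrow> real^'n \<Rightarrow> ennreal" where
  "delta_product_integral \<pi> y \<theta> z =
     (THE c. \<forall>\<rho>. mollifier \<rho> \<longrightarrow>
        ((\<lambda>\<epsilon>. k_plane_transform (mollify \<rho> \<epsilon> (plane_delta \<theta> z)) \<pi> y) \<longlongrightarrow> c) (at_right 0))"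

section \<open>Signed measures\<close>

text \<open>A signed measure is given by a positive and a negative part, at least one of them finite,
  and stands for their difference. By the Jordan decomposition every signed measure arises in
  this way; the parts are not required to be mutually singular. Integrals of nonnegative
  functions exist unless they are of the form \<open>\<infinity> - \<infinity>\<close>.\<close>

type_synonym 'a signed_measure = "'a measure \<times> 'a measure"

definition signed_measure_on :: "'a measure \<Rightarrow> 'a signed_measure \<Rightarrow> bool" where
  "signed_measure_on M \<nu> \<longleftrightarrow> sets (fst \<nu>) = sets M \<and> sets (snd \<nu>) = sets M \<and>
     (finite_measure (fst \<nu>) \<or> finite_measure (snd \<nu>))"

definition signed_emeasure :: "'a signed_measure \<Rightarrow> 'a set \<Rightarrow> ereal" where
  "signed_emeasure \<nu> A = enn2ereal (emeasure (fst \<nu>) A) - enn2ereal (emeasure (snd \<nu>) A)"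

definition signed_distr ::
  "'a signed_measure \<Rightarrow> 'b measure \<Rightarrow> ('a \<Rightarrow> 'b) \<Rightarrow> 'b signed_measure" where
  "signed_distr \<nu> N f = (distr (fst \<nu>) N f, distr (snd \<nu>) N f)"

definition signed_integral_exists :: "'a signed_measure \<Rightarrow> ('a \<Rightarrow> ennreal) \<Rightarrow> bool" where
  "signed_integral_exists \<nu> f \<longleftrightarrow>
     (\<integral>\<^sup>+x. f x \<partial>fst \<nu>) < \<infinity> \<or> (\<integral>\<^sup>+x. f x \<partial>snd \<nu>) < \<infinity>"

definition signed_integral :: "'a signed_measure \<Rightarrow> ('a \<Rightarrow> ennreal) \<Rightarrow> ereal" where
  "signed_integral \<nu> f =
     enn2ereal (\<integral>\<^sup>+x. f x \<partial>fst \<nu>) - enn2ereal (\<integral>\<^sup>+x. f x \<partial>snd \<nu>)"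

text \<open>The composition of a plane transform with the adjoint of the complementary one, and the
  condition for the integral defining it to make sense. This holds in particular whenever
  \<open>\<mu>\<close> is nonnegative, i.e. its negative part vanishes.\<close>

definition transform_adjoint_exists ::
  "((real^'n) set \<times> (real^'n)) signed_measure \<Rightarrow> (real^'n) set \<Rightarrow> real^'n \<Rightarrow> bool" where
  "transform_adjoint_exists \<mu> \<pi> y \<longleftrightarrow>
     signed_integral_exists \<mu> (\<lambda>(\<theta>, z). delta_product_integral \<pi> y \<theta> z)"

definition transform_adjoint ::
  "((real^'n) set \<times> (real^'n)) signed_measure \<Rightarrow> (real^'n) set \<Rightarrow> real^'n \<Rightarrow> ereal" where
  "transform_adjoint \<mu> \<pi> y =
     signed_integral \<mu> (\<lambda>(\<theta>, z). delta_product_integral \<pi> y \<theta> z)"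

end

theory Submission
  imports Defs "HOL-Probability.Probability" "HOL-Real_Asymp.Real_Asymp"
begin

text \<open>Let \<open>Q\<close> be orthogonal projection onto \<open>\<pi>\<close> in orthonormal coordinates. By (GT) it is injective on
  \<open>S\<close>, and by (T) its differential is invertible there, so \<open>S\<close> is the image of a section \<open>s\<close> over an
  open \<open>V \<subseteq> \<real>\<^sup>k\<close>. In this single chart surface measure has density \<open>1 / J\<close>, where
  \<open>J \<xi> = |(T\<^sub>\<xi> S)\<^sup>\<bottom> \<and> \<pi>|\<close> is the Jacobian of \<open>Q\<close> on \<open>T\<^sub>\<xi> S\<close>. On \<open>\<pi> + {y}\<close> the extension operator is
  therefore the Fourier transform of \<open>v \<mapsto> g (s v) exp (-2\<pi>i y \<bullet> s v) / J (s v)\<close>, and Plancherel turns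
  its square integral into that of \<open>|g|\<^sup>2 / J\<^sup>2\<close> over \<open>V\<close>, which is that of \<open>|g|\<^sup>2 / J\<close> over \<open>S\<close>. As \<open>g\<close> is only
  integrable, Plancherel in \<open>[0, \<infinity>]\<close> is needed on \<open>L\<^sup>1\<close>.

  For the second identity, mollified deltas on transverse planes of complementary dimensions have
  the product integral \<open>1 / |\<theta> \<and> \<pi>|\<close> at every scale, by the change of variables
  \<open>(x, w) \<mapsto> x - w\<close> from \<open>\<pi> \<times> \<theta>\<close> to \<open>\<real>\<^sup>n\<close>.\<close>

section \<open>Plancherel's theorem for integrable functions\<close>

text \<open>The function fed to Plancherel may have infinite L2 norm, so neither density in L2 nor
  L2 convergence is at hand. A Gaussian weight of scale \<open>s\<close> makes the energy of the
  Fourier transform finite and equal to that of a heat average of the function. As the scale tends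
  to zero, each of the two inequalities is an instance of Fatou's lemma.

  The normal planes, \<open>J\<close> and the section \<open>s\<close> are given pointwise, through
  curves, choices of bases and an inverse, while integration needs them measurable. The wedge
  product is therefore written as the root of the determinant of a sum of two projection matrices,
  which removes all choices, and the normal projection is continuous along \<open>S\<close> by
  Cramer's rule in charts. The section is only shown to be continuous, by invariance of domain;
  derivatives are taken in the given charts and pushed through \<open>Q\<close>.

  The surface measure is a definite description, so the measure built from the single chart must be
  shown to be the only one with the required densities. Signed measures enter through an additive
  identity in [0, infinity], and subtraction is postponed to the last line.\<close>

abbreviation unit_wave :: "real \<Rightarrow> complex" where
  "unit_wave r \<equiv> exp (- (2 * complex_of_real pi * \<i> * complex_of_real r))"

text \<open>The substitution \<open>z = c * x\<close> turns the exponent of the standard normal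
  density into \<open>- (pi * t * x\<^sup>2)\<close>, and \<open>a\<close> is the frequency for
  which \<open>a * c = - 2 * pi * w\<close>. The value is then the characteristic function of the
  normal distribution at \<open>a\<close>.\<close>

lemma gauss_fourier_real:
  fixes t w :: real assumes t: "t > 0"
  shows "integrable lborel (\<lambda>x::real. complex_of_real (exp (- (pi * t * x\<^sup>2))) * unit_wave (x * w))" (is ?I)
    and "(\<integral>x. complex_of_real (exp (- (pi * t * x\<^sup>2))) * unit_wave (x * w) \<partial>lborel)
       = complex_of_real (exp (- (pi * w\<^sup>2 / t)) / sqrt t)" (is ?E)
proof -
  define c where "c = sqrt (2 * pi * t)"
  have c: "c > 0" "c\<^sup>2 = 2 * pi * t" using t by (auto simp: c_def)
  define a where "a = - (2 * pi * w / c)"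
  let ?g = "\<lambda>z::real. std_normal_density z *\<^sub>R iexp (a * z)"
  let ?f = "\<lambda>x::real. complex_of_real (exp (- (pi * t * x\<^sup>2))) * unit_wave (x * w)"
  have gi: "integrable lborel ?g"
  proof (rule Bochner_Integration.integrable_bound)
    show "integrable lborel std_normal_density" by simp
    show "?g \<in> borel_measurable lborel" by measurable
    show "AE x in lborel. norm (?g x) \<le> norm (std_normal_density x)" by (auto simp: norm_mult)
  qed
  have gE: "(\<integral>z. ?g z \<partial>lborel) = complex_of_real (exp (- a\<^sup>2 / 2))"
  proof -
    have "char std_normal_distribution a = (\<integral>z. ?g z \<partial>lborel)"
      unfolding char_def by (subst integral_density) auto
    then show ?thesis using fun_cong[OF char_std_normal_distribution, of a] by simp
  qed
  have eq: "?g (0 + c * x) = (1 / sqrt (2 * pi)) *\<^sub>R ?f x" for x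
  proof -
    have 1: "(c * x)\<^sup>2 / 2 = pi * t * x\<^sup>2" using c(2) by (simp add: power_mult_distrib)
    have 2: "\<i> * complex_of_real (a * (c * x)) = - (2 * complex_of_real pi * \<i> * complex_of_real (x * w))"
      using c(1) by (simp add: a_def field_simps)
    have 3: "std_normal_density (c * x) = (1 / sqrt (2 * pi)) * exp (- (pi * t * x\<^sup>2))"
      unfolding std_normal_density_def 1[symmetric] by simp
    show ?thesis using 2 by (simp add: 3 scaleR_conv_of_real)
  qed
  have "integrable lborel (\<lambda>x. ?g (0 + c * x))"
    by (rule lborel_integrable_real_affine[OF gi]) (use c in auto)
  then have "integrable lborel (\<lambda>x. sqrt (2*pi) *\<^sub>R ((1 / sqrt (2 * pi)) *\<^sub>R ?f x))"
    unfolding eq by (rule integrable_scaleR_right)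
  then show ?I by simp
  have "complex_of_real (exp (- a\<^sup>2 / 2)) = \<bar>c\<bar> *\<^sub>R (\<integral>x. ?g (0 + c * x) \<partial>lborel)"
    unfolding gE[symmetric] by (rule lborel_integral_real_affine) (use c in auto)
  also have "\<dots> = \<bar>c\<bar> *\<^sub>R ((1 / sqrt (2 * pi)) *\<^sub>R (\<integral>x. ?f x \<partial>lborel))"
    unfolding eq by simp
  also have "\<dots> = sqrt t *\<^sub>R (\<integral>x. ?f x \<partial>lborel)"
    using c t by (simp add: c_def real_sqrt_mult)
  finally have "(\<integral>x. ?f x \<partial>lborel) = (1 / sqrt t) *\<^sub>R complex_of_real (exp (- a\<^sup>2 / 2))"
    using t by simp
  moreover have "a\<^sup>2 / 2 = pi * w\<^sup>2 / t"
    using c t by (simp add: a_def power_divide power_mult_distrib) (simp add: power2_eq_square)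
  ultimately show ?E by (simp add: scaleR_conv_of_real)
qed

text \<open>The usual heat kernel at time \<open>s / (4 * pi)\<close>. In this scaling it is the
  Fourier transform of the Gaussian \<open>exp (- (pi * s * (norm x)\<^sup>2))\<close>.\<close>

definition heat_kernel :: "real \<Rightarrow> 'a::euclidean_space \<Rightarrow> real" where
  "heat_kernel s z = (1 / sqrt s) ^ DIM('a) * exp (- (pi * (norm z)\<^sup>2 / s))"

lemma heat_kernel_measurable[measurable]: "heat_kernel s \<in> borel_measurable borel"
  unfolding heat_kernel_def by measurable

lemma heat_kernel_nonneg: "s > 0 \<Longrightarrow> heat_kernel s z \<ge> 0"
  unfolding heat_kernel_def by simp

lemma gauss_fourier:
  fixes w :: "'a::euclidean_space" assumes t: "t > 0"
  shows "integrable lborel (\<lambda>x::'a. complex_of_real (exp (- (pi * t * (norm x)\<^sup>2))) * unit_wave (x \<bullet> w))"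
      (is "integrable _ ?f")
    and "(\<integral>x. complex_of_real (exp (- (pi * t * (norm (x::'a))\<^sup>2))) * unit_wave (x \<bullet> w) \<partial>lborel)
       = complex_of_real (heat_kernel t w)"
proof -
  interpret P: product_sigma_finite "\<lambda>_::'a. lborel::real measure" ..
  let ?g = "\<lambda>b x. complex_of_real (exp (- (pi * t * x\<^sup>2))) * unit_wave (x * (w \<bullet> b))"
  let ?T = "\<lambda>f::'a\<Rightarrow>real. \<Sum>b\<in>Basis. f b *\<^sub>R b"
  have T: "?T \<in> Pi\<^sub>M Basis (\<lambda>_. lborel) \<rightarrow>\<^sub>M borel" by measurable
  have fp: "?f (?T x) = (\<Prod>b\<in>Basis. ?g b (x b))" for x :: "'a \<Rightarrow> real"
  proof -
    have "(norm (?T x))\<^sup>2 = (\<Sum>b\<in>Basis. (x b)\<^sup>2)"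
      by (simp add: norm_eq_sqrt_inner sum_nonneg power2_eq_square euclidean_inner[of "?T x" "?T x"])
    moreover have "?T x \<bullet> w = (\<Sum>b\<in>Basis. x b * (w \<bullet> b))"
      by (simp add: inner_sum_left inner_commute[of w])
    ultimately show ?thesis
      by (simp add: prod.distrib exp_sum[symmetric] of_real_exp sum_negf sum_distrib_left sum_divide_distrib)
  qed
  have "integrable (Pi\<^sub>M Basis (\<lambda>_. lborel)) (\<lambda>x. \<Prod>b\<in>Basis. ?g b (x b))"
    by (rule P.product_integrable_prod[OF finite_Basis], rule gauss_fourier_real(1)[OF t])
  then show I: "integrable lborel ?f"
    by (subst lborel_eq, subst integrable_distr_eq[OF T]) (auto simp: fp)
  have "integral\<^sup>L lborel ?f = (\<integral>x. (\<Prod>b\<in>Basis. ?g b (x b)) \<partial>Pi\<^sub>M Basis (\<lambda>_. lborel))"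
    by (subst lborel_eq, subst integral_distr[OF T]) (auto simp: fp)
  also have "\<dots> = (\<Prod>b\<in>Basis. integral\<^sup>L lborel (?g b))"
    by (rule P.product_integral_prod[OF finite_Basis], rule gauss_fourier_real(1)[OF t])
  also have "\<dots> = (\<Prod>b\<in>(Basis::'a set). complex_of_real (exp (- (pi * (w \<bullet> b)\<^sup>2 / t)) / sqrt t))"
    by (simp only: gauss_fourier_real(2)[OF t])
  also have "\<dots> = complex_of_real (heat_kernel t w)"
  proof -
    have "(norm w)\<^sup>2 = (\<Sum>b\<in>Basis. (w \<bullet> b)\<^sup>2)"
      by (simp add: norm_eq_sqrt_inner sum_nonneg power2_eq_square euclidean_inner[of w w])
    then show ?thesis unfolding heat_kernel_def
      by (simp only: of_real_prod[symmetric] prod_dividef exp_sum[symmetric, OF finite_Basis] prod_constant sum_negf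
           sum_distrib_left sum_divide_distrib power_one_over) (simp add: field_simps)
  qed
  finally show "integral\<^sup>L lborel ?f = complex_of_real (heat_kernel t w)" .
qed

lemma gauss_integral:
  assumes t: "t > 0"
  shows "integrable lborel (\<lambda>x::'a::euclidean_space. exp (- (pi * t * (norm x)\<^sup>2)))"
    and "(\<integral>x. exp (- (pi * t * (norm (x::'a))\<^sup>2)) \<partial>lborel) = (1 / sqrt t) ^ DIM('a)"
  using gauss_fourier[OF t, of "0::'a"]
    by (simp_all add: heat_kernel_def flip: of_real_power of_real_divide complex_of_real_integrable_eq)

lemma lborel_shift:
  fixes f :: "'a::euclidean_space \<Rightarrow> 'b::{banach, second_countable_topology}"
  shows "integrable lborel (\<lambda>x. f (x - a)) \<longleftrightarrow> integrable lborel f" "(\<integral>x. f (x - a) \<partial>lborel) = integral\<^sup>L lborel f"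
proof -
  have "integrable lborel (\<lambda>x. f (x + b))" if "integrable lborel f" for f :: "'a \<Rightarrow> 'b" and b
    using that integrable_distr[of "(+) b" lborel borel f]
    by (simp add: lborel_distr_plus add.commute[of b])
  from this[of f "-a"] this[of "\<lambda>x. f (x - a)" a]
  show *: "integrable lborel (\<lambda>x. f (x - a)) \<longleftrightarrow> integrable lborel f" by auto
  show "(\<integral>x. f (x - a) \<partial>lborel) = integral\<^sup>L lborel f"
  proof (cases "integrable lborel f")
    case True
    then have m: "f \<in> borel_measurable borel" by auto
    have "integral\<^sup>L (distr lborel borel ((+) (-a))) f = (\<integral>x. f (-a + x) \<partial>lborel)"
      by (rule integral_distr) (use m in auto)
    then show ?thesis by (simp add: lborel_distr_plus)
  qed (use * in \<open>simp add: not_integrable_integral_eq\<close>)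
qed

lemma nn_integral_lborel_shift:
  fixes f :: "'a::euclidean_space \<Rightarrow> ennreal"
  assumes "f \<in> borel_measurable borel"
  shows "(\<integral>\<^sup>+x. f (x - a) \<partial>lborel) = (\<integral>\<^sup>+x. f x \<partial>lborel)"
proof -
  have "integral\<^sup>N (distr lborel borel ((+) (-a))) f = (\<integral>\<^sup>+x. f (-a + x) \<partial>lborel)"
    by (rule nn_integral_distr) (use assms in auto)
  then show ?thesis by (simp add: lborel_distr_plus)
qed

lemma heat_kernel_integral:
  assumes s: "s > 0"
  shows "integrable lborel (heat_kernel s :: 'a::euclidean_space \<Rightarrow> real)"
    and "(\<integral>x. heat_kernel s (x::'a) \<partial>lborel) = 1"
    and "(\<integral>\<^sup>+x. ennreal (heat_kernel s (x::'a)) \<partial>lborel) = 1"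
proof -
  have eq: "heat_kernel s = (\<lambda>x::'a. (1 / sqrt s) ^ DIM('a) * exp (- (pi * (1/s) * (norm x)\<^sup>2)))"
    by (auto simp: heat_kernel_def)
  show 1: "integrable lborel (heat_kernel s :: 'a \<Rightarrow> real)"
    unfolding eq by (intro integrable_mult_right gauss_integral) (use s in auto)
  have "(\<integral>x. heat_kernel s (x::'a) \<partial>lborel) = (1 / sqrt s) ^ DIM('a) * (1 / sqrt (1/s)) ^ DIM('a)"
    unfolding eq integral_mult_right_zero by (subst gauss_integral(2)) (use s in auto)
  also have "\<dots> = 1" using s by (simp add: power_mult_distrib[symmetric] real_sqrt_divide)
  finally show 2: "(\<integral>x. heat_kernel s (x::'a) \<partial>lborel) = 1" .
  show "(\<integral>\<^sup>+x. ennreal (heat_kernel s (x::'a)) \<partial>lborel) = 1"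
    by (subst nn_integral_eq_integral[OF 1]) (use s 2 in \<open>auto simp: heat_kernel_nonneg\<close>)
qed

text \<open>The parallelogram identity about the midpoint \<open>?m\<close> splits the exponent into
  a part depending on \<open>u - v\<close> only and a Gaussian in \<open>w\<close> centred at
  \<open>?m\<close>, whose integral is known.\<close>

lemma heat_kernel_semigroup:
  fixes u v :: "'a::euclidean_space" assumes s: "s > 0"
  shows "(\<integral>w. heat_kernel s (u - w) * heat_kernel s (v - w) \<partial>lborel) = heat_kernel (2 * s) (u - v)"
    and "integrable lborel (\<lambda>w. heat_kernel s (u - w) * heat_kernel s (v - w))"
proof -
  let ?m = "(1/2) *\<^sub>R (u + v)"
  have n: "(norm (u - w))\<^sup>2 + (norm (v - w))\<^sup>2 = 2 * (norm (w - ?m))\<^sup>2 + (norm (u - v))\<^sup>2 / 2" for w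
    unfolding power2_norm_eq_inner
      by (simp add: inner_diff_left inner_diff_right inner_add_left inner_add_right inner_commute field_simps)
  have eq: "heat_kernel s (u - w) * heat_kernel s (v - w) =
     (heat_kernel (2 * s) (u - v) * (sqrt (2/s)) ^ DIM('a)) * exp (- (pi * (2/s) * (norm (w - ?m))\<^sup>2))" for w
  proof -
    have "exp (- (pi * (norm (u - w))\<^sup>2 / s)) * exp (- (pi * (norm (v - w))\<^sup>2 / s))
       = exp (- (pi * ((norm (u - w))\<^sup>2 + (norm (v - w))\<^sup>2) / s))"
      by (simp add: exp_add[symmetric] add_divide_distrib distrib_left)
    also have "\<dots> = exp (- (pi * (norm (u - v))\<^sup>2 / (2 * s))) * exp (- (pi * (2/s) * (norm (w - ?m))\<^sup>2))"
      unfolding n by (simp add: exp_add[symmetric]) (simp add: add_divide_distrib distrib_left mult_ac)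
    finally have 1: "exp (- (pi * (norm (u - w))\<^sup>2 / s)) * exp (- (pi * (norm (v - w))\<^sup>2 / s)) = \<dots>" .
    have 2: "1 / sqrt s * (1 / sqrt s) = 1 / sqrt (2 * s) * sqrt (2/s)"
      using s by (simp add: real_sqrt_mult real_sqrt_divide)
    have 3: "(1 / sqrt s) ^ DIM('a) * (1 / sqrt s) ^ DIM('a) = (1 / sqrt (2 * s)) ^ DIM('a) * sqrt (2/s) ^ DIM('a)"
      by (simp only: power_mult_distrib[symmetric] 2)
    have *: "(p * x) * (p * y) = ((q * z) * r) * t" if "x * y = z * t" "p * p = q * r" for p q r x y z t :: real
    proof -
      have "(p * x) * (p * y) = (p * p) * (x * y)" by (simp only: mult_ac)
      then show ?thesis unfolding that by (simp only: mult_ac)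
    qed
    show ?thesis unfolding heat_kernel_def by (rule *[OF 1 3])
  qed
  have i: "integrable lborel (\<lambda>w::'a. exp (- (pi * (2/s) * (norm (w - ?m))\<^sup>2)))"
    using gauss_integral(1)[of "2/s", where ?'a='a] s
      lborel_shift(1)[of "\<lambda>w::'a. exp (- (pi * (2/s) * (norm w)\<^sup>2))" ?m] by simp
  show "integrable lborel (\<lambda>w. heat_kernel s (u - w) * heat_kernel s (v - w))"
    unfolding eq using i by (rule integrable_mult_right)
  have "(\<integral>w. exp (- (pi * (2/s) * (norm ((w::'a) - ?m))\<^sup>2)) \<partial>lborel) = (1 / sqrt (2/s)) ^ DIM('a)"
    using gauss_integral(2)[of "2/s", where ?'a='a] s
      lborel_shift(2)[of "\<lambda>w::'a. exp (- (pi * (2/s) * (norm w)\<^sup>2))" ?m] by simp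
  then show "(\<integral>w. heat_kernel s (u - w) * heat_kernel s (v - w) \<partial>lborel) = heat_kernel (2 * s) (u - v)"
    unfolding eq integral_mult_right_zero using s by (simp add: power_one_over)
qed

section \<open>Energies of integral transforms through Gram kernels\<close>

abbreviation lborel2 :: "('a::euclidean_space \<times> 'a) measure" where
  "lborel2 \<equiv> lborel \<Otimes>\<^sub>M lborel"

lemma complex_pair_integral_mult:
  fixes f g :: "'a::euclidean_space \<Rightarrow> complex"
  assumes f: "integrable lborel f" and g: "integrable lborel g"
  shows "integrable lborel2 (\<lambda>(u, v). f u * g v)"
    and "(\<integral>p. f (fst p) * g (snd p) \<partial>lborel2) = integral\<^sup>L lborel f * integral\<^sup>L lborel g"
proof -
  have [measurable]: "f \<in> borel_measurable borel" "g \<in> borel_measurable borel" using f g by auto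
  show i: "integrable lborel2 (\<lambda>(u, v). f u * g v)"
  proof (rule lborel_pair.Fubini_integrable)
    show "(\<lambda>(u, v). f u * g v) \<in> borel_measurable lborel2" by measurable
    show "integrable lborel (\<lambda>x. \<integral>y. norm (case (x, y) of (u, v) \<Rightarrow> f u * g v) \<partial>lborel)"
      using f by (simp add: norm_mult)
    show "AE x in lborel. integrable lborel (\<lambda>y. case (x, y) of (u, v) \<Rightarrow> f u * g v)"
      using g by simp
  qed
  have "(\<integral>x. \<integral>y. f x * g y \<partial>lborel \<partial>lborel) = (\<integral>p. f (fst p) * g (snd p) \<partial>lborel2)"
    using lborel_pair.integral_fst'[OF i] unfolding case_prod_beta by simp
  then show "(\<integral>p. f (fst p) * g (snd p) \<partial>lborel2) = integral\<^sup>L lborel f * integral\<^sup>L lborel g"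
    by simp
qed

lemma cnj_measurable[measurable]: "cnj \<in> borel_measurable borel"
  by (intro borel_measurable_continuous_onI continuous_intros)

abbreviation L1norm :: "('a::euclidean_space \<Rightarrow> complex) \<Rightarrow> ennreal" where
  "L1norm f \<equiv> \<integral>\<^sup>+x. ennreal (cmod (f x)) \<partial>lborel"

abbreviation L2sq :: "('a::euclidean_space \<Rightarrow> complex) \<Rightarrow> ennreal" where
  "L2sq f \<equiv> \<integral>\<^sup>+x. ennreal ((cmod (f x))\<^sup>2) \<partial>lborel"

text \<open>Formally the squared L2 norm of the superposition of the functions
  \<open>\<lambda>x. k x u\<close> with coefficients \<open>h u\<close>, expanded as a double
  integral against their inner products.\<close>

abbreviation gram_form ::
    "('b::euclidean_space \<Rightarrow> 'a::euclidean_space \<Rightarrow> complex) \<Rightarrow> ('a \<Rightarrow> complex) \<Rightarrow> real" where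
  "gram_form k h \<equiv> Re (\<integral>p. h (fst p) * cnj (h (snd p)) * (\<integral>x. k x (fst p) * cnj (k x (snd p)) \<partial>lborel) \<partial>lborel2)"

text \<open>The squared modulus is a double integral over \<open>(u, v)\<close>, and Fubini moves
  the integral over \<open>x\<close> inside. The bound \<open>C\<close> on the absolute Gram kernel
  dominates the triple integral by \<open>C\<close> times the square of the L1 norm of
  \<open>h\<close>, so integrability of \<open>h\<close> suffices. The point is that the right side
  depends on \<open>k\<close> only through its Gram kernel.\<close>

lemma kernel_gram:
  fixes h :: "'a::euclidean_space \<Rightarrow> complex" and k :: "'b::euclidean_space \<Rightarrow> 'a \<Rightarrow> complex"
  assumes h: "integrable lborel h"
    and k[measurable]: "(\<lambda>(x, u). k x u) \<in> borel_measurable (borel \<Otimes>\<^sub>M borel)"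
    and kb: "\<And>x u. norm (k x u) \<le> D"
    and C: "\<And>u v. (\<integral>\<^sup>+x. ennreal (norm (k x u) * norm (k x v)) \<partial>lborel) \<le> ennreal C"
  shows "L2sq (\<lambda>x. \<integral>u. h u * k x u \<partial>lborel) =
     ennreal (gram_form k h)"
proof -
  interpret P: pair_sigma_finite lborel "lborel2 :: ('a \<times> 'a) measure" ..
  have [measurable]: "h \<in> borel_measurable borel" using h by auto
  let ?\<Phi> = "\<lambda>x p. (h (fst p) * k x (fst p)) * cnj (h (snd p) * k x (snd p))"
  have hk: "integrable lborel (\<lambda>u. h u * k x u)" for x
  proof (rule Bochner_Integration.integrable_bound[of _ "\<lambda>u. D *\<^sub>R h u"])
    show "integrable lborel (\<lambda>u. D *\<^sub>R h u)" using h by simp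
    show "(\<lambda>u. h u * k x u) \<in> borel_measurable lborel" by measurable
    show "AE u in lborel. norm (h u * k x u) \<le> norm (D *\<^sub>R h u)"
    proof (rule AE_I2)
      fix u
      have "norm (k x u) \<le> \<bar>D\<bar>" using kb[of x u] by linarith
      then show "norm (h u * k x u) \<le> norm (D *\<^sub>R h u)"
        by (simp add: norm_mult mult.commute[of "cmod (h u)"] mult_right_mono)
    qed
  qed
  have sq: "(\<integral>p. ?\<Phi> x p \<partial>lborel2) = complex_of_real ((cmod (\<integral>u. h u * k x u \<partial>lborel))\<^sup>2)" for x
  proof -
    have "integrable lborel (\<lambda>u. cnj (h u * k x u))" by (rule integrable_cnj[OF hk])
    from complex_pair_integral_mult(2)[OF hk[of x] this]
    show ?thesis by (simp add: complex_norm_square[symmetric] del: complex_cnj_mult)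
  qed
  have meas: "case_prod ?\<Phi> \<in> borel_measurable (lborel \<Otimes>\<^sub>M lborel2)" by measurable
  have int: "integrable (lborel \<Otimes>\<^sub>M lborel2) (case_prod ?\<Phi>)"
  proof (rule integrableI_bounded[OF meas])
    have "(\<integral>\<^sup>+x. ennreal (norm (case_prod ?\<Phi> x)) \<partial>(lborel \<Otimes>\<^sub>M lborel2))
       = (\<integral>\<^sup>+p. \<integral>\<^sup>+x. ennreal (norm (?\<Phi> x p)) \<partial>lborel \<partial>lborel2)"
      by (subst P.nn_integral_snd[symmetric]) (use meas in auto)
    also have "\<dots> \<le> (\<integral>\<^sup>+p. ennreal C * (ennreal (norm (h (fst p))) * ennreal (norm (h (snd p)))) \<partial>lborel2)"
    proof (rule nn_integral_mono)
      fix p :: "'a \<times> 'a"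
      have "(\<integral>\<^sup>+x. ennreal (norm (?\<Phi> x p)) \<partial>lborel) =
        (\<integral>\<^sup>+x. (ennreal (norm (h (fst p))) * ennreal (norm (h (snd p)))) * ennreal
          (norm (k x (fst p)) * norm (k x (snd p))) \<partial>lborel)"
        by (intro nn_integral_cong) (simp add: norm_mult ennreal_mult' mult_ac)
      also have "\<dots> = (ennreal (norm (h (fst p))) * ennreal (norm (h (snd p))))
          * (\<integral>\<^sup>+x. ennreal (norm (k x (fst p)) * norm (k x (snd p))) \<partial>lborel)"
        by (rule nn_integral_cmult) measurable
      also have "\<dots> \<le> (ennreal (norm (h (fst p))) * ennreal (norm (h (snd p)))) * ennreal C"
        by (rule mult_left_mono[OF C]) simp
      finally show "(\<integral>\<^sup>+x. ennreal (norm (?\<Phi> x p)) \<partial>lborel)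
          \<le> ennreal C * (ennreal (norm (h (fst p))) * ennreal (norm (h (snd p))))"
        by (simp add: mult.commute)
    qed
    also have "\<dots> = ennreal C * (\<integral>\<^sup>+u. \<integral>\<^sup>+v. ennreal (norm (h u)) * ennreal (norm (h v)) \<partial>lborel \<partial>lborel)"
      by (subst nn_integral_cmult, measurable, subst lborel.nn_integral_fst[symmetric]) auto
    also have "\<dots> = ennreal C * ((\<integral>\<^sup>+u. ennreal (norm (h u)) \<partial>lborel) * (\<integral>\<^sup>+u. ennreal (norm (h u)) \<partial>lborel))"
      by (simp add: nn_integral_cmult nn_integral_multc)
    also have "\<dots> < \<infinity>" using h by (auto simp: integrable_iff_bounded ennreal_mult_less_top)
    finally show "(\<integral>\<^sup>+x. ennreal (norm (case_prod ?\<Phi> x)) \<partial>(lborel \<Otimes>\<^sub>M lborel2)) < \<infinity>" .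
  qed
  have intR: "integrable lborel (\<lambda>x. (cmod (\<integral>u. h u * k x u \<partial>lborel))\<^sup>2)"
    using P.integrable_fst'[OF int] unfolding complex_of_real_integrable_eq[symmetric]
      by (simp add: sq del: complex_cnj_mult)
  have "L2sq (\<lambda>x. \<integral>u. h u * k x u \<partial>lborel) = ennreal (\<integral>x. (cmod (\<integral>u. h u * k x u \<partial>lborel))\<^sup>2 \<partial>lborel)"
    by (rule nn_integral_eq_integral[OF intR]) simp
  also have "(\<integral>x. (cmod (\<integral>u. h u * k x u \<partial>lborel))\<^sup>2 \<partial>lborel)
      = Re (\<integral>x. complex_of_real ((cmod (\<integral>u. h u * k x u \<partial>lborel))\<^sup>2) \<partial>lborel)"
    by (simp del: of_real_power)
  also have "(\<integral>x. complex_of_real ((cmod (\<integral>u. h u * k x u \<partial>lborel))\<^sup>2) \<partial>lborel) = (\<integral>x. \<integral>p. ?\<Phi> x p \<partial>lborel2 \<partial>lborel)"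
    by (simp only: sq)
  also have "\<dots> = (\<integral>p. \<integral>x. ?\<Phi> x p \<partial>lborel \<partial>lborel2)"
    by (rule P.Fubini_integral[symmetric, OF int])
  also have "\<dots> = (\<integral>p. h (fst p) * cnj (h (snd p)) * (\<integral>x. k x (fst p) * cnj (k x (snd p)) \<partial>lborel) \<partial>lborel2)"
    by (simp add: integral_mult_right_zero[symmetric] mult_ac del: integral_mult_right_zero integral_mult_right)
  finally show ?thesis .
qed

definition heat_mollify :: "real \<Rightarrow> ('a::euclidean_space \<Rightarrow> complex) \<Rightarrow> 'a \<Rightarrow> complex" where
  "heat_mollify s h w = (\<integral>u. h u * complex_of_real (heat_kernel s (u - w)) \<partial>lborel)"

definition fourier :: "('a::euclidean_space \<Rightarrow> complex) \<Rightarrow> 'a \<Rightarrow> complex" where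
  "fourier h x = (\<integral>u. h u * unit_wave (x \<bullet> u) \<partial>lborel)"

lemma heat_kernel_le:
  assumes "s > 0"
  shows "heat_kernel s (z::'a::euclidean_space) \<le> (1 / sqrt s) ^ DIM('a)"
  unfolding heat_kernel_def using assms by (intro mult_left_le) auto

lemma norm_exp_i[simp]: "norm (unit_wave r) = 1"
  by (simp add: norm_exp_eq_Re)

text \<open>The kernels \<open>exp (- \<pi> s |x|\<^sup>2 - 2\<pi>i x \<bullet> u)\<close> and \<open>heat_kernel s (u - w)\<close> have the same Gram kernel
  \<open>heat_kernel (2 s) (u - v)\<close>, so no convolution theorem is needed.\<close>

lemma fourier_gauss_weighted:
  fixes h :: "'a::euclidean_space \<Rightarrow> complex"
  assumes h: "integrable lborel h" and s: "s > 0"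
  shows "(\<integral>\<^sup>+x. ennreal ((cmod (fourier h x))\<^sup>2 * exp (- (2 * pi * s * (norm x)\<^sup>2))) \<partial>lborel) =
     L2sq (heat_mollify s h)"
proof -
  let ?k = "\<lambda>x u::'a. complex_of_real (exp (- (pi * s * (norm x)\<^sup>2))) * unit_wave (x \<bullet> u)"
  let ?l = "\<lambda>w u::'a. complex_of_real (heat_kernel s (u - w))"
  have e2: "exp (- (pi * s * (norm x)\<^sup>2)) * exp (- (pi * s * (norm x)\<^sup>2)) = exp (- (pi * (2 * s) * (norm x)\<^sup>2))"
      for x :: 'a
    by (simp add: exp_add[symmetric])
  have gram_k: "(\<integral>x. ?k x u * cnj (?k x v) \<partial>lborel) = complex_of_real (heat_kernel (2 * s) (u - v))" for u v
  proof -
    have "?k x u * cnj (?k x v) = complex_of_real (exp (- (pi * (2 * s) * (norm x)\<^sup>2))) * unit_wave (x \<bullet> (u - v))"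
        for x
    proof -
      let ?e = "\<lambda>r. unit_wave r"
      have "cnj (?e b) = exp (2 * complex_of_real pi * \<i> * complex_of_real b)" for b
        by (simp add: exp_cnj)
      then have "?e a * cnj (?e b) = ?e (a - b)" for a b
        by (simp only: exp_add[symmetric]) (simp add: algebra_simps)
      from this[of "x \<bullet> u" "x \<bullet> v"]
      show ?thesis unfolding e2[symmetric] inner_diff_right complex_cnj_mult complex_cnj_complex_of_real of_real_mult
        by (metis (no_types, lifting) mult.assoc mult.left_commute)
    qed
    then show ?thesis using gauss_fourier(2)[of "2 * s" "u - v"] s by simp
  qed
  have gram_l: "(\<integral>w. ?l w u * cnj (?l w v) \<partial>lborel) = complex_of_real (heat_kernel (2 * s) (u - v))" for u v
    unfolding complex_cnj_complex_of_real of_real_mult[symmetric] integral_complex_of_real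
    by (simp add: heat_kernel_semigroup[OF s])
  have 1: "L2sq (\<lambda>x. \<integral>u. h u * ?k x u \<partial>lborel) =
     ennreal (gram_form ?k h)"
  proof (rule kernel_gram[OF h])
    show "(\<lambda>(x, u). ?k x u) \<in> borel_measurable (borel \<Otimes>\<^sub>M borel)" by measurable
    show "norm (?k x u) \<le> 1" for x u using s by (simp add: norm_mult)
    show "(\<integral>\<^sup>+x. ennreal (norm (?k x u) * norm (?k x v)) \<partial>lborel) \<le> ennreal ((1 / sqrt (2 * s)) ^ DIM('a))" for u v
    proof -
      have "(\<integral>\<^sup>+x. ennreal (norm (?k x u) * norm (?k x v)) \<partial>lborel)
          = (\<integral>\<^sup>+x. ennreal (exp (- (pi * (2 * s) * (norm (x::'a))\<^sup>2))) \<partial>lborel)"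
        by (simp add: norm_mult e2)
      also have "\<dots> = ennreal ((1 / sqrt (2 * s)) ^ DIM('a))"
        using s by (subst nn_integral_eq_integral[OF gauss_integral(1)]) (auto simp: gauss_integral(2))
      finally show ?thesis by simp
    qed
  qed
  have 2: "L2sq (\<lambda>w. \<integral>u. h u * ?l w u \<partial>lborel) =
     ennreal (gram_form ?l h)"
  proof (rule kernel_gram[OF h])
    show "(\<lambda>(x, u). ?l x u) \<in> borel_measurable (borel \<Otimes>\<^sub>M borel)" by measurable
    show "norm (?l x u) \<le> (1 / sqrt s) ^ DIM('a)" for x u
      using heat_kernel_le[OF s, of "u - x"] heat_kernel_nonneg[OF s, of "u - x"] by (simp del: power_one_over)
    show "(\<integral>\<^sup>+w. ennreal (norm (?l w u) * norm (?l w v)) \<partial>lborel) \<le> ennreal ((1 / sqrt (2 * s)) ^ DIM('a))" for u v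
    proof -
      have "(\<integral>\<^sup>+w. ennreal (norm (?l w u) * norm (?l w v)) \<partial>lborel)
          = (\<integral>\<^sup>+w. ennreal (heat_kernel s (u - w) * heat_kernel s (v - w)) \<partial>lborel)"
        by (simp add: abs_of_nonneg heat_kernel_nonneg[OF s])
      also have "\<dots> = ennreal (heat_kernel (2 * s) (u - v))"
        by (subst nn_integral_eq_integral[OF heat_kernel_semigroup(2)[OF s]])
           (auto simp: heat_kernel_semigroup(1)[OF s] heat_kernel_nonneg[OF s])
      also have "\<dots> \<le> ennreal ((1 / sqrt (2 * s)) ^ DIM('a))"
        using s by (intro ennreal_leI heat_kernel_le) auto
      finally show ?thesis .
    qed
  qed
  have 3: "(cmod (\<integral>u. h u * ?k x u \<partial>lborel))\<^sup>2 = (cmod (fourier h x))\<^sup>2 * exp (- (2 * pi * s * (norm x)\<^sup>2))" for x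
  proof -
    have "(\<integral>u. h u * ?k x u \<partial>lborel) = complex_of_real (exp (- (pi * s * (norm x)\<^sup>2))) * fourier h x"
      unfolding fourier_def integral_mult_right_zero[symmetric] by (simp add: mult_ac)
    then show ?thesis using e2[of x] by (simp add: norm_mult power_mult_distrib mult_ac flip: power2_eq_square)
  qed
  show ?thesis using 1 2 unfolding gram_k gram_l 3 heat_mollify_def by simp
qed

section \<open>Averaging against the heat kernel\<close>

abbreviation heat_average :: "real \<Rightarrow> ('a::euclidean_space \<Rightarrow> ennreal) \<Rightarrow> 'a \<Rightarrow> ennreal" where
  "heat_average s f w \<equiv> \<integral>\<^sup>+u. f u * ennreal (heat_kernel s (u - w)) \<partial>lborel"

lemma heat_mollify_le_nn:
  assumes s: "s > 0"
  shows "ennreal (cmod (heat_mollify s h w)) \<le> heat_average s (\<lambda>u. ennreal (cmod (h u))) w"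
proof -
  \<comment> \<open>A non-integrable integrand has Bochner integral \<open>0\<close> by convention,
    and the bound is then trivial.\<close>
  have "ennreal (cmod (heat_mollify s h w)) \<le> L1norm (\<lambda>u. h u * complex_of_real (heat_kernel s (u - w)))"
    unfolding heat_mollify_def
    by (cases "integrable lborel (\<lambda>u. h u * complex_of_real (heat_kernel s (u - w)))")
       (auto intro: integral_norm_bound_ennreal simp: not_integrable_integral_eq)
  then show ?thesis by (simp add: norm_mult ennreal_mult' abs_of_nonneg heat_kernel_nonneg[OF s])
qed

lemma nn_heat_kernel_shift:
  assumes s: "s > 0"
  shows "(\<integral>\<^sup>+u. ennreal (heat_kernel s (u - w)) \<partial>lborel) = 1" "(\<integral>\<^sup>+u. ennreal (heat_kernel s (w - u)) \<partial>lborel) = 1"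
proof -
  show 1: "(\<integral>\<^sup>+u. ennreal (heat_kernel s (u - w)) \<partial>lborel) = 1"
    using nn_integral_lborel_shift[of "\<lambda>u. ennreal (heat_kernel s u)" w] heat_kernel_integral(3)[OF s] by simp
  have "heat_kernel s (w - u) = heat_kernel s (u - w)" for u
    by (simp add: heat_kernel_def norm_minus_commute)
  then show "(\<integral>\<^sup>+u. ennreal (heat_kernel s (w - u)) \<partial>lborel) = 1" using 1 by simp
qed

lemma nn_heat_mollify_tonelli:
  assumes s: "s > 0" and [measurable]: "f \<in> borel_measurable borel"
  shows "(\<integral>\<^sup>+w. heat_average s f w \<partial>lborel) = (\<integral>\<^sup>+u. f u \<partial>lborel)"
proof -
  have "(\<integral>\<^sup>+w. heat_average s f w \<partial>lborel) = (\<integral>\<^sup>+u. \<integral>\<^sup>+w. f u * ennreal (heat_kernel s (u - w)) \<partial>lborel \<partial>lborel)"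
    by (rule lborel_pair.Fubini') measurable
  also have "\<dots> = (\<integral>\<^sup>+u. f u \<partial>lborel)"
    by (simp add: nn_integral_cmult nn_heat_kernel_shift[OF s])
  finally show ?thesis .
qed

text \<open>Jensen's inequality for the probability density \<open>heat_kernel s (u - w)\<close> in
  \<open>u\<close>: Cauchy-Schwarz, with the kernel split into two square roots, bounds the squared
  average by the average of the square. Averaging preserves total mass by Tonelli, also when that
  mass is infinite.\<close>

lemma heat_mollify_L2_le:
  assumes s: "s > 0" and [measurable]: "h \<in> borel_measurable borel"
  shows "L2sq (heat_mollify s h) \<le> L2sq h"
proof -
  have "ennreal ((cmod (heat_mollify s h w))\<^sup>2) \<le> heat_average s (\<lambda>u. ennreal ((cmod (h u))\<^sup>2)) w" for w
  proof -
    let ?r = "\<lambda>u. ennreal (sqrt (heat_kernel s (u - w)))"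
    have r2: "?r u * ?r u = ennreal (heat_kernel s (u - w))" for u
      using heat_kernel_nonneg[OF s] by (subst ennreal_mult'[symmetric]) auto
    have "ennreal ((cmod (heat_mollify s h w))\<^sup>2) = (ennreal (cmod (heat_mollify s h w)))\<^sup>2"
      by (simp add: ennreal_power)
    also have "\<dots> \<le> (heat_average s (\<lambda>u. ennreal (cmod (h u))) w)\<^sup>2"
      by (rule power_mono[OF heat_mollify_le_nn[OF s]]) simp
    also have "\<dots> = (\<integral>\<^sup>+u. (ennreal (cmod (h u)) * ?r u) * ?r u \<partial>lborel)\<^sup>2"
      by (simp add: mult.assoc r2)
    also have "\<dots> \<le> (\<integral>\<^sup>+u. (ennreal (cmod (h u)) * ?r u)\<^sup>2 \<partial>lborel) * (\<integral>\<^sup>+u. (?r u)\<^sup>2 \<partial>lborel)"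
      by (rule Cauchy_Schwarz_nn_integral) measurable
    also have "\<dots> = heat_average s (\<lambda>u. ennreal ((cmod (h u))\<^sup>2)) w"
      unfolding power_mult_distrib power2_eq_square[of "?r _"] r2 nn_heat_kernel_shift[OF s]
      by (simp add: ennreal_power)
    finally show ?thesis .
  qed
  then have "L2sq (heat_mollify s h) \<le> (\<integral>\<^sup>+w. heat_average s (\<lambda>u. ennreal ((cmod (h u))\<^sup>2)) w \<partial>lborel)"
    by (intro nn_integral_mono)
  also have "\<dots> = L2sq h"
    by (rule nn_heat_mollify_tonelli[OF s]) measurable
  finally show ?thesis .
qed

lemma heat_mollify_measurable[measurable]:
  assumes [measurable]: "h \<in> borel_measurable borel"
  shows "heat_mollify s h \<in> borel_measurable borel"
  unfolding heat_mollify_def by measurable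

lemma heat_mollify_integrable_aux:
  assumes h: "integrable lborel h" and s: "s > 0"
  shows "integrable lborel (\<lambda>u. h u * complex_of_real (heat_kernel s (u - w)))"
proof (rule Bochner_Integration.integrable_bound[of _ "\<lambda>u. ((1 / sqrt s) ^ DIM('a)) *\<^sub>R h u"])
  have [measurable]: "h \<in> borel_measurable borel" using h by auto
  show "integrable lborel (\<lambda>u. ((1 / sqrt s) ^ DIM('a)) *\<^sub>R h u)" using h by (rule integrable_scaleR_right)
  show "(\<lambda>u. h u * complex_of_real (heat_kernel s (u - w))) \<in> borel_measurable lborel" by measurable
  show "AE u in lborel. norm (h u * complex_of_real (heat_kernel s (u - w)))
      \<le> norm (((1 / sqrt s) ^ DIM('a)) *\<^sub>R h u)"
    using s
    by (intro AE_I2) (simp add: norm_mult mult.commute[of "cmod (h _)"] mult_right_mono abs_of_nonneg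
      heat_kernel_nonneg[OF s] heat_kernel_le[OF s] del: power_one_over)
qed

lemma heat_mollify_diff:
  assumes "integrable lborel h" "integrable lborel h'" and s: "s > 0"
  shows "heat_mollify s (\<lambda>u. h u - h' u) w = heat_mollify s h w - heat_mollify s h' w"
  unfolding heat_mollify_def left_diff_distrib
  by (rule Bochner_Integration.integral_diff) (use assms heat_mollify_integrable_aux in auto)

lemma heat_mollify_L1_le:
  assumes s: "s > 0" and [measurable]: "h \<in> borel_measurable borel"
  shows "L1norm (heat_mollify s h) \<le> L1norm h"
proof -
  have "L1norm (heat_mollify s h) \<le> (\<integral>\<^sup>+w. heat_average s (\<lambda>u. ennreal (cmod (h u))) w \<partial>lborel)"
    by (intro nn_integral_mono heat_mollify_le_nn[OF s])
  also have "\<dots> = L1norm h"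
    by (rule nn_heat_mollify_tonelli[OF s]) measurable
  finally show ?thesis .
qed

section \<open>L1 convergence of heat averages\<close>

definition heat_approximable :: "('a::euclidean_space \<Rightarrow> complex) \<Rightarrow> bool" where
  "heat_approximable h \<longleftrightarrow>
     ((\<lambda>n. L1norm (\<lambda>w. heat_mollify (1 / Suc n) h w - h w)) \<longlonglongrightarrow> 0)"

text \<open>Averaging contracts the L1 norm, so the error for \<open>h\<close> exceeds the error for
  \<open>h'\<close> by at most twice the L1 distance of the two functions.\<close>

lemma heat_approximable_closed:
  assumes h: "integrable lborel h"
    and approx: "\<And>e. e > 0 \<Longrightarrow> \<exists>h'. integrable lborel h' \<and> heat_approximable h' \<and>
       L1norm (\<lambda>w. h w - h' w) < ennreal e"
  shows "heat_approximable h"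
  unfolding heat_approximable_def tendsto_iff ennreal_tendsto_0_iff
proof -
  have [measurable]: "h \<in> borel_measurable borel" using h by auto
  show "(\<lambda>n. L1norm (\<lambda>w. heat_mollify (1 / Suc n) h w - h w)) \<longlonglongrightarrow> 0"
  proof (rule order_tendstoI)
    fix a :: ennreal assume "0 < a"
    then obtain e where e: "0 < e" "ennreal e < a"
      by (metis ennreal_less_zero_iff ennreal_rat_dense ennreal_eq_0_iff less_le not_less)
    obtain h' where h': "integrable lborel h'" "heat_approximable h'" "L1norm (\<lambda>w. h w - h' w) < ennreal (e/3)"
      using approx[of "e/3"] e by auto
    have [measurable]: "h' \<in> borel_measurable borel" using h' by auto
    have "\<forall>\<^sub>F n in sequentially. L1norm (\<lambda>w. heat_mollify (1 / Suc n) h' w - h' w) < ennreal (e/3)"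
      using h'(2) unfolding heat_approximable_def by (rule order_tendstoD) (use e in simp)
    then show "\<forall>\<^sub>F n in sequentially. L1norm (\<lambda>w. heat_mollify (1 / Suc n) h w - h w) < a"
    proof eventually_elim
      case (elim n)
      let ?s = "1 / real (Suc n)"
      let ?A = "heat_mollify ?s (\<lambda>u. h u - h' u)" and ?B = "\<lambda>w. heat_mollify ?s h' w - h' w" and ?C = "\<lambda>w. h w - h' w"
      have s: "?s > 0" by simp
      have "L1norm (\<lambda>w. heat_mollify ?s h w - h w)
          \<le> (\<integral>\<^sup>+w. ennreal (cmod (?A w)) + ennreal (cmod (?B w)) + ennreal (cmod (?C w)) \<partial>lborel)"
      proof (intro nn_integral_mono)
        fix w
        have "cmod (heat_mollify ?s h w - h w)
            \<le> cmod (heat_mollify ?s h w - heat_mollify ?s h' w) + cmod (?B w) + cmod (?C w)"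
          by norm
        then show "ennreal (cmod (heat_mollify ?s h w - h w))
            \<le> ennreal (cmod (?A w)) + ennreal (cmod (?B w)) + ennreal (cmod (?C w))"
          unfolding heat_mollify_diff[OF h h'(1) s] by (simp add: ennreal_leI flip: ennreal_plus)
      qed
      also have "\<dots> = L1norm ?A + L1norm ?B + L1norm ?C"
        by (simp add: nn_integral_add)
      also have "\<dots> \<le> ennreal (e/3) + ennreal (e/3) + ennreal (e/3)"
      proof (intro add_mono)
        show "L1norm ?A \<le> ennreal (e/3)"
          using heat_mollify_L1_le[OF s, of "\<lambda>u. h u - h' u"] h'(3) by simp
      qed (use elim h'(3) in auto)
      also have "\<dots> = ennreal e" using e by (simp flip: ennreal_plus)
      also have "\<dots> < a" by (rule e)
      finally show ?case .
    qed
  qed simp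
qed

text \<open>For \<open>norm z \<ge> r\<close> one half of the exponent is bounded by its value at
  radius \<open>r\<close>, and the other half is the exponent of the kernel of scale
  \<open>2 * s\<close>. The power of \<open>sqrt 2\<close> compares the two normalising factors, and
  the kernel of scale \<open>2 * s\<close> has mass one.\<close>

lemma heat_kernel_tail:
  assumes s: "s > 0" and r: "r > 0"
  shows "(\<integral>\<^sup>+z. ennreal (heat_kernel s (z::'a::euclidean_space)) * indicator {z. norm z \<ge> r} z \<partial>lborel)
      \<le> ennreal (sqrt 2 ^ DIM('a) * exp (- (pi * r\<^sup>2 / (2 * s))))"
proof -
  let ?c = "sqrt 2 ^ DIM('a) * exp (- (pi * r\<^sup>2 / (2 * s)))"
  have "heat_kernel s z \<le> ?c * heat_kernel (2 * s) z" if "norm z \<ge> r" for z :: 'a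
  proof -
    have 1: "1 / sqrt s = sqrt 2 * (1 / sqrt (2 * s))" by (simp add: real_sqrt_mult)
    have 2: "r\<^sup>2 \<le> (norm z)\<^sup>2" using that r by (intro power_mono) auto
    have "exp (- (pi * (norm z)\<^sup>2 / s)) = exp (- (pi * (norm z)\<^sup>2 / (2 * s))) * exp (- (pi * (norm z)\<^sup>2 / (2 * s)))"
      using s by (simp add: exp_add[symmetric] field_simps)
    also have "\<dots> \<le> exp (- (pi * r\<^sup>2 / (2 * s))) * exp (- (pi * (norm z)\<^sup>2 / (2 * s)))"
      using s 2 by (intro mult_right_mono) (auto intro!: divide_right_mono mult_left_mono)
    finally have "(1 / sqrt s) ^ DIM('a) * exp (- (pi * (norm z)\<^sup>2 / s))
        \<le> (1 / sqrt s) ^ DIM('a) * (exp (- (pi * r\<^sup>2 / (2 * s))) * exp (- (pi * (norm z)\<^sup>2 / (2 * s))))"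
      using s by (intro mult_left_mono) auto
    then show ?thesis unfolding heat_kernel_def 1 power_mult_distrib by (simp add: mult_ac)
  qed
  then have "(\<integral>\<^sup>+z. ennreal (heat_kernel s (z::'a)) * indicator {z. norm z \<ge> r} z \<partial>lborel)
      \<le> (\<integral>\<^sup>+z. ennreal (?c * heat_kernel (2 * s) (z::'a)) \<partial>lborel)"
    by (intro nn_integral_mono) (auto split: split_indicator intro: ennreal_leI)
  also have "\<dots> = (\<integral>\<^sup>+z. ennreal ?c * ennreal (heat_kernel (2 * s) (z::'a)) \<partial>lborel)"
    by (intro nn_integral_cong ennreal_mult') simp
  also have "\<dots> = ennreal ?c"
    using s by (subst nn_integral_cmult) (auto simp: heat_kernel_integral(3))
  finally show ?thesis .
qed

lemma heat_mollify_indicator: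
  fixes U :: "'a::euclidean_space set"
  assumes U: "U \<in> sets borel" "emeasure lborel U < \<infinity>" and s: "s > 0"
  defines "f \<equiv> \<lambda>w. Re (heat_mollify s (\<lambda>u. indicator U u *\<^sub>R 1) w)"
  shows "heat_mollify s (\<lambda>u. indicator U u *\<^sub>R 1) w = complex_of_real (f w)"
    and "0 \<le> f w" and "f w \<le> 1"
    and "ennreal (f w) = heat_average s (indicator U) w"
proof -
  let ?f = "\<integral>u. indicator U u * heat_kernel s (u - w) \<partial>lborel"
  have i: "integrable lborel (\<lambda>u. indicator U u * heat_kernel s (u - w))"
  proof (rule Bochner_Integration.integrable_bound[of _ "\<lambda>u. heat_kernel s (u - w)"])
    show "integrable lborel (\<lambda>u. heat_kernel s (u - w))" unfolding lborel_shift by (rule heat_kernel_integral[OF s])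
  qed (use U in \<open>auto split: split_indicator\<close>)
  have hm: "heat_mollify s (\<lambda>u. indicator U u *\<^sub>R 1) w = complex_of_real ?f"
    unfolding heat_mollify_def integral_complex_of_real[symmetric]
    by (rule Bochner_Integration.integral_cong) (auto split: split_indicator)
  then have f: "f w = ?f" by (simp add: f_def)
  show "heat_mollify s (\<lambda>u. indicator U u *\<^sub>R 1) w = complex_of_real (f w)" unfolding hm f ..
  show "0 \<le> f w" unfolding f by (intro integral_nonneg_AE AE_I2) (simp add: heat_kernel_nonneg[OF s])
  show e: "ennreal (f w) = heat_average s (indicator U) w"
    unfolding f using i
    by (subst nn_integral_eq_integral[symmetric])
      (auto intro!: nn_integral_cong AE_I2 simp: heat_kernel_nonneg[OF s] split: split_indicator)
  have "ennreal (f w) \<le> 1"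
    unfolding e nn_heat_kernel_shift(1)[OF s, of w, symmetric]
    by (intro nn_integral_mono) (auto split: split_indicator)
  then show "f w \<le> 1" by simp
qed

text \<open>Only \<open>liminf \<ge> 1\<close> on \<open>U\<close> has to be checked: total masses agree, so the mass lost inside \<open>U\<close> equals the
  mass appearing outside.\<close>

lemma heat_approximable_open:
  assumes U: "open U" "emeasure lborel U < \<infinity>"
  shows "heat_approximable (\<lambda>u::'a::euclidean_space. indicator U u *\<^sub>R (1::complex))"
proof -
  have Ub[measurable]: "U \<in> sets borel" using U by auto
  let ?s = "\<lambda>n. 1 / real (Suc n)" and ?\<chi> = "\<lambda>u. indicator U u *\<^sub>R (1::complex)"
  define f where "f n w = Re (heat_mollify (?s n) ?\<chi> w)" for n w
  have "?s n > 0" for n by simp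
  note f = heat_mollify_indicator[OF Ub U(2) this, folded f_def]
  have fm[measurable]: "f n \<in> borel_measurable borel" for n
    unfolding f_def[abs_def] by simp
  have tot: "(\<integral>\<^sup>+w. ennreal (f n w) \<partial>lborel) = emeasure lborel U" for n
    unfolding f(4) by (subst nn_heat_mollify_tonelli) auto
  have lim: "(\<lambda>n. f n w) \<longlonglongrightarrow> 1" if w: "w \<in> U" for w
  proof -
    obtain r where r: "r > 0" "ball w r \<subseteq> U" using U(1) w openE by blast
    let ?t = "\<lambda>n (u::'a). ennreal (heat_kernel (?s n) u) * indicator {z. norm z \<ge> r} u"
    \<comment> \<open>As \<open>ball w r\<close> lies in \<open>U\<close>, the part of the kernel's
      mass that \<open>f n w\<close> misses lies at distance at least \<open>r\<close> from
      \<open>w\<close>.\<close>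
    have b: "1 - f n w \<le> sqrt 2 ^ DIM('a) * exp (- (pi * r\<^sup>2 / (2 * ?s n)))" for n
    proof -
      have s: "?s n > 0" by simp
      have "(1::ennreal) = (\<integral>\<^sup>+u. ennreal (heat_kernel (?s n) (u - w)) \<partial>lborel)"
        using nn_heat_kernel_shift[OF s] by simp
      also have "\<dots> \<le> (\<integral>\<^sup>+u. indicator U u * ennreal (heat_kernel (?s n) (u - w)) + ?t n (u - w) \<partial>lborel)"
        using r(2) by (intro nn_integral_mono)
          (auto simp: dist_norm norm_minus_commute subset_iff split: split_indicator)
      also have "\<dots> = ennreal (f n w) + (\<integral>\<^sup>+u. ?t n (u - w) \<partial>lborel)"
        unfolding f(4) by (rule nn_integral_add) auto
      also have "(\<integral>\<^sup>+u. ?t n (u - w) \<partial>lborel) = (\<integral>\<^sup>+u. ?t n u \<partial>lborel)"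
        by (rule nn_integral_lborel_shift[of "?t n"]) measurable
      also have "\<dots> \<le> ennreal (sqrt 2 ^ DIM('a) * exp (- (pi * r\<^sup>2 / (2 * ?s n))))"
        by (rule heat_kernel_tail[OF s r(1)])
      finally have "ennreal 1 \<le> ennreal (f n w + sqrt 2 ^ DIM('a) * exp (- (pi * r\<^sup>2 / (2 * ?s n))))"
        using f(2)[of n w] by (simp add: add_left_mono)
      then show ?thesis using f(2)[of n w] by (subst (asm) ennreal_le_iff) auto
    qed
    have "(\<lambda>n. sqrt 2 ^ DIM('a) * exp (- (pi * r\<^sup>2 / (2 * ?s n)))) \<longlonglongrightarrow> 0"
      using r(1) by real_asymp
    moreover have "\<forall>\<^sub>F n in sequentially. 0 \<le> 1 - f n w"
      using f(3)[of _ w] by (intro always_eventually allI) simp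
    moreover have "\<forall>\<^sub>F n in sequentially. 1 - f n w \<le> sqrt 2 ^ DIM('a) * exp (- (pi * r\<^sup>2 / (2 * ?s n)))"
      by (intro always_eventually allI b)
    ultimately have "(\<lambda>n. 1 - f n w) \<longlonglongrightarrow> 0"
      using tendsto_sandwich[of "\<lambda>_. 0" "\<lambda>n. 1 - f n w" sequentially
        "\<lambda>n. sqrt 2 ^ DIM('a) * exp (- (pi * r\<^sup>2 / (2 * ?s n)))" 0] by blast
    from tendsto_diff[OF tendsto_const this, of 1] show ?thesis by simp
  qed
  let ?a = "\<lambda>n. \<integral>\<^sup>+w. ennreal (f n w) * indicator U w \<partial>lborel"
  have fin: "emeasure lborel U \<noteq> \<infinity>" using U by auto
  have a: "?a \<longlonglongrightarrow> (\<integral>\<^sup>+w. indicator U w \<partial>lborel)"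
  proof (rule nn_integral_dominated_convergence[where w="indicator U"])
    show "AE x in lborel. (\<lambda>n. ennreal (f n x) * indicator U x) \<longlonglongrightarrow> indicator U x"
    proof (rule AE_I2)
      fix x show "(\<lambda>n. ennreal (f n x) * indicator U x) \<longlonglongrightarrow> indicator U x"
        using tendsto_ennrealI[OF lim[of x]] by (auto split: split_indicator)
    qed
  qed (use U f(3) in \<open>auto split: split_indicator\<close>)
  have a_le: "?a n \<le> emeasure lborel U" for n
  proof -
    have "?a n \<le> (\<integral>\<^sup>+w. indicator U w \<partial>lborel)"
      using f(3) by (intro nn_integral_mono) (auto split: split_indicator)
    then show ?thesis by simp
  qed
  have "L1norm (\<lambda>w. heat_mollify (?s n) ?\<chi> w - indicator U w *\<^sub>R 1) = 2 * (emeasure lborel U - ?a n)" for n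
  proof -
    \<comment> \<open>Subtraction in \<open>ennreal\<close> undoes addition of finite values only;
      this is where the finite measure of \<open>U\<close> enters.\<close>
    have sub: "X = m - c" if "X + c = m" "c \<le> m" "m \<noteq> \<infinity>" for X c m :: ennreal
    proof -
      have "c \<noteq> top" using that by (auto simp: top_unique)
      then show ?thesis unfolding that(1)[symmetric] by simp
    qed
    have 1: "(\<integral>\<^sup>+w. ennreal (1 - f n w) * indicator U w \<partial>lborel) = emeasure lborel U - ?a n"
    proof (rule sub[OF _ a_le fin])
      have "(\<integral>\<^sup>+w. ennreal (1 - f n w) * indicator U w \<partial>lborel) + ?a n
          = (\<integral>\<^sup>+w. ennreal (1 - f n w) * indicator U w + ennreal (f n w) * indicator U w \<partial>lborel)"
        by (rule nn_integral_add[symmetric]) auto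
      also have "\<dots> = (\<integral>\<^sup>+w. indicator U w \<partial>lborel)"
        using f(2,3) by (intro nn_integral_cong) (auto split: split_indicator simp flip: ennreal_plus)
      finally show "(\<integral>\<^sup>+w. ennreal (1 - f n w) * indicator U w \<partial>lborel) + ?a n = emeasure lborel U" by simp
    qed
    have 2: "(\<integral>\<^sup>+w. ennreal (f n w) * indicator (- U) w \<partial>lborel) = emeasure lborel U - ?a n"
    proof (rule sub[OF _ a_le fin])
      have "(\<integral>\<^sup>+w. ennreal (f n w) * indicator (- U) w \<partial>lborel) + ?a n
          = (\<integral>\<^sup>+w. ennreal (f n w) * indicator (- U) w + ennreal (f n w) * indicator U w \<partial>lborel)"
        by (rule nn_integral_add[symmetric]) auto
      also have "\<dots> = (\<integral>\<^sup>+w. ennreal (f n w) \<partial>lborel)"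
        by (intro nn_integral_cong) (auto split: split_indicator)
      finally show "(\<integral>\<^sup>+w. ennreal (f n w) * indicator (- U) w \<partial>lborel) + ?a n = emeasure lborel U" by (simp add: tot)
    qed
    have "ennreal (cmod (heat_mollify (?s n) ?\<chi> w - indicator U w *\<^sub>R 1)) =
       ennreal (1 - f n w) * indicator U w + ennreal (f n w) * indicator (- U) w" for w
    proof -
      have "cmod (complex_of_real (f n w) - 1) = \<bar>f n w - 1\<bar>"
        by (metis norm_of_real of_real_1 of_real_diff)
      then have "cmod (complex_of_real (f n w) - 1) = 1 - f n w" using f(3)[of n w] by simp
      then show ?thesis unfolding f(1) using f(2)[of n w] by (cases "w \<in> U") auto
    qed
    then have "L1norm (\<lambda>w. heat_mollify (?s n) ?\<chi> w - indicator U w *\<^sub>R 1) =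
       (\<integral>\<^sup>+w. ennreal (1 - f n w) * indicator U w + ennreal (f n w) * indicator (- U) w \<partial>lborel)"
      by (simp only:)
    also have "\<dots> = (\<integral>\<^sup>+w. ennreal (1 - f n w) * indicator U w \<partial>lborel)
        + (\<integral>\<^sup>+w. ennreal (f n w) * indicator (- U) w \<partial>lborel)"
      by (rule nn_integral_add) auto
    finally show ?thesis unfolding 1 2 by (simp only: mult_2)
  qed
  moreover have "(\<lambda>n. 2 * (emeasure lborel U - ?a n)) \<longlonglongrightarrow> 2 * (emeasure lborel U - emeasure lborel U)"
    using a fin by (intro ennreal_tendsto_cmult tendsto_diff_ennreal tendsto_const) auto
  ultimately show ?thesis unfolding heat_approximable_def using fin by (simp add: ennreal_minus_eq_0)
qed

text \<open>By outer regularity \<open>A\<close> has open supersets \<open>U\<close> with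
  \<open>U - A\<close> of small measure, and this measure is the L1 distance of the two
  indicators.\<close>

lemma heat_approximable_indicator:
  assumes A: "A \<in> sets borel" "emeasure lborel A < \<infinity>"
  shows "heat_approximable (\<lambda>u::'a::euclidean_space. indicator A u *\<^sub>R (1::complex))"
proof (rule heat_approximable_closed)
  have int: "integrable lborel (\<lambda>u::'a. indicator B u *\<^sub>R (1::complex))" if "B \<in> sets borel" "emeasure lborel B < \<infinity>"
      for B
    using that by (intro integrable_scaleR_left integrable_real_indicator) auto
  show "integrable lborel (\<lambda>u::'a. indicator A u *\<^sub>R (1::complex))" by (rule int[OF A])
  fix e :: real assume "e > 0"
  then obtain U where U: "open U" "A \<subseteq> U" "emeasure lborel (U - A) < e" using outer_regular_lborel[OF A(1)] by blast
  have [measurable]: "U \<in> sets borel" using U by auto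
  have "emeasure lborel U = emeasure lborel A + emeasure lborel (U - A)"
    using U A by (subst plus_emeasure) (auto intro!: arg_cong[where f="emeasure lborel"])
  also have "\<dots> < \<infinity>" using A U(3) by (auto simp: less_top[symmetric])
  finally have fU: "emeasure lborel U < \<infinity>" .
  have "L1norm (\<lambda>w. indicator A w *\<^sub>R 1 - indicator U w *\<^sub>R 1) = (\<integral>\<^sup>+w. indicator (U - A) w \<partial>lborel)"
    using U(2) by (intro nn_integral_cong) (auto split: split_indicator)
  also have "\<dots> = emeasure lborel (U - A)" using A U by (intro nn_integral_indicator) auto
  finally have "L1norm (\<lambda>w. indicator A w *\<^sub>R 1 - indicator U w *\<^sub>R 1) < ennreal e" using U(3) by simp
  then show "\<exists>h'. integrable lborel h' \<and> heat_approximable h' \<and> L1norm (\<lambda>w. indicator A w *\<^sub>R 1 - h' w) < ennreal e"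
    using heat_approximable_open[OF U(1) fU] int[of U] fU by (intro exI[of _ "\<lambda>u. indicator U u *\<^sub>R 1"]) auto
qed

lemma heat_approximable_integrable:
  assumes h: "integrable lborel (h :: 'a::euclidean_space \<Rightarrow> complex)"
  shows "heat_approximable h"
  using h
proof (induction rule: integrable_induct)
  case (base A c)
  have A[measurable]: "A \<in> sets borel" using base by simp
  let ?h = "\<lambda>u. indicator A u *\<^sub>R (1::complex)"
  have 1: "heat_mollify s (\<lambda>u. indicator A u *\<^sub>R c) w = heat_mollify s ?h w * c" for s w
    unfolding heat_mollify_def integral_mult_left_zero[symmetric]
    by (rule Bochner_Integration.integral_cong) (auto split: split_indicator)
  have 2: "L1norm (\<lambda>w. heat_mollify s (\<lambda>u. indicator A u *\<^sub>R c) w - indicator A w *\<^sub>R c) =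
    ennreal (cmod c) * L1norm (\<lambda>w. heat_mollify s ?h w - ?h w)" for s
  proof -
    have "heat_mollify s ?h w * c - indicator A w *\<^sub>R c = c * (heat_mollify s ?h w - ?h w)" for w
      by (simp add: right_diff_distrib)
    then have "L1norm (\<lambda>w. heat_mollify s (\<lambda>u. indicator A u *\<^sub>R c) w - indicator A w *\<^sub>R c) =
      (\<integral>\<^sup>+w. ennreal (cmod c) * ennreal (cmod (heat_mollify s ?h w - ?h w)) \<partial>lborel)"
      unfolding 1 by (intro nn_integral_cong) (metis norm_mult ennreal_mult' norm_ge_zero)
    moreover have "(\<lambda>w. heat_mollify s ?h w - ?h w) \<in> borel_measurable borel"
      by (intro borel_measurable_diff heat_mollify_measurable) auto
    then have "(\<lambda>w. ennreal (cmod (heat_mollify s ?h w - ?h w))) \<in> borel_measurable lborel"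
      by measurable
    ultimately show ?thesis by (simp only: nn_integral_cmult)
  qed
  have "(\<lambda>n. ennreal (cmod c) * L1norm (\<lambda>w. heat_mollify (1 / Suc n) ?h w - ?h w)) \<longlonglongrightarrow> ennreal (cmod c) * 0"
    using heat_approximable_indicator[OF A] base(2) unfolding heat_approximable_def
    by (intro ennreal_tendsto_cmult) auto
  then show ?case unfolding heat_approximable_def 2 by simp
next
  case (add f g)
  have [measurable]: "f \<in> borel_measurable borel" "g \<in> borel_measurable borel" using add by auto
  let ?F = "\<lambda>n w. heat_mollify (1 / real (Suc n)) f w - f w"
  let ?G = "\<lambda>n w. heat_mollify (1 / real (Suc n)) g w - g w"
  let ?H = "\<lambda>n w. heat_mollify (1 / real (Suc n)) (\<lambda>u. f u + g u) w - (f w + g w)"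
  have sum: "heat_mollify s (\<lambda>u. f u + g u) w = heat_mollify s f w + heat_mollify s g w" if "s > 0" for s w
    unfolding heat_mollify_def distrib_right
    by (rule Bochner_Integration.integral_add) (use heat_mollify_integrable_aux add that in auto)
  have le: "L1norm (?H n) \<le> L1norm (?F n) + L1norm (?G n)" for n
  proof -
    have "L1norm (?H n) \<le> (\<integral>\<^sup>+w. ennreal (cmod (?F n w)) + ennreal (cmod (?G n w)) \<partial>lborel)"
    proof (rule nn_integral_mono)
      fix w
      have "cmod (?H n w) \<le> cmod (?F n w) + cmod (?G n w)" by (subst sum) (auto simp: norm_diff_triangle_ineq)
      then show "ennreal (cmod (?H n w)) \<le> ennreal (cmod (?F n w)) + ennreal (cmod (?G n w))"
        by (simp add: ennreal_leI del: of_nat_Suc flip: ennreal_plus)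
    qed
    also have "\<dots> = L1norm (?F n) + L1norm (?G n)"
      by (rule nn_integral_add) auto
    finally show ?thesis .
  qed
  have "(\<lambda>n. L1norm (?F n) + L1norm (?G n)) \<longlonglongrightarrow> 0 + 0"
    using add.IH unfolding heat_approximable_def by (intro tendsto_add)
  then have lim0: "(\<lambda>n. L1norm (?F n) + L1norm (?G n)) \<longlonglongrightarrow> 0" by simp
  have e1: "\<forall>\<^sub>F n in sequentially. 0 \<le> L1norm (?H n)" by simp
  have e2: "\<forall>\<^sub>F n in sequentially. L1norm (?H n) \<le> L1norm (?F n) + L1norm (?G n)"
    by (intro always_eventually allI le)
  show ?case unfolding heat_approximable_def
    by (rule tendsto_sandwich[OF e1 e2 tendsto_const lim0])
next
  case (lim f s)
  have [measurable]: "f \<in> borel_measurable borel" "\<And>i. s i \<in> borel_measurable borel" using lim by auto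
  have "(\<lambda>i. L1norm (\<lambda>w. f w - s i w)) \<longlonglongrightarrow> (\<integral>\<^sup>+w. 0 \<partial>(lborel :: 'a measure))"
  \<comment> \<open>The approximants supplied by \<open>integrable_induct\<close> satisfy
    \<open>norm (s i x) \<le> 2 * norm (f x)\<close>, and the triangle inequality adds one more
    \<open>norm (f x)\<close>.\<close>
  proof (rule nn_integral_dominated_convergence[where w="\<lambda>x. 3 * ennreal (cmod (f x))"])
    have "L1norm f < \<infinity>" using lim(4) by (simp add: integrable_iff_bounded)
    then show "(\<integral>\<^sup>+x. 3 * ennreal (cmod (f x)) \<partial>lborel) < \<infinity>"
      by (simp add: nn_integral_cmult ennreal_mult_less_top)
    have "cmod (f x - s i x) \<le> 3 * cmod (f x)" for i x
      using lim(3)[of x i] norm_triangle_ineq4[of "f x" "s i x"] by simp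
    from ennreal_leI[OF this]
    show "AE x in lborel. ennreal (cmod (f x - s i x)) \<le> 3 * ennreal (cmod (f x))" for i
      by (intro AE_I2) (simp add: ennreal_mult)
    show "AE x in lborel. (\<lambda>i. ennreal (cmod (f x - s i x))) \<longlonglongrightarrow> 0"
    proof (rule AE_I2)
      fix x
      have "(\<lambda>i. cmod (f x - s i x)) \<longlonglongrightarrow> cmod (f x - f x)" using lim(2)[of x] by (intro tendsto_intros) simp
      from tendsto_ennrealI[OF this] show "(\<lambda>i. ennreal (cmod (f x - s i x))) \<longlonglongrightarrow> 0" by simp
    qed
  qed auto
  then have c: "(\<lambda>i. L1norm (\<lambda>w. f w - s i w)) \<longlonglongrightarrow> 0" by simp
  show ?case
  proof (rule heat_approximable_closed[OF lim(4)])
    fix e :: real assume "e > 0"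
    then have "\<forall>\<^sub>F i in sequentially. L1norm (\<lambda>w. f w - s i w) < ennreal e"
      by (intro order_tendstoD(2)[OF c]) simp
    then obtain i where "L1norm (\<lambda>w. f w - s i w) < ennreal e"
      using eventually_happens' sequentially_bot by blast
    then show "\<exists>h'. integrable lborel h' \<and> heat_approximable h' \<and> L1norm (\<lambda>w. f w - h' w) < ennreal e"
      using lim by blast
  qed
qed

text \<open>With \<open>h\<close> only integrable, convergence holds in L1. A subsequence converges
  almost everywhere, and Fatou's lemma for the squares does the rest, whether or not the left side
  is finite.\<close>

lemma heat_mollify_L2_liminf:
  assumes h: "integrable lborel (h :: 'a::euclidean_space \<Rightarrow> complex)"
  obtains r :: "nat \<Rightarrow> nat" where "strict_mono r"
    "L2sq h \<le> liminf (\<lambda>n. L2sq (\<lambda>w. heat_mollify (1 / Suc (r n)) h w))"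
proof -
  have [measurable]: "h \<in> borel_measurable borel" using h by auto
  let ?u = "\<lambda>n w. heat_mollify (1 / Suc n) h w - h w"
  have "L1norm (heat_mollify (1 / Suc n) h) < \<infinity>" for n
    using heat_mollify_L1_le[of "1 / Suc n" h] h by (simp add: integrable_iff_bounded le_less_trans)
  then have "integrable lborel (heat_mollify (1 / Suc n) h)" for n
    by (intro integrableI_bounded) auto
  then have int: "integrable lborel (?u n)" for n using h by simp
  have "(\<lambda>n. ennreal (\<integral>w. cmod (?u n w) \<partial>lborel)) \<longlonglongrightarrow> ennreal 0"
    using heat_approximable_integrable[OF h] unfolding heat_approximable_def
    by (subst nn_integral_eq_integral[symmetric]) (use int in auto)
  then have "(\<lambda>n. \<integral>w. cmod (?u n w) \<partial>lborel) \<longlonglongrightarrow> 0"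
    by (subst (asm) tendsto_ennreal_iff) auto
  from tendsto_L1_AE_subseq[OF int this]
  obtain r where r: "strict_mono r" "AE w in lborel. (\<lambda>n. ?u (r n) w) \<longlonglongrightarrow> 0" by blast
  have "L2sq h = (\<integral>\<^sup>+w. liminf (\<lambda>n. ennreal ((cmod (heat_mollify (1 / Suc (r n)) h w))\<^sup>2)) \<partial>lborel)"
  proof (rule nn_integral_cong_AE)
    show "AE w in lborel. ennreal ((cmod (h w))\<^sup>2)
        = liminf (\<lambda>n. ennreal ((cmod (heat_mollify (1 / Suc (r n)) h w))\<^sup>2))"
      using r(2)
    proof eventually_elim
      case (elim w)
      from tendsto_add[OF elim tendsto_const[of "h w"]]
      have "(\<lambda>n. heat_mollify (1 / Suc (r n)) h w) \<longlonglongrightarrow> h w" by simp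
      then have "(\<lambda>n. ennreal ((cmod (heat_mollify (1 / Suc (r n)) h w))\<^sup>2)) \<longlonglongrightarrow> ennreal ((cmod (h w))\<^sup>2)"
        by (intro tendsto_intros tendsto_ennrealI)
      then show ?case by (metis lim_imp_Liminf sequentially_bot)
    qed
  qed
  also have "\<dots> \<le> liminf (\<lambda>n. L2sq (\<lambda>w. heat_mollify (1 / Suc (r n)) h w))"
    by (rule nn_integral_liminf) auto
  finally show ?thesis using that r(1) by blast
qed

section \<open>Plancherel's identity in [0, infinity]\<close>

lemma fourier_measurable[measurable]:
  assumes [measurable]: "h \<in> borel_measurable borel"
  shows "fourier h \<in> borel_measurable borel"
  unfolding fourier_def by measurable

text \<open>For the upper bound, the Gaussian weights tend to one, so Fatou bounds the energy of the
  transform by the lower limit of the energies of the heat averages, and averaging contracts the L2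
  norm. For the lower bound, the energy of \<open>h\<close> is at most such a lower limit, and each
  weight is at most one.\<close>

theorem plancherel:
  fixes h :: "'a::euclidean_space \<Rightarrow> complex"
  assumes h: "integrable lborel h"
  shows "L2sq (fourier h) = L2sq h"
proof (rule antisym)
  have [measurable]: "h \<in> borel_measurable borel" using h by auto
  let ?q = "\<lambda>n x. ennreal ((cmod (fourier h x))\<^sup>2 * exp (- (2 * pi * (1 / Suc n) * (norm x)\<^sup>2)))"
  have "L2sq (fourier h) = (\<integral>\<^sup>+x. liminf (\<lambda>n. ?q n x) \<partial>lborel)"
  proof (rule nn_integral_cong)
    fix x :: 'a
    have "(\<lambda>n. exp (- (2 * pi * (1 / Suc n) * (norm x)\<^sup>2))) \<longlonglongrightarrow> 1" by real_asymp
    from tendsto_mult[OF tendsto_const[of "(cmod (fourier h x))\<^sup>2"] this]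
    have "(\<lambda>n. ?q n x) \<longlonglongrightarrow> ennreal ((cmod (fourier h x))\<^sup>2)"
      by (intro tendsto_ennrealI) simp
    then show "ennreal ((cmod (fourier h x))\<^sup>2) = liminf (\<lambda>n. ?q n x)"
      by (metis lim_imp_Liminf sequentially_bot)
  qed
  also have "\<dots> \<le> liminf (\<lambda>n. \<integral>\<^sup>+x. ?q n x \<partial>lborel)" by (rule nn_integral_liminf) measurable
  also have "\<dots> \<le> liminf (\<lambda>n::nat. L2sq (\<lambda>u. h u))"
    by (intro Liminf_mono always_eventually allI)
      (subst fourier_gauss_weighted[OF h], auto intro!: heat_mollify_L2_le)
  finally show "L2sq (fourier h) \<le> L2sq h" by (simp add: Liminf_const)
  obtain r where r: "L2sq h \<le> liminf (\<lambda>n. L2sq (\<lambda>w. heat_mollify (1 / Suc (r n)) h w))"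
    using heat_mollify_L2_liminf[OF h] by blast
  also have "\<dots> \<le> liminf (\<lambda>n::nat. L2sq (\<lambda>x. fourier h x))"
    by (intro Liminf_mono always_eventually allI)
      (subst fourier_gauss_weighted[OF h, symmetric], auto intro!: nn_integral_mono ennreal_leI mult_left_le)
  finally show "L2sq h \<le> L2sq (fourier h)" by (simp add: Liminf_const)
qed

section \<open>Change of variables\<close>

text \<open>A nonzero term of the Leibniz sum belongs to a permutation that fixes every index
  outside \<open>range \<tau>\<close>. These permutations are the transports along
  \<open>\<tau>\<close> of the permutations of \<open>'k\<close>, with equal signs. For bijective
  \<open>\<tau>\<close> this is invariance of the determinant under simultaneous relabelling of rows
  and columns.\<close>

lemma det_identity_rows:
  fixes A :: "'a::comm_ring_1^'n::finite^'n" and \<tau> :: "'k::finite \<Rightarrow> 'n"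
  assumes \<tau>: "inj \<tau>" and rows: "\<And>i j. i \<notin> range \<tau> \<Longrightarrow> A $ i $ j = (if i = j then 1 else 0)"
  shows "det A = det (\<chi> a b. A $ \<tau> a $ \<tau> b)"
proof -
  let ?R = "range \<tau>"
  let ?t = "\<lambda>p. of_int (sign p) * (\<Prod>i\<in>UNIV. A $ i $ p i)"
  have "det A = sum ?t {p. p permutes UNIV}" by (simp add: det_def)
  also have "\<dots> = sum ?t {p. p permutes ?R}"
  proof (rule sum.mono_neutral_right)
    show "\<forall>p\<in>{p. p permutes UNIV} - {p. p permutes ?R}. ?t p = 0"
    proof
      fix p assume p: "p \<in> {p. p permutes UNIV} - {p. p permutes ?R}"
      then have "\<exists>i. i \<notin> ?R \<and> p i \<noteq> i" by (auto simp: permutes_def)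
      then obtain i where "i \<notin> ?R" "p i \<noteq> i" by blast
      then have "A $ i $ p i = 0" by (simp add: rows)
      then have "(\<Prod>i\<in>UNIV. A $ i $ p i) = 0" by (intro prod_zero) auto
      then show "?t p = 0" by simp
    qed
  qed (auto intro: finite_permutations permutes_subset)
  also have "\<dots> = (\<Sum>q | q permutes UNIV. ?t (map_permutation UNIV \<tau> q))"
  proof (rule sum.reindex_bij_witness[where j="map_permutation ?R (inv \<tau>)" and i="map_permutation UNIV \<tau>"])
    have b: "bij_betw \<tau> UNIV ?R" "bij_betw (inv \<tau>) ?R UNIV"
      using \<tau> by (auto simp: bij_betw_def inj_on_inv_into image_inv_f_f inj_on_def)
    show "map_permutation UNIV \<tau> (map_permutation ?R (inv \<tau>) p) = p" if "p \<in> {p. p permutes ?R}" for p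
      using that by (intro map_permutation_compose_inv[OF b(2)]) (auto simp: \<tau>)
    show "map_permutation ?R (inv \<tau>) (map_permutation UNIV \<tau> p) = p" if "p \<in> {p. p permutes UNIV}" for p
      using that by (intro map_permutation_compose_inv[OF b(1)]) (auto simp: \<tau>)
    then show "map_permutation UNIV \<tau> q \<in> {p. p permutes ?R}" if "q \<in> {p. p permutes UNIV}" for q
      using that map_permutation_permutes[OF b(1)] by auto
    show "map_permutation ?R (inv \<tau>) p \<in> {p. p permutes UNIV}" if "p \<in> {p. p permutes ?R}" for p
      using that map_permutation_permutes[OF b(2)] by auto
    show "?t (map_permutation UNIV \<tau> (map_permutation ?R (inv \<tau>) p)) = ?t p" if "p \<in> {p. p permutes ?R}" for p
    proof -
      have "map_permutation UNIV \<tau> (map_permutation ?R (inv \<tau>) p) = p"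
        using that by (intro map_permutation_compose_inv[OF b(2)]) (auto simp: \<tau>)
      then show ?thesis by simp
    qed
  qed
  also have "\<dots> = (\<Sum>q | q permutes UNIV. of_int (sign q) * (\<Prod>a\<in>UNIV. (\<chi> a b. A $ \<tau> a $ \<tau> b) $ a $ q a))"
  proof (intro sum.cong refl)
    fix q :: "'k \<Rightarrow> 'k" assume "q \<in> {q. q permutes UNIV}"
    then have q: "q permutes UNIV" by simp
    let ?p = "map_permutation UNIV \<tau> q"
    have pp: "?p permutes ?R" using q \<tau> by (intro map_permutation_permutes) (auto simp: bij_betw_def)
    have "(\<Prod>i\<in>UNIV. A $ i $ ?p i) = (\<Prod>i\<in>?R. A $ i $ ?p i)"
      using pp by (intro prod.mono_neutral_right) (auto simp: rows permutes_not_in)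
    also have "\<dots> = (\<Prod>a\<in>UNIV. A $ \<tau> a $ ?p (\<tau> a))"
      using \<tau> by (simp add: prod.reindex)
    also have "\<dots> = (\<Prod>a\<in>UNIV. A $ \<tau> a $ \<tau> (q a))"
      using \<tau> by (simp add: map_permutation_apply)
    finally show "?t ?p = of_int (sign q) * (\<Prod>a\<in>UNIV. (\<chi> a b. A $ \<tau> a $ \<tau> b) $ a $ q a)"
      using sign_map_permutation[OF \<tau> q] by simp
  qed
  also have "\<dots> = det (\<chi> a b. A $ \<tau> a $ \<tau> b)" by (simp add: det_def)
  finally show ?thesis .
qed

text \<open>The library's change of variables theorem requires a well-ordered index type. This copy of \<open>'a\<close>
  carries it over to arbitrary finite index types.\<close>

typedef (overloaded) 'a fin_index = "{..<CARD('a::finite)}"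
  by (rule exI[of _ 0]) simp

instance fin_index :: (finite) finite
proof
  have "(UNIV :: 'a fin_index set) = Abs_fin_index ` {..<CARD('a)}"
    by (rule type_definition.Abs_image[OF type_definition_fin_index, symmetric])
  then show "finite (UNIV :: 'a fin_index set)" by (metis finite_imageI finite_lessThan)
qed

instantiation fin_index :: (finite) wellorder
begin
definition less_eq_fin_index :: "'a fin_index \<Rightarrow> 'a fin_index \<Rightarrow> bool" where
  "less_eq_fin_index x y \<longleftrightarrow> Rep_fin_index x \<le> Rep_fin_index y"
definition less_fin_index :: "'a fin_index \<Rightarrow> 'a fin_index \<Rightarrow> bool" where
  "less_fin_index x y \<longleftrightarrow> Rep_fin_index x < Rep_fin_index y"
instance
proof
  fix P :: "'a fin_index \<Rightarrow> bool" and a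
  assume step: "\<And>x. (\<And>y. y < x \<Longrightarrow> P y) \<Longrightarrow> P x"
  have "P b" if "Rep_fin_index b = n" for b n
    using that
  proof (induction n arbitrary: b rule: less_induct)
    case (less n)
    show ?case
    proof (rule step)
      fix y assume "y < b"
      then have "Rep_fin_index y < n" using less.prems by (simp add: less_fin_index_def)
      from less.IH[OF this refl] show "P y" .
    qed
  qed
  then show "P a" by blast
qed (auto simp: less_eq_fin_index_def less_fin_index_def Rep_fin_index_inject)
end

lemma card_fin_index: "CARD('a::finite fin_index) = CARD('a)"
  using type_definition.card[OF type_definition_fin_index] by simp

section \<open>Images of Borel sets under differentiable injections\<close>

lemma emeasure_lborel_lebesgue:
  "A \<in> sets borel \<Longrightarrow> emeasure lebesgue A = emeasure lborel A"
  by simp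

text \<open>The real-valued change of variables formula gives the value when the Jacobian is
  integrable. Its integrability is equivalent to finite measure of the image, so in the other case
  both sides are infinite.\<close>

lemma emeasure_differentiable_image_wellorder:
  fixes f :: "real^'n::{finite,wellorder} \<Rightarrow> real^'n::_"
  assumes S: "S \<in> sets borel" and fS: "f ` S \<in> sets borel"
    and der: "\<And>x. x \<in> S \<Longrightarrow> (f has_derivative f' x) (at x within S)" and inj: "inj_on f S"
    and meas: "(\<lambda>x. det (matrix (f' x)) * indicator S x) \<in> borel_measurable borel"
  shows "emeasure lborel (f ` S) = (\<integral>\<^sup>+x. ennreal \<bar>det (matrix (f' x))\<bar> * indicator S x \<partial>lborel)"
proof -
  let ?g = "\<lambda>x. \<bar>det (matrix (f' x))\<bar>"
  let ?h = "\<lambda>x. ?g x * indicator S x"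
  have Sl: "S \<in> sets lebesgue" using S by simp
  have hm: "?h \<in> borel_measurable borel"
  proof -
    have "?h = (\<lambda>x. \<bar>det (matrix (f' x)) * indicator S x\<bar>)" by (auto split: split_indicator)
    then show ?thesis using meas by simp
  qed
  have nn: "(\<integral>\<^sup>+x. ennreal (?g x) * indicator S x \<partial>lborel) = (\<integral>\<^sup>+x. ennreal (?h x) \<partial>lborel)"
    by (intro nn_integral_cong) (auto split: split_indicator)
  have io: "?g integrable_on S \<longleftrightarrow> (\<integral>\<^sup>+x. ennreal (?h x) \<partial>lborel) < \<infinity>"
  proof -
    have "?g integrable_on S \<longleftrightarrow> ?h integrable_on UNIV"
      by (subst integrable_restrict_UNIV[symmetric])
        (auto intro!: arg_cong2[where f="(integrable_on)"] simp: indicator_def)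
    also have "\<dots> \<longleftrightarrow> ?h absolutely_integrable_on UNIV"
      by (simp add: absolutely_integrable_on_iff_nonneg)
    also have "\<dots> \<longleftrightarrow> integrable lborel ?h"
      using hm by (simp add: set_integrable_def integrable_completion)
    also have "\<dots> \<longleftrightarrow> (\<integral>\<^sup>+x. ennreal (?h x) \<partial>lborel) < \<infinity>"
      using hm by (simp add: integrable_iff_bounded)
    finally show ?thesis .
  qed
  show ?thesis
  proof (cases "?g integrable_on S")
    case True
    then have m: "f ` S \<in> lmeasurable" using measurable_differentiable_image_eq[OF Sl der inj] by blast
    have "integrable lborel ?h" using True io hm by (simp add: integrable_iff_bounded)
    then have "(?h has_integral (\<integral>x. ?h x \<partial>lborel)) UNIV" by (rule has_integral_integral_lborel)
    then have "(?g has_integral (\<integral>x. ?h x \<partial>lborel)) S"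
    proof -
      have "?h = (\<lambda>x. if x \<in> S then ?g x else 0)" by auto
      then show ?thesis using \<open>(?h has_integral _) UNIV\<close> by (simp only: has_integral_restrict_UNIV)
    qed
    then have "measure lebesgue (f ` S) = (\<integral>x. ?h x \<partial>lborel)"
      using has_measure_differentiable_image[OF Sl der inj] by blast
    then have "emeasure lebesgue (f ` S) = ennreal (\<integral>x. ?h x \<partial>lborel)"
      using m by (simp add: emeasure_eq_measure2)
    also have "\<dots> = (\<integral>\<^sup>+x. ennreal (?h x) \<partial>lborel)"
      using \<open>integrable lborel ?h\<close> by (intro nn_integral_eq_integral[symmetric]) auto
    finally show ?thesis unfolding nn using fS by (simp del: emeasure_completion add: emeasure_lborel_lebesgue)
  next
    case False
    then have "f ` S \<notin> lmeasurable" using measurable_differentiable_image_eq[OF Sl der inj] by blast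
    then have "\<not> emeasure lebesgue (f ` S) < \<infinity>" using fS by (simp add: fmeasurable_def del: emeasure_completion)
    then have "emeasure lborel (f ` S) = \<infinity>" unfolding emeasure_lborel_lebesgue[OF fS]
      by (metis infinity_ennreal_def top.not_eq_extremum)
    moreover have "(\<integral>\<^sup>+x. ennreal (?h x) \<partial>lborel) = \<infinity>" using io False
      by (metis infinity_ennreal_def top.not_eq_extremum)
    ultimately show ?thesis unfolding nn by simp
  qed
qed

lemma prod_Basis_cart: "(\<Prod>b\<in>(Basis :: (real^'n) set). f b) = (\<Prod>i\<in>UNIV. f (axis i 1))"
proof -
  have B: "(Basis :: (real^'n) set) = range (\<lambda>i. axis i 1)" by (auto simp: Basis_vec_def)
  have "inj (\<lambda>i::'n. axis i (1::real))" by (auto simp: inj_def axis_eq_axis)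
  then show ?thesis unfolding B by (simp add: prod.reindex)
qed

lemma lborel_reindex:
  fixes \<tau> :: "'m::finite \<Rightarrow> 'k::finite"
  assumes \<tau>: "bij \<tau>"
  shows "distr lborel borel (\<lambda>x::real^'k. \<chi> i. x $ \<tau> i) = lborel"
proof (rule lborel_eqI[symmetric])
  let ?T = "\<lambda>x::real^'k. \<chi> i. x $ \<tau> i" and ?T' = "\<lambda>y::real^'m. \<chi> a. y $ inv \<tau> a"
  have m[measurable]: "?T \<in> borel_measurable borel"
    by (intro borel_measurable_continuous_onI continuous_intros)
  fix l u :: "real^'m" assume le: "\<And>b. b \<in> Basis \<Longrightarrow> l \<bullet> b \<le> u \<bullet> b"
  have le': "l $ i \<le> u $ i" for i using le[of "axis i 1"] by (simp add: axis_in_Basis_iff inner_axis)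
  have vim: "?T -` box l u = box (?T' l) (?T' u)"
    using \<tau> by (auto simp: mem_box_cart bij_def) (metis inv_f_f surj_f_inv_f)+
  have "emeasure (distr lborel borel ?T) (box l u) = emeasure lborel (box (?T' l) (?T' u))"
    by (subst emeasure_distr) (auto simp: vim)
  also have "\<dots> = ennreal (\<Prod>b\<in>Basis. (?T' u - ?T' l) \<bullet> b)"
    by (rule emeasure_lborel_box) (auto simp: Basis_vec_def inner_axis le')
  also have "(\<Prod>b\<in>Basis. (?T' u - ?T' l) \<bullet> b) = (\<Prod>b\<in>Basis. (u - l) \<bullet> b)"
    unfolding prod_Basis_cart using prod.reindex_bij_betw[of "inv \<tau>" UNIV UNIV
      "\<lambda>i. u $ i - l $ i"] bij_imp_bij_inv[OF \<tau>]
    by (simp add: inner_axis)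
  finally show "emeasure (distr lborel borel ?T) (box l u) = ennreal (\<Prod>b\<in>Basis. (u - l) \<bullet> b)" .
qed simp

lemma emeasure_differentiable_image:
  fixes f :: "real^'k::finite \<Rightarrow> real^'k"
  assumes S: "S \<in> sets borel" and fS: "f ` S \<in> sets borel"
    and der: "\<And>x. x \<in> S \<Longrightarrow> (f has_derivative f' x) (at x within S)" and inj: "inj_on f S"
    and meas: "(\<lambda>x. det (matrix (f' x)) * indicator S x) \<in> borel_measurable borel"
  shows "emeasure lborel (f ` S) = (\<integral>\<^sup>+x. ennreal \<bar>det (matrix (f' x))\<bar> * indicator S x \<partial>lborel)"
proof -
  obtain \<tau> :: "'k fin_index \<Rightarrow> 'k" where \<tau>: "bij \<tau>"
    using finite_same_card_bij[of "UNIV :: 'k fin_index set" "UNIV :: 'k set"] card_fin_index by auto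
  define T where "T = (\<lambda>x::real^'k. (\<chi> i. x $ \<tau> i) :: real^'k fin_index)"
  define T' where "T' = (\<lambda>y::real^'k fin_index. (\<chi> a. y $ inv \<tau> a) :: real^'k)"
  have TT': "T (T' y) = y" "T' (T x) = x" for x y
    using \<tau> by (auto simp: T_def T'_def vec_eq_iff bij_def surj_f_inv_f)
  have lin: "bounded_linear T" "bounded_linear T'"
    by (auto simp: T_def T'_def vec_eq_iff linear_iff intro!: linear_conv_bounded_linear[THEN iffD1])
  have Tm[measurable]: "T \<in> borel_measurable borel" "T' \<in> borel_measurable borel"
    using lin by (auto intro!: borel_measurable_continuous_onI linear_continuous_on)
  have dT: "distr lborel borel T = lborel" unfolding T_def by (rule lborel_reindex[OF \<tau>])
  have dT': "distr lborel borel T' = lborel"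
    unfolding T'_def by (rule lborel_reindex) (rule bij_imp_bij_inv[OF \<tau>])
  have im: "T ` A = T' -` A" for A
    using TT' by (auto simp: image_iff) metis
  have imb: "T ` A \<in> sets borel" if "A \<in> sets borel" for A
    unfolding im using measurable_sets_borel[OF Tm(2) that] .
  have ime: "emeasure lborel (T ` A) = emeasure lborel A" if A: "A \<in> sets borel" for A
  proof -
    have "emeasure lborel A = emeasure (distr lborel borel T') A" by (simp add: dT')
    also have "\<dots> = emeasure lborel (T' -` A)" using A by (subst emeasure_distr) auto
    finally show ?thesis unfolding im ..
  qed
  let ?f = "T \<circ> f \<circ> T'" and ?f' = "\<lambda>y. T \<circ> f' (T' y) \<circ> T'"
  \<comment> \<open>Conjugation by \<open>T\<close> relabels rows and columns of the derivative by
    the same bijection.\<close>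
  have dets: "det (matrix (?f' y)) = det (matrix (f' (T' y)))" if "T' y \<in> S" for y
  proof -
    have l: "linear (f' (T' y))" using der[OF that] by (simp add: has_derivative_linear)
    have "det (matrix (f' (T' y))) = det (\<chi> a b. matrix (f' (T' y)) $ \<tau> a $ \<tau> b)"
      using \<tau> by (intro det_identity_rows) (auto simp: bij_def)
    also have "(\<chi> a b. matrix (f' (T' y)) $ \<tau> a $ \<tau> b) = matrix (?f' y)"
    proof -
      have "T' (axis b 1) = axis (\<tau> b) 1" for b
        using \<tau> by (auto simp: T'_def axis_def vec_eq_iff bij_def inj_def) (metis surj_f_inv_f)+
      then show ?thesis by (simp add: matrix_def T_def)
    qed
    finally show ?thesis by simp
  qed
  have fim: "?f ` (T ` S) = T ` (f ` S)" by (auto simp: image_iff TT')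
  have TS: "y \<in> T ` S \<longleftrightarrow> T' y \<in> S" for y by (auto simp: im)
  have "emeasure lborel (?f ` (T ` S)) = (\<integral>\<^sup>+y. ennreal \<bar>det (matrix (?f' y))\<bar> * indicator (T ` S) y \<partial>lborel)"
  proof (rule emeasure_differentiable_image_wellorder)
    show "T ` S \<in> sets borel" by (rule imb[OF S])
    show "?f ` T ` S \<in> sets borel" unfolding fim by (rule imb[OF fS])
    show "(?f has_derivative ?f' y) (at y within T ` S)" if "y \<in> T ` S" for y
    proof -
      have "T' ` T ` S = S" by (auto simp: image_iff TT')
      then have 1: "(f has_derivative f' (T' y)) (at (T' y) within T' ` T ` S)" using der[of "T' y"] that TS by simp
      have "((f \<circ> T') has_derivative (f' (T' y) \<circ> T')) (at y within T ` S)"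
        by (rule diff_chain_within[OF bounded_linear_imp_has_derivative[OF lin(2)] 1])
      from diff_chain_within[OF this bounded_linear_imp_has_derivative[OF lin(1)]]
      show ?thesis by (simp add: o_assoc)
    qed
    show "inj_on ?f (T ` S)"
      using inj by (auto simp: inj_on_def TT') (metis TT'(2))
    have "(\<lambda>y. det (matrix (?f' y)) * indicator (T ` S) y) = (\<lambda>x. det (matrix (f' x)) * indicator S x) \<circ> T'"
      by (rule ext) (use TS dets in \<open>auto simp: indicator_def\<close>)
    then show "(\<lambda>y. det (matrix (?f' y)) * indicator (T ` S) y) \<in> borel_measurable borel"
      using meas by (simp add: measurable_comp[OF Tm(2)])
  qed
  then have "emeasure lborel (f ` S) = (\<integral>\<^sup>+y. ennreal \<bar>det (matrix (?f' y))\<bar> * indicator (T ` S) y \<partial>lborel)"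
    unfolding fim ime[OF fS] .
  also have "\<dots> = (\<integral>\<^sup>+y. ennreal \<bar>det (matrix (f' (T' y))) * indicator S (T' y)\<bar> \<partial>lborel)"
    by (rule nn_integral_cong) (use TS dets in \<open>auto simp: indicator_def\<close>)
  also have "\<dots> = (\<integral>\<^sup>+x. ennreal \<bar>det (matrix (f' x)) * indicator S x\<bar> \<partial>distr lborel borel T')"
    using meas by (subst nn_integral_distr) auto
  also have "\<dots> = (\<integral>\<^sup>+x. ennreal \<bar>det (matrix (f' x))\<bar> * indicator S x \<partial>lborel)"
    unfolding dT' by (intro nn_integral_cong) (auto split: split_indicator)
  finally show ?thesis .
qed

lemma nn_integral_change_of_variables:
  fixes f :: "real^'k::finite \<Rightarrow> real^'k"
  assumes S: "S \<in> sets borel" and fm: "f \<in> borel_measurable (restrict_space borel S)"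
    and fS: "\<And>A. A \<in> sets borel \<Longrightarrow> A \<subseteq> S \<Longrightarrow> f ` A \<in> sets borel"
    and der: "\<And>x. x \<in> S \<Longrightarrow> (f has_derivative f' x) (at x within S)" and inj: "inj_on f S"
    and meas: "(\<lambda>x. det (matrix (f' x)) * indicator S x) \<in> borel_measurable borel"
    and h: "h \<in> borel_measurable borel"
  shows "(\<integral>\<^sup>+y. h y * indicator (f ` S) y \<partial>lborel)
      = (\<integral>\<^sup>+x. ennreal \<bar>det (matrix (f' x))\<bar> * h (f x) * indicator S x \<partial>lborel)"
proof -
  define J where "J = (\<lambda>x. ennreal \<bar>det (matrix (f' x)) * indicator S x\<bar>)"
  have Jm[measurable]: "J \<in> borel_measurable borel" unfolding J_def using meas by simp
  define M where "M = distr (density (restrict_space lborel S) J) borel f"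
  have fm': "f \<in> borel_measurable (density (restrict_space lborel S) J)"
    using fm by (simp add: measurable_def sets_restrict_space space_restrict_space)
  have Jr: "J \<in> borel_measurable (restrict_space lborel S)" by (intro measurable_restrict_space1) simp
  have "M = density lborel (indicator (f ` S))"
  proof (rule measure_eqI)
    show "sets M = sets (density lborel (indicator (f ` S)))" by (simp add: M_def)
    fix A assume "A \<in> sets M"
    then have A: "A \<in> sets borel" by (simp add: M_def)
    have pre: "f -` A \<inter> S \<in> sets borel"
      using measurable_sets[OF fm A] S by (auto simp: space_restrict_space sets_restrict_space_iff)
    have "emeasure M A = emeasure (density (restrict_space lborel S) J) (f -` A \<inter> S)"
      unfolding M_def using A fm' by (subst emeasure_distr) (auto simp: space_restrict_space)
    also have "\<dots> = (\<integral>\<^sup>+x. J x * indicator (f -` A \<inter> S) x \<partial>restrict_space lborel S)"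
      using Jr pre by (intro emeasure_density) (auto simp: sets_restrict_space_iff S)
    also have "\<dots> = (\<integral>\<^sup>+x. J x * indicator (f -` A \<inter> S) x * indicator S x \<partial>lborel)"
      using S by (subst nn_integral_restrict_space) auto
    also have "\<dots> = (\<integral>\<^sup>+x. ennreal \<bar>det (matrix (f' x))\<bar> * indicator (f -` A \<inter> S) x \<partial>lborel)"
      by (intro nn_integral_cong) (auto simp: J_def split: split_indicator)
    also have "\<dots> = emeasure lborel (f ` (f -` A \<inter> S))"
    proof (rule emeasure_differentiable_image[symmetric])
      show "f ` (f -` A \<inter> S) \<in> sets borel" using pre by (intro fS) auto
      show "inj_on f (f -` A \<inter> S)" using inj by (rule inj_on_subset) auto
      show "(f has_derivative f' x) (at x within f -` A \<inter> S)" if "x \<in> f -` A \<inter> S" for x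
        using der[of x] that by (auto intro: has_derivative_subset)
      have "(\<lambda>x. det (matrix (f' x)) * indicator (f -` A \<inter> S) x)
          = (\<lambda>x. (det (matrix (f' x)) * indicator S x) * indicator (f -` A \<inter> S) x)"
        by (auto split: split_indicator)
      then show "(\<lambda>x. det (matrix (f' x)) * indicator (f -` A \<inter> S) x) \<in> borel_measurable borel"
        using meas pre by simp
    qed (rule pre)
    also have "f ` (f -` A \<inter> S) = A \<inter> f ` S" by auto
    also have "emeasure lborel (A \<inter> f ` S) = emeasure (density lborel (indicator (f ` S))) A"
      using A fS[OF S] by (subst emeasure_density) (auto simp: indicator_inter_arith[symmetric] Int_commute)
    finally show "emeasure M A = emeasure (density lborel (indicator (f ` S))) A" .
  qed
  then have "(\<integral>\<^sup>+y. h y \<partial>M) = (\<integral>\<^sup>+y. h y \<partial>density lborel (indicator (f ` S)))" by simp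
  also have "\<dots> = (\<integral>\<^sup>+y. h y * indicator (f ` S) y \<partial>lborel)"
    using h fS[OF S] by (subst nn_integral_density) (auto simp: mult.commute)
  finally have "(\<integral>\<^sup>+y. h y * indicator (f ` S) y \<partial>lborel) = (\<integral>\<^sup>+y. h y \<partial>M)" ..
  also have "\<dots> = (\<integral>\<^sup>+x. h (f x) \<partial>density (restrict_space lborel S) J)"
    unfolding M_def using h fm' by (subst nn_integral_distr) auto
  also have "\<dots> = (\<integral>\<^sup>+x. J x * h (f x) \<partial>restrict_space lborel S)"
  proof (rule nn_integral_density[OF Jr])
    have "f \<in> restrict_space lborel S \<rightarrow>\<^sub>M borel"
      using fm by (simp cong: measurable_cong_sets add: sets_restrict_space)
    from measurable_compose[OF this h] show "(\<lambda>x. h (f x)) \<in> borel_measurable (restrict_space lborel S)" .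
  qed
  also have "\<dots> = (\<integral>\<^sup>+x. J x * h (f x) * indicator S x \<partial>lborel)"
    using S by (subst nn_integral_restrict_space) auto
  also have "\<dots> = (\<integral>\<^sup>+x. ennreal \<bar>det (matrix (f' x))\<bar> * h (f x) * indicator S x \<partial>lborel)"
    by (intro nn_integral_cong) (auto simp: J_def split: split_indicator)
  finally show ?thesis .
qed

lemma matrix_vector_mult_measurable[measurable]:
  fixes A :: "real^'n^'m"
  shows "(*v) A \<in> borel_measurable borel"
  by (intro borel_measurable_continuous_onI linear_continuous_on matrix_vector_mul_bounded_linear)

lemma nn_integral_linear_image:
  fixes A :: "real^'n^'n" and h :: "real^'n \<Rightarrow> ennreal"
  assumes A: "det A \<noteq> 0" and h: "h \<in> borel_measurable borel"
  shows "(\<integral>\<^sup>+x. h (A *v x) \<partial>lborel) = ennreal (1 / \<bar>det A\<bar>) * (\<integral>\<^sup>+x. h x \<partial>lborel)"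
proof -
  have inv: "invertible A" using A by (simp add: invertible_det_nz)
  then obtain B where B: "B ** A = mat 1" "A ** B = mat 1" unfolding invertible_def by blast
  have surj: "range (\<lambda>x. A *v x) = UNIV"
    by (metis B(2) matrix_vector_mul_assoc matrix_vector_mul_lid surjI)
  have "(\<integral>\<^sup>+x. h x * indicator (range (\<lambda>x. A *v x)) x \<partial>lborel)
      = (\<integral>\<^sup>+x. ennreal \<bar>det (matrix ((*v) A))\<bar> * h (A *v x) * indicator UNIV x \<partial>lborel)"
  proof (rule nn_integral_change_of_variables)
    show "(*v) A ` S \<in> sets borel" if S: "S \<in> sets borel" for S
    proof -
      have "(*v) A ` S = (*v) B -` S"
        using B by (auto simp: matrix_vector_mul_assoc image_iff)
          (metis matrix_vector_mul_assoc matrix_vector_mul_lid)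
      then show ?thesis using measurable_sets_borel[OF matrix_vector_mult_measurable S] by simp
    qed
    show "inj ((*v) A)" by (metis B(1) inj_on_inverseI matrix_vector_mul_assoc matrix_vector_mul_lid)
    show "((*v) A has_derivative (*v) A) (at x within UNIV)" for x
      by (rule bounded_linear_imp_has_derivative[OF matrix_vector_mul_bounded_linear])
    show "(*v) A \<in> borel_measurable (restrict_space borel UNIV)"
      by (intro measurable_restrict_space1 matrix_vector_mult_measurable)
  qed (use h in auto)
  then have 1: "(\<integral>\<^sup>+x. h x \<partial>lborel) = (\<integral>\<^sup>+x. ennreal \<bar>det A\<bar> * h (A *v x) \<partial>lborel)"
    by (simp add: surj)
  have "(\<lambda>x. h (A *v x)) \<in> borel_measurable borel"
    by (rule measurable_compose[OF matrix_vector_mult_measurable h])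
  then have "(\<integral>\<^sup>+x. h x \<partial>lborel) = ennreal \<bar>det A\<bar> * (\<integral>\<^sup>+x. h (A *v x) \<partial>lborel)"
    unfolding 1 by (simp add: nn_integral_cmult)
  then have "ennreal (1 / \<bar>det A\<bar>) * (\<integral>\<^sup>+x. h x \<partial>lborel)
      = (ennreal (1 / \<bar>det A\<bar>) * ennreal \<bar>det A\<bar>) * (\<integral>\<^sup>+x. h (A *v x) \<partial>lborel)"
    by (simp add: mult.assoc)
  also have "ennreal (1 / \<bar>det A\<bar>) * ennreal \<bar>det A\<bar> = 1"
    using A by (simp flip: ennreal_mult)
  finally show ?thesis by simp
qed

section \<open>Projections and wedge products\<close>

lemma closest_point_subspace:
  fixes V :: "'a::euclidean_space set"
  assumes V: "subspace V" and w: "w \<in> V" and orth: "\<And>v. v \<in> V \<Longrightarrow> (x - w) \<bullet> v = 0"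
  shows "closest_point V x = w"
proof (rule closest_point_unique[symmetric])
  show "convex V" "closed V" using V by (simp_all add: closed_subspace subspace_imp_convex)
  show "\<forall>z\<in>V. dist x w \<le> dist x z"
  proof
    fix z assume "z \<in> V"
    then have "w - z \<in> V" using w V by (simp add: subspace_diff)
    then have o: "(x - w) \<bullet> (w - z) = 0" by (rule orth)
    have "x - z = (x - w) + (w - z)" by simp
    then have "(norm (x - z))\<^sup>2 = (norm (x - w))\<^sup>2 + (norm (w - z))\<^sup>2"
      using o by (simp only: norm_add_Pythagorean orthogonal_def)
    then have "(norm (x - w))\<^sup>2 \<le> (norm (x - z))\<^sup>2" by simp
    then show "dist x w \<le> dist x z" by (simp add: dist_norm power2_le_iff_abs_le)
  qed
qed (rule w)

lemma orthonormal_basisD: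
  fixes B :: "(real^'n) set"
  assumes B: "orthonormal_basis B V"
  shows "finite B" "card B = dim V" "independent B" "\<And>b c. b \<in> B \<Longrightarrow> c \<in> B
      \<Longrightarrow> b \<bullet> c = (if b = c then 1 else 0)" "span B = V"
    "subspace V" "B \<subseteq> V"
proof -
  have *: "pairwise orthogonal B" "\<And>b. b \<in> B \<Longrightarrow> norm b = 1" "span B = V" using B by (auto simp: orthonormal_basis_def)
  have "0 \<notin> B" using *(2) by force
  then show i: "independent B" using *(1) pairwise_orthogonal_independent by blast
  then show "finite B" by (simp add: independent_imp_finite)
  show "card B = dim V" using i *(3) by (metis dim_span_eq_card_independent)
  show "\<And>b c. b \<in> B \<Longrightarrow> c \<in> B \<Longrightarrow> b \<bullet> c = (if b = c then 1 else 0)"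
    using * by (auto simp: pairwise_def orthogonal_def norm_eq_1)
  show "span B = V" "subspace V" "B \<subseteq> V" using *(3) span_superset by auto
qed

lemma orthonormal_basis_exists:
  assumes "subspace V"
  obtains B where "orthonormal_basis B (V :: (real^'n) set)"
proof -
  obtain B where "pairwise orthogonal B" "\<And>x. x \<in> B \<Longrightarrow> norm x = 1" "span B = V"
    by (rule orthonormal_basis_subspace[OF assms]) blast
  then show ?thesis by (intro that[of B]) (auto simp: orthonormal_basis_def)
qed

lemma closest_point_orthonormal_basis:
  fixes B :: "(real^'n) set"
  assumes B: "orthonormal_basis B V"
  shows "closest_point V x = (\<Sum>b\<in>B. (b \<bullet> x) *\<^sub>R b)"
proof (rule closest_point_subspace)
  note b = orthonormal_basisD[OF B]
  show "subspace V" by (rule b)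
  show "(\<Sum>b\<in>B. (b \<bullet> x) *\<^sub>R b) \<in> V" using b by (auto intro!: subspace_sum subspace_scale)
  fix v assume "v \<in> V"
  then have "v \<in> span B" using b by simp
  then show "(x - (\<Sum>b\<in>B. (b \<bullet> x) *\<^sub>R b)) \<bullet> v = 0"
  proof (induction rule: span_induct)
    case base
    then show ?case by (simp add: subspace_def inner_right_distrib)
  next
    case (step c)
    have "(\<Sum>b\<in>B. (b \<bullet> x) *\<^sub>R b) \<bullet> c = (\<Sum>b\<in>B. if b = c then c \<bullet> x else 0)"
      unfolding inner_sum_left using step b(4) by (intro sum.cong) auto
    also have "\<dots> = c \<bullet> x" using step b(1) by (simp add: sum.delta)
    finally show ?case by (simp add: inner_diff_left inner_commute[of x c])
  qed
qed

text \<open>The same matrix through which \<open>plane_space\<close> defines its Borel structure, so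
  that Borel functions of it are measurable on planes.\<close>

definition projection_matrix :: "(real^'n) set \<Rightarrow> real^'n^'n" where
  "projection_matrix V = matrix (closest_point V)"

lemma projection_matrix_orthonormal_basis:
  assumes "orthonormal_basis B V"
  shows "projection_matrix V $ i $ j = (\<Sum>b\<in>B. b $ i * b $ j)"
  unfolding projection_matrix_def matrix_def closest_point_orthonormal_basis[OF assms]
  by (simp add: inner_axis mult.commute)

lemma dim_orthogonal_comp:
  fixes V :: "(real^'n) set"
  assumes V: "subspace V"
  shows "dim (V\<^sup>\<bottom>) + dim V = CARD('n)"
  using dim_subspace_orthogonal_to_vectors[OF V subspace_UNIV] by (simp add: orthogonal_comp_def)

section \<open>Frames adapted to two subspaces of complementary dimensions\<close>

definition wedge_frame :: "(real^'n) set \<Rightarrow> (real^'n) set \<Rightarrow> ('n \<Rightarrow> real^'n) \<Rightarrow> 'n set \<Rightarrow> bool" where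
  "wedge_frame V W f I \<longleftrightarrow> inj_on f I \<and> orthonormal_basis (f ` I) V \<and> inj_on f (- I) \<and> orthonormal_basis (f ` (- I)) W"

lemma card_add_card_Compl: "card I + card (- I) = CARD('n)" for I :: "'n::finite set"
  using card_Un_disjoint[of I "- I"] by (simp add: Compl_partition)

text \<open>Here the basis of \<open>W\<close> and its indexing are prescribed, as the Jacobian
  computation requires. By the dimension count, \<open>I\<close> has exactly as many indices as a
  basis of \<open>V\<close> has vectors.\<close>

lemma wedge_frame_extend:
  fixes f :: "'n::finite \<Rightarrow> real^'n"
  assumes V: "subspace V" and d: "dim V + dim W = CARD('n)"
    and f: "inj_on f (- I)" "orthonormal_basis (f ` (- I)) W"
  obtains f' where "wedge_frame V W f' I" "\<And>i. i \<notin> I \<Longrightarrow> f' i = f i"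
proof -
  obtain B where B: "orthonormal_basis B V" using orthonormal_basis_exists[OF V] .
  note b = orthonormal_basisD[OF B]
  have "card (- I) = dim W" using f orthonormal_basisD(2)[OF f(2)] by (simp add: card_image)
  then have "card I = card B" using d b(2) card_add_card_Compl[of I] by simp
  then obtain h where h: "bij_betw h I B" using b(1) finite_same_card_bij[of I B] by auto
  let ?f = "\<lambda>i. if i \<in> I then h i else f i"
  have im: "?f ` I = B" "?f ` (- I) = f ` (- I)" using h by (auto simp: bij_betw_def)
  have "inj_on ?f I" "inj_on ?f (- I)" using h f by (auto simp: bij_betw_def inj_on_def)
  then have "wedge_frame V W ?f I" unfolding wedge_frame_def im using B f by auto
  then show ?thesis by (rule that) auto
qed

lemma wedge_frame_exists:
  fixes V W :: "(real^'n) set"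
  assumes V: "subspace V" and W: "subspace W" and d: "dim V + dim W = CARD('n)"
  obtains f I where "wedge_frame V W f I"
proof -
  obtain B where B: "orthonormal_basis B W" using orthonormal_basis_exists[OF W] .
  note b = orthonormal_basisD[OF B]
  obtain J :: "'n set" where J: "card J = card B" using d b(2) obtain_subset_with_card_n[of "card B" "UNIV :: 'n set"]
    by auto
  then obtain h where h: "bij_betw h J B" using b(1) finite_same_card_bij[of J B] by auto
  then have "inj_on h (- (- J))" "orthonormal_basis (h ` (- (- J))) W" using B by (auto simp: bij_betw_def)
  from wedge_frame_extend[OF V d this] that show ?thesis by blast
qed

text \<open>With the frame as rows of \<open>F\<close>, the matrix \<open>F\<^sup>T F\<close> is the sum of the two projections, hence
  independent of the frame.\<close>

lemma wedge_frame_det: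
  assumes "wedge_frame V W f I"
  shows "\<bar>det (\<chi> i. f i)\<bar> = sqrt (det (projection_matrix V + projection_matrix W))"
proof -
  let ?F = "\<chi> i. f i"
  have f: "inj_on f I" "orthonormal_basis (f ` I) V" "inj_on f (- I)" "orthonormal_basis (f ` (- I)) W"
    using assms by (auto simp: wedge_frame_def)
  have "(transpose ?F ** ?F) $ a $ b = (projection_matrix V + projection_matrix W) $ a $ b" for a b
  proof -
    have "(transpose ?F ** ?F) $ a $ b = (\<Sum>i\<in>UNIV. f i $ a * f i $ b)"
      by (simp add: matrix_matrix_mult_def transpose_def)
    also have "\<dots> = (\<Sum>i\<in>I. f i $ a * f i $ b) + (\<Sum>i\<in>-I. f i $ a * f i $ b)"
      by (metis (no_types, lifting) Compl_partition Compl_disjoint finite sum.union_disjoint)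
    also have "(\<Sum>i\<in>I. f i $ a * f i $ b) = (\<Sum>v\<in>f`I. v $ a * v $ b)" using f(1) by (simp add: sum.reindex)
    also have "(\<Sum>i\<in>-I. f i $ a * f i $ b) = (\<Sum>v\<in>f`(-I). v $ a * v $ b)" using f(3) by (simp add: sum.reindex)
    finally show ?thesis using f by (simp add: projection_matrix_orthonormal_basis)
  qed
  then have "transpose ?F ** ?F = projection_matrix V + projection_matrix W" by (simp add: vec_eq_iff)
  then have "det (projection_matrix V + projection_matrix W) = det ?F * det ?F"
    by (metis det_mul det_transpose)
  then show ?thesis by simp
qed

text \<open>The definite description is legitimate because \<open>wedge_frame_det\<close> gives
  every frame a value that depends on the two subspaces alone.\<close>

lemma wedge_abs_frame:
  assumes "wedge_frame V W f I"
  shows "wedge_abs V W = \<bar>det (\<chi> i. f i)\<bar>"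
proof -
  have "wedge_abs V W = (THE c. \<exists>g J. wedge_frame V W g J \<and> c = \<bar>det (\<chi> i. g i)\<bar>)"
    unfolding wedge_abs_def wedge_frame_def by (simp only: conj_assoc)
  also have "\<dots> = \<bar>det (\<chi> i. f i)\<bar>"
    by (rule the_equality) (use assms in blast, use assms wedge_frame_det in metis)
  finally show ?thesis .
qed

text \<open>Projection matrices vary continuously with the subspace, whereas frames would have to be
  chosen. Continuity of \<open>J\<close> and measurability on the space of planes rest on this
  form.\<close>

lemma wedge_abs_eq:
  fixes V W :: "(real^'n) set"
  assumes "subspace V" "subspace W" "dim V + dim W = CARD('n)"
  shows "wedge_abs V W = sqrt (det (projection_matrix V + projection_matrix W))"
proof -
  obtain f I where "wedge_frame V W f I" using wedge_frame_exists[OF assms] .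
  then show ?thesis by (simp only: wedge_abs_frame wedge_frame_det)
qed

text \<open>Transversality and the dimensions make the rows span the whole space. A vector
  annihilated by the matrix is orthogonal to all rows, hence to itself.\<close>

lemma wedge_frame_det_nonzero:
  fixes V W :: "(real^'n) set"
  assumes fr: "wedge_frame V W f I" and t: "V \<inter> W = {0}"
  shows "det (\<chi> i. f i) \<noteq> 0"
proof -
  have f: "inj_on f I" "orthonormal_basis (f ` I) V" "inj_on f (- I)" "orthonormal_basis (f ` (- I)) W"
    using fr by (auto simp: wedge_frame_def)
  note v = orthonormal_basisD[OF f(2)] and w = orthonormal_basisD[OF f(4)]
  have "x = 0" if x: "(\<chi> i. f i) *v x = 0" for x
  proof -
    have fx: "f i \<bullet> x = 0" for i
      using x by (simp add: vec_eq_iff matrix_vector_mul_component)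
    have "orthogonal x y" if "y \<in> span (range f)" for y
      using that by (rule orthogonal_to_span) (auto simp: orthogonal_def inner_commute[of x] fx)
    moreover have "span (range f) = UNIV"
    proof -
      have "dim {x + y |x y. x \<in> V \<and> y \<in> W} + dim (V \<inter> W) = dim V + dim W"
        by (rule dim_sums_Int) (use v w in auto)
      moreover have "dim V + dim W = CARD('n)"
        using v(2) w(2) f(1,3) card_add_card_Compl[of I] by (simp add: card_image)
      ultimately have "dim {x + y |x y. x \<in> V \<and> y \<in> W} = DIM(real^'n)" using t by simp
      then have full: "span {x + y |x y. x \<in> V \<and> y \<in> W} = UNIV" by (simp only: dim_eq_full)
      have "V \<subseteq> span (range f)" "W \<subseteq> span (range f)"
        using span_mono[of "f ` I" "range f"] span_mono[of "f ` (- I)" "range f"] v(5) w(5) by auto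
      then have "{x + y |x y. x \<in> V \<and> y \<in> W} \<subseteq> span (range f)" by (auto intro: span_add)
      then have "span {x + y |x y. x \<in> V \<and> y \<in> W} \<subseteq> span (range f)"
        by (rule span_minimal[OF _ subspace_span])
      then show ?thesis unfolding full by (simp only: top.extremum_unique)
    qed
    ultimately have "orthogonal x x" by blast
    then show "x = 0" by (simp add: orthogonal_self)
  qed
  then have "invertible (\<chi> i. f i)"
    unfolding invertible_left_inverse matrix_left_invertible_ker by blast
  then show ?thesis by (simp add: invertible_det_nz)
qed

text \<open>An invertible frame matrix has spanning rows, and these lie in the sum of
  \<open>V\<close> and \<open>W\<close>; the dimension formula then leaves no room for an
  intersection. It allows transversality to be recognised by a measurable condition on
  planes.\<close>

lemma wedge_frame_det_nonzeroD:
  fixes V W :: "(real^'n) set"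
  assumes V: "subspace V" and W: "subspace W" and d: "dim V + dim W = CARD('n)"
    and nz: "det (projection_matrix V + projection_matrix W) \<noteq> 0"
  shows "V \<inter> W = {0}"
proof -
  obtain f I where fr: "wedge_frame V W f I" using wedge_frame_exists[OF V W d] .
  have "det (\<chi> i. f i) \<noteq> 0" using wedge_frame_det[OF fr] nz by auto
  then have "\<exists>B. B ** (\<chi> i. f i) = mat 1" unfolding invertible_det_nz[symmetric] invertible_left_inverse .
  then have sp: "span (rows (\<chi> i. f i)) = UNIV" by (simp only: matrix_left_invertible_span_rows span_vec_eq)
  let ?U = "{x + y |x y. x \<in> V \<and> y \<in> W}"
  have U: "subspace ?U" by (rule subspace_sums[OF V W])
  have "f ` I \<subseteq> V" "f ` (- I) \<subseteq> W" using fr orthonormal_basisD(7) unfolding wedge_frame_def by blast+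
  then have "f i \<in> V \<or> f i \<in> W" for i by blast
  moreover have "V \<subseteq> ?U" "W \<subseteq> ?U" using subspace_0[OF V] subspace_0[OF W] by force+
  ultimately have "range f \<subseteq> ?U" by blast
  moreover have "rows (\<chi> i. f i) = range f" by (auto simp: rows_def row_def)
  ultimately have "rows (\<chi> i. f i) \<subseteq> ?U" by (simp only:)
  then have "span (rows (\<chi> i. f i)) \<subseteq> ?U" by (rule span_minimal[OF _ U])
  then have "?U = UNIV" unfolding sp by (simp only: top.extremum_unique)
  then have "dim ?U = CARD('n)" by simp
  then have "dim (V \<inter> W) = 0" using dim_sums_Int[OF V W] d by simp
  then show ?thesis using V W by (auto simp: dim_eq_0 subspace_0)
qed

lemma wedge_abs_pos:
  fixes V W :: "(real^'n) set"
  assumes "subspace V" "subspace W" "dim V + dim W = CARD('n)" "V \<inter> W = {0}"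
  shows "wedge_abs V W > 0"
proof -
  obtain f I where fr: "wedge_frame V W f I" using wedge_frame_exists[OF assms(1-3)] .
  show ?thesis unfolding wedge_abs_frame[OF fr] using wedge_frame_det_nonzero[OF fr assms(4)] by simp
qed

text \<open>By dimensions \<open>V\<close> and \<open>W\<^sup>\<bottom>\<close> together span
  everything, and a vector of \<open>V\<^sup>\<bottom> \<inter> W\<close> is orthogonal to both.
  This turns (T) into transversality of the normal space and the plane.\<close>

lemma transverse_orthogonal_comp:
  fixes V W :: "(real^'n) set"
  assumes V: "subspace V" and W: "subspace W" and d: "dim V = dim W" and t: "V \<inter> W\<^sup>\<bottom> = {0}"
  shows "V\<^sup>\<bottom> \<inter> W = {0}"
proof -
  have "dim {x + y |x y. x \<in> V \<and> y \<in> W\<^sup>\<bottom>} + dim (V \<inter> W\<^sup>\<bottom>) = dim V + dim (W\<^sup>\<bottom>)"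
    by (rule dim_sums_Int[OF V subspace_orthogonal_comp])
  then have "dim {x + y |x y. x \<in> V \<and> y \<in> W\<^sup>\<bottom>} = DIM(real^'n)" using t d dim_orthogonal_comp[OF W] by simp
  then have full: "span {x + y |x y. x \<in> V \<and> y \<in> W\<^sup>\<bottom>} = UNIV" by (simp only: dim_eq_full)
  have "x = 0" if x: "x \<in> V\<^sup>\<bottom>" "x \<in> W" for x
  proof -
    have "orthogonal x z" if "z \<in> {x + y |x y. x \<in> V \<and> y \<in> W\<^sup>\<bottom>}" for z
      using that x by (auto simp: orthogonal_comp_def orthogonal_def inner_add_right inner_commute)
    then have "orthogonal x x" using full orthogonal_to_span[of x] by blast
    then show ?thesis by (simp add: orthogonal_self)
  qed
  moreover have "0 \<in> V\<^sup>\<bottom> \<inter> W" using W by (simp add: subspace_0 subspace_orthogonal_comp)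
  ultimately show ?thesis by blast
qed

text \<open>Complete \<open>D\<close> by an orthonormal frame of the normal space to a square matrix \<open>A\<close>. In \<open>F A\<close> and in
  \<open>A\<^sup>T A\<close> the rows of the normal indices are rows of the identity.\<close>

lemma wedge_abs_jacobian:
  fixes D :: "real^'k^'n" and b :: "'k \<Rightarrow> real^'n"
  assumes b: "inj b" "orthonormal_basis (range b) \<pi>" and rk: "rank D = CARD('k)"
  shows "wedge_abs ((range ((*v) D))\<^sup>\<bottom>) \<pi> * sqrt (det (transpose D ** D)) = \<bar>det ((\<chi> i. b i) ** D)\<bar>"
proof -
  let ?T = "range ((*v) D)"
  have sT: "subspace ?T" by (metis linear_subspace_image matrix_vector_mul_linear subspace_UNIV)
  have dT: "dim ?T = CARD('k)" using rk by (simp add: rank_dim_range)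
  have d\<pi>: "dim \<pi> = CARD('k)" using orthonormal_basisD(2)[OF b(2)] b(1) by (simp add: card_image)
  have d: "dim (?T\<^sup>\<bottom>) + dim \<pi> = CARD('n)" using dim_orthogonal_comp[OF sT] dT d\<pi> by simp
  then have "CARD('k) \<le> CARD('n)" using d\<pi> by simp
  then obtain \<tau> :: "'k \<Rightarrow> 'n" where \<tau>: "inj \<tau>" using card_le_inj[of "UNIV :: 'k set" "UNIV :: 'n set"] by auto
  \<comment> \<open>The indices in \<open>range \<tau>\<close> carry the prescribed basis of the
    plane in the order of \<open>'k\<close>; those in \<open>I\<close> are left for the normal
    frame.\<close>
  define I where "I = - range \<tau>"
  have im: "(b \<circ> inv \<tau>) ` (- I) = range b" using \<tau> by (auto simp: I_def image_image)
  have "inj_on (b \<circ> inv \<tau>) (- I)" using \<tau> b(1) by (auto simp: I_def inj_on_def)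
  then obtain f where f: "wedge_frame (?T\<^sup>\<bottom>) \<pi> f I" "\<And>i. i \<notin> I \<Longrightarrow> f i = (b \<circ> inv \<tau>) i"
    using wedge_frame_extend[OF subspace_orthogonal_comp d, of "b \<circ> inv \<tau>" I] b(2) im by metis
  have fI: "inj_on f I" "orthonormal_basis (f ` I) (?T\<^sup>\<bottom>)" using f(1) by (auto simp: wedge_frame_def)
  have f\<tau>: "f (\<tau> a) = b a" for a using f(2)[of "\<tau> a"] \<tau> by (simp add: I_def)
  let ?F = "\<chi> i. f i"
  define A :: "real^'n^'n" where "A = (\<chi> r c. if c \<in> I then f c $ r else D $ r $ inv \<tau> c)"
  have colD: "f i \<bullet> (D *v x) = 0" if "i \<in> I" for i x
  proof -
    have "f i \<in> ?T\<^sup>\<bottom>" using orthonormal_basisD(7)[OF fI(2)] that by auto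
    then show ?thesis by (auto simp: orthogonal_comp_def orthogonal_def inner_commute)
  qed
  have Dcol: "D *v axis a 1 = (\<chi> r. D $ r $ a)" for a
    by (simp add: matrix_vector_mul_component vec_eq_iff inner_axis)
  have colA: "column c A = (if c \<in> I then f c else D *v axis (inv \<tau> c) 1)" for c
    by (simp add: A_def column_def Dcol vec_eq_iff)
  have FA: "(?F ** A) $ i $ j = f i \<bullet> column j A" for i j
    by (simp add: matrix_matrix_mult_def inner_vec_def column_def)
  have AA: "(transpose A ** A) $ i $ j = column i A \<bullet> column j A" for i j
    by (simp add: matrix_matrix_mult_def inner_vec_def column_def transpose_def)
  have orth: "f i \<bullet> f j = (if i = j then 1 else 0)" if "i \<in> I" "j \<in> I" for i j
    using orthonormal_basisD(4)[OF fI(2)] that fI(1) by (auto simp: inj_on_def)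
  have row: "f i \<bullet> column j A = (if i = j then 1 else 0)" if "i \<in> I" for i j
    using that orth colD by (auto simp: colA)
  have AAr: "(transpose A ** A) $ i $ j = (if i = j then 1 else 0)" if "i \<in> I" for i j
    unfolding AA using row[OF that, of j] that by (simp only: colA[of i] if_True)
  have R: "i \<notin> range \<tau> \<longleftrightarrow> i \<in> I" for i by (simp add: I_def)
  have "det (?F ** A) = det (\<chi> a c. (?F ** A) $ \<tau> a $ \<tau> c)"
    by (rule det_identity_rows[OF \<tau>]) (simp add: FA R row)
  also have "(\<chi> a c. (?F ** A) $ \<tau> a $ \<tau> c) = (\<chi> i. b i) ** D"
    unfolding FA f\<tau> colA using \<tau>
    by (simp add: vec_eq_iff I_def matrix_matrix_mult_def Dcol inner_vec_def)
  finally have 1: "det ?F * det A = det ((\<chi> i. b i) ** D)" by (simp add: det_mul)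
  have "det (transpose A ** A) = det (\<chi> a c. (transpose A ** A) $ \<tau> a $ \<tau> c)"
    by (rule det_identity_rows[OF \<tau>]) (simp add: R AAr)
  also have "(\<chi> a c. (transpose A ** A) $ \<tau> a $ \<tau> c) = transpose D ** D"
    unfolding AA colA using \<tau>
    by (simp add: vec_eq_iff I_def matrix_matrix_mult_def Dcol inner_vec_def transpose_def)
  finally have "det A * det A = det (transpose D ** D)" by (simp add: det_mul det_transpose)
  then have 2: "sqrt (det (transpose D ** D)) = \<bar>det A\<bar>" by (metis real_sqrt_abs2)
  show ?thesis unfolding wedge_abs_frame[OF f(1)] 2 1[symmetric] by (simp add: abs_mult)
qed

section \<open>Continuous dependence of the normal projection on the derivative\<close>

lemma matrix_vector_inner_transpose:
  fixes D :: "real^'k^'n"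
  shows "(D *v w) \<bullet> z = w \<bullet> (transpose D *v z)"
  by (metis dot_lmul_matrix inner_commute transpose_matrix_vector)

lemma det_gram_nonzero:
  fixes D :: "real^'k^'n"
  assumes "rank D = CARD('k)"
  shows "det (transpose D ** D) \<noteq> 0"
proof -
  have inj: "inj ((*v) D)" using assms by (simp add: full_rank_injective)
  have "x = 0" if "(transpose D ** D) *v x = 0" for x
  proof -
    have "(D *v x) \<bullet> (D *v x) = ((transpose D ** D) *v x) \<bullet> x"
      by (simp add: matrix_vector_inner_transpose matrix_vector_mul_assoc inner_commute)
    then have "D *v x = 0" using that by simp
    then show "x = 0" using inj by (metis injD matrix_vector_mult_0_right)
  qed
  then have "invertible (transpose D ** D)"
    unfolding invertible_left_inverse matrix_left_invertible_ker by blast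
  then show ?thesis by (simp add: invertible_det_nz)
qed

text \<open>Cramer's rule for the normal equations, which makes continuity in \<open>D\<close> evident.\<close>

definition least_squares :: "real^'k^'n \<Rightarrow> real^'n \<Rightarrow> real^'k" where
  "least_squares D x =
    (\<chi> k. det (\<chi> i j. if j = k then (transpose D *v x) $ i else (transpose D ** D) $ i $ j)
      / det (transpose D ** D))"

text \<open>The normal equations say that the residual of the least squares fit is orthogonal to the
  range of \<open>D\<close>, while the fit itself lies in that range. The residual is therefore the
  projection to the orthogonal complement.\<close>

lemma projection_matrix_range_comp:
  fixes D :: "real^'k^'n"
  assumes rk: "rank D = CARD('k)"
  shows "projection_matrix ((range ((*v) D))\<^sup>\<bottom>) =
    (\<chi> r c. (axis c 1 - D *v least_squares D (axis c 1)) $ r)"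
proof -
  have "closest_point ((range ((*v) D))\<^sup>\<bottom>) x =
     x - D *v least_squares D x" for x
  proof (rule closest_point_subspace[OF subspace_orthogonal_comp])
    let ?c = "least_squares D x"
    have c: "(transpose D ** D) *v ?c = transpose D *v x"
      unfolding least_squares_def using cramer[OF det_gram_nonzero[OF rk]] by blast
    have "(D *v w) \<bullet> (x - D *v ?c) = 0" for w
    proof -
      have "(D *v w) \<bullet> (x - D *v ?c) = w \<bullet> (transpose D *v (x - D *v ?c))"
        by (rule matrix_vector_inner_transpose)
      also have "transpose D *v (x - D *v ?c) = 0"
        using c by (simp add: matrix_vector_mult_diff_distrib matrix_vector_mul_assoc)
      finally show ?thesis by simp
    qed
    then show "x - D *v ?c \<in> (range ((*v) D))\<^sup>\<bottom>" by (auto simp: orthogonal_comp_def orthogonal_def)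
    show "(x - (x - D *v ?c)) \<bullet> v = 0" if "v \<in> (range ((*v) D))\<^sup>\<bottom>" for v
      using that by (auto simp: orthogonal_comp_def orthogonal_def)
  qed
  then show ?thesis by (simp add: projection_matrix_def matrix_def)
qed

lemma continuous_on_det:
  fixes A :: "'a::topological_space \<Rightarrow> real^'n^'n"
  assumes "\<And>i j. continuous_on U (\<lambda>u. A u $ i $ j)"
  shows "continuous_on U (\<lambda>u. det (A u))"
  unfolding det_def by (intro continuous_on_sum continuous_on_mult continuous_on_prod continuous_on_const assms)

lemma continuous_on_projection_matrix_range_comp:
  fixes D :: "'a::topological_space \<Rightarrow> real^'k^'n"
  assumes D: "continuous_on U D" and rk: "\<And>u. u \<in> U \<Longrightarrow> rank (D u) = CARD('k)"
  shows "continuous_on U (\<lambda>u. projection_matrix ((range ((*v) (D u)))\<^sup>\<bottom>))"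
proof -
  have Dc: "continuous_on U (\<lambda>u. D u $ i $ j)" for i j using D by (intro continuous_intros)
  have g: "continuous_on U (\<lambda>u. (transpose (D u) ** D u) $ i $ j)" for i j
    unfolding matrix_matrix_mult_def transpose_def by (simp, intro continuous_intros Dc)
  have dt: "continuous_on U (\<lambda>u. det (transpose (D u) ** D u))"
    unfolding det_def by (intro continuous_intros g)
  define N where "N = (\<lambda>k c u. det (\<chi> i j.
    if j = k then (transpose (D u) *v axis c 1) $ i else (transpose (D u) ** D u) $ i $ j))"
  have N: "continuous_on U (N k c)" for k c
  proof -
    have "continuous_on U (\<lambda>u. if j = k then (transpose (D u) *v axis c 1) $ i else (transpose (D u) ** D u) $ i $ j)"
        for i j
    proof (cases "j = k")
      case True
      then show ?thesis by (simp add: matrix_vector_mul_component inner_axis transpose_def Dc)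
    next
      case False
      then show ?thesis using g by simp
    qed
    then show ?thesis unfolding N_def det_def by (simp add: continuous_on_sum continuous_on_prod continuous_on_mult)
  qed
  have "continuous_on U (\<lambda>u. \<chi> r c. axis c 1 $ r - (\<Sum>k\<in>UNIV. D u $ r $ k * (N k c u / det (transpose (D u) ** D u))))"
  proof (intro continuous_on_vec_lambda continuous_on_diff continuous_on_const continuous_on_sum continuous_on_mult
      continuous_on_divide Dc dt)
    show "continuous_on U (N k c)" for k c by (rule N)
    show "\<forall>u\<in>U. det (transpose (D u) ** D u) \<noteq> 0" using det_gram_nonzero[OF rk] by blast
  qed
  then show ?thesis
  proof (rule continuous_on_eq)
    fix u assume u: "u \<in> U"
    show "(\<chi> r c. axis c 1 $ r - (\<Sum>k\<in>UNIV. D u $ r $ k * (N k c u / det (transpose (D u) ** D u))))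
        = projection_matrix ((range ((*v) (D u)))\<^sup>\<bottom>)"
      unfolding projection_matrix_range_comp[OF rk[OF u]] least_squares_def N_def vec_eq_iff
      by (simp add: matrix_vector_mult_def)
  qed
qed

section \<open>Manifolds transverse to a plane\<close>

lemma C1_parametrisationD:
  fixes \<psi> :: "real^'k \<Rightarrow> real^'n"
  assumes p: "C1_parametrisation \<psi> W S"
  shows "open W" "openin (top_of_set S) (\<psi> ` W)" "\<psi> ` W \<subseteq> S" "continuous_on W \<psi>" "inj_on \<psi> W"
    "\<And>u. u \<in> W \<Longrightarrow> (\<psi> has_derivative (*v) (jacobian \<psi> (at u))) (at u)"
    "continuous_on W (\<lambda>u. jacobian \<psi> (at u))"
    "\<And>u. u \<in> W \<Longrightarrow> rank (jacobian \<psi> (at u)) = CARD('k)"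
proof -
  obtain \<phi> where h: "homeomorphism W (\<psi> ` W) \<psi> \<phi>" using p by (auto simp: C1_parametrisation_def)
  show "continuous_on W \<psi>" using h by (simp add: homeomorphism_def)
  show "inj_on \<psi> W" using h by (auto simp: homeomorphism_def intro: inj_on_inverseI)
  show "openin (top_of_set S) (\<psi> ` W)" using p by (simp add: C1_parametrisation_def)
  then show "\<psi> ` W \<subseteq> S" by (simp add: openin_imp_subset)
  show "(\<psi> has_derivative (*v) (jacobian \<psi> (at u))) (at u)" if "u \<in> W" for u
    using p that jacobian_works[of \<psi> "at u"] by (simp add: C1_parametrisation_def)
qed (use p in \<open>auto simp: C1_parametrisation_def\<close>)

lemma range_jacobian_subset_tangent_space:
  assumes p: "C1_parametrisation \<psi> W S" and u: "u \<in> W"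
  shows "range ((*v) (jacobian \<psi> (at u))) \<subseteq> tangent_space S (\<psi> u)"
proof clarify
  let ?D = "jacobian \<psi> (at u)"
  note P = C1_parametrisationD[OF p]
  fix w
  let ?\<gamma> = "\<lambda>t. \<psi> (u + t *\<^sub>R w)"
  have "((\<lambda>t. u + t *\<^sub>R w) \<longlongrightarrow> u + 0 *\<^sub>R w) (nhds (0::real))"
    by (intro tendsto_intros filterlim_ident)
  then have "\<forall>\<^sub>F t in nhds (0::real). u + t *\<^sub>R w \<in> W"
    using P(1) u by (intro topological_tendstoD) auto
  then have 1: "\<forall>\<^sub>F t in nhds (0::real). ?\<gamma> t \<in> S"
    by eventually_elim (use P(3) in blast)
  have "((\<lambda>t::real. u + t *\<^sub>R w) has_derivative (\<lambda>t. t *\<^sub>R w)) (at 0)"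
    by (auto intro!: derivative_eq_intros)
  moreover have "(\<psi> has_derivative (*v) ?D) (at (u + 0 *\<^sub>R w))" using P(6)[OF u] by simp
  ultimately have "(?\<gamma> has_derivative (\<lambda>t. ?D *v (t *\<^sub>R w))) (at 0)"
    by (rule has_derivative_compose)
  then have "(?\<gamma> has_vector_derivative ?D *v w) (at 0)"
    by (simp add: has_vector_derivative_def matrix_vector_mult_scaleR)
  with 1 show "?D *v w \<in> tangent_space S (\<psi> u)"
    unfolding tangent_space_def by (auto intro!: exI[of _ ?\<gamma>])
qed

text \<open>The orthonormal basis is indexed by \<open>'k\<close>, so that coordinates on the plane
  have the same type as the parameter domains. \<open>Q\<close> composed with a parametrisation is
  then a map from \<open>real^'k\<close> to itself, to which invariance of domain and the change of
  variables formula apply.\<close>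

locale transverse_manifold =
  fixes S \<pi> :: "(real^'n) set" and b :: "'k::finite \<Rightarrow> real^'n"
  assumes S: "C1_submanifold TYPE('k) S"
    and b: "inj b" "orthonormal_basis (range b) \<pi>"
    and T: "\<And>\<xi>. \<xi> \<in> S \<Longrightarrow> tangent_space S \<xi> \<inter> \<pi>\<^sup>\<bottom> = {0}"
    and GT: "\<And>\<xi> \<eta>. \<xi> \<in> S \<Longrightarrow> \<eta> \<in> S \<Longrightarrow> span {\<xi> - \<eta>} \<inter> \<pi>\<^sup>\<bottom> = {0}"
begin

definition Q :: "real^'n \<Rightarrow> real^'k" where "Q \<xi> = (\<chi> i. b i) *v \<xi>"

definition V :: "(real^'k) set" where "V = Q ` S"

text \<open>Its values off \<open>V\<close> are arbitrary, which is why the integrands below carry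
  an indicator of \<open>V\<close>.\<close>

definition s :: "real^'k \<Rightarrow> real^'n" where "s = inv_into S Q"

definition J :: "real^'n \<Rightarrow> real" where "J \<xi> = wedge_abs ((tangent_space S \<xi>)\<^sup>\<bottom>) \<pi>"

abbreviation chart :: "(real^'k \<Rightarrow> real^'n) \<Rightarrow> (real^'k) set \<Rightarrow> bool" where
  "chart \<psi> W \<equiv> C1_parametrisation \<psi> W S"

lemma Q_nth: "Q \<xi> $ i = b i \<bullet> \<xi>"
  by (simp add: Q_def matrix_vector_mul_component)

lemma Q_linear: "linear Q"
  unfolding Q_def by (rule matrix_vector_mul_linear)

lemma Q_continuous: "continuous_on A Q"
  using Q_linear linear_conv_bounded_linear linear_continuous_on by blast

lemma parametrisation_exists:
  assumes "\<xi> \<in> S"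
  obtains \<psi> W u where "chart \<psi> W" "u \<in> W" "\<xi> = \<psi> u"
  using S assms unfolding C1_submanifold_def by blast

lemma pi_dim: "subspace \<pi>" "dim \<pi> = CARD('k)"
  using orthonormal_basisD(2,6)[OF b(2)] b(1) by (auto simp: card_image)

lemma Q_eq_0:
  assumes "Q \<xi> = 0"
  shows "\<xi> \<in> \<pi>\<^sup>\<bottom>"
proof -
  have "b i \<bullet> \<xi> = 0" for i using assms by (simp flip: Q_nth)
  then have "orthogonal \<xi> v" if "v \<in> range b" for v
    using that by (auto simp: orthogonal_def inner_commute[of \<xi>])
  then have "orthogonal \<xi> v" if "v \<in> \<pi>" for v
    using orthogonal_to_span[of v "range b" \<xi>] orthonormal_basisD(5)[OF b(2)] that by auto
  then show ?thesis by (auto simp: orthogonal_comp_def orthogonal_commute)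
qed

lemma Q_inj: "inj_on Q S"
proof (rule inj_onI)
  fix \<xi> \<eta> assume *: "\<xi> \<in> S" "\<eta> \<in> S" "Q \<xi> = Q \<eta>"
  then have "\<xi> - \<eta> \<in> \<pi>\<^sup>\<bottom>" by (intro Q_eq_0) (simp add: linear_diff[OF Q_linear])
  then have "\<xi> - \<eta> \<in> span {\<xi> - \<eta>} \<inter> \<pi>\<^sup>\<bottom>" by (simp add: span_base)
  then show "\<xi> = \<eta>" unfolding GT[OF *(1,2)] by simp
qed

lemma s_Q[simp]: "\<xi> \<in> S \<Longrightarrow> s (Q \<xi>) = \<xi>"
  by (simp add: s_def Q_inj)

lemma Q_s[simp]: "v \<in> V \<Longrightarrow> Q (s v) = v" and s_in[simp]: "v \<in> V \<Longrightarrow> s v \<in> S"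
  by (auto simp: V_def)

lemma Q_in[simp]: "\<xi> \<in> S \<Longrightarrow> Q \<xi> \<in> V"
  by (auto simp: V_def)

text \<open>(GT) makes the composition of \<open>Q\<close> with a chart injective, and invariance of
  domain makes its image open. On that image \<open>s\<close> is the chart applied to the continuous
  inverse, which gives continuity of \<open>s\<close> without differentiating it.\<close>

lemma chart_Q:
  assumes p: "chart \<psi> W"
  shows "continuous_on W (\<lambda>u. Q (\<psi> u))" "inj_on (\<lambda>u. Q (\<psi> u)) W" "open ((\<lambda>u. Q (\<psi> u)) ` W)"
    "\<And>u. u \<in> W \<Longrightarrow> ((\<lambda>u. Q (\<psi> u)) has_derivative (*v) ((\<chi> i. b i) ** jacobian \<psi> (at u))) (at u)"
    "continuous_on ((\<lambda>u. Q (\<psi> u)) ` W) (inv_into W (\<lambda>u. Q (\<psi> u)))"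
    "continuous_on ((\<lambda>u. Q (\<psi> u)) ` W) s" "(\<lambda>u. Q (\<psi> u)) ` W \<subseteq> V"
proof -
  note P = C1_parametrisationD[OF p]
  show c: "continuous_on W (\<lambda>u. Q (\<psi> u))"
    by (rule continuous_on_compose2[OF Q_continuous[of UNIV] P(4)]) auto
  show i: "inj_on (\<lambda>u. Q (\<psi> u)) W"
  proof (rule inj_onI)
    fix x y assume *: "x \<in> W" "y \<in> W" "Q (\<psi> x) = Q (\<psi> y)"
    then have "\<psi> x = \<psi> y" using P(3) by (intro inj_onD[OF Q_inj]) auto
    then show "x = y" using inj_onD[OF P(5)] * by blast
  qed
  show o: "open ((\<lambda>u. Q (\<psi> u)) ` W)" by (rule invariance_of_domain[OF c P(1) i])
  show "((\<lambda>u. Q (\<psi> u)) has_derivative (*v) ((\<chi> i. b i) ** jacobian \<psi> (at u))) (at u)" if "u \<in> W" for u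
  proof -
    have "bounded_linear Q" using Q_linear by (simp add: linear_conv_bounded_linear)
    from has_derivative_compose[OF P(6)[OF that] bounded_linear_imp_has_derivative[OF this]]
    show ?thesis unfolding Q_def by (simp add: matrix_vector_mul_assoc)
  qed
  have inv_h: "inv_into W (\<lambda>u. Q (\<psi> u)) (Q (\<psi> x)) = x" if "x \<in> W" for x
    using inv_into_f_f[OF i that] by simp
  show inv: "continuous_on ((\<lambda>u. Q (\<psi> u)) ` W) (inv_into W (\<lambda>u. Q (\<psi> u)))"
    by (rule continuous_on_inverse_open[OF P(1) c]) (auto simp: inv_h)
  have "continuous_on ((\<lambda>u. Q (\<psi> u)) ` W) (\<lambda>v. \<psi> (inv_into W (\<lambda>u. Q (\<psi> u)) v))"
    by (rule continuous_on_compose2[OF P(4) inv]) (auto simp: inv_h)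
  then show "continuous_on ((\<lambda>u. Q (\<psi> u)) ` W) s"
    by (rule continuous_on_eq) (use P(3) inv_h in auto)
  show "(\<lambda>u. Q (\<psi> u)) ` W \<subseteq> V" using P(3) by (auto simp: V_def)
qed

lemma open_V: "open V"
proof (subst open_subopen, clarify)
  fix v assume "v \<in> V"
  then obtain \<xi> where \<xi>: "\<xi> \<in> S" "v = Q \<xi>" by (auto simp: V_def)
  obtain \<psi> W u where p: "chart \<psi> W" "u \<in> W" "\<xi> = \<psi> u"
    using parametrisation_exists[OF \<xi>(1)] .
  show "\<exists>T. open T \<and> v \<in> T \<and> T \<subseteq> V"
    using chart_Q(3,7)[OF p(1)] p(2,3) \<xi>(2) by blast
qed

lemma s_continuous: "continuous_on V s"
proof (subst continuous_on_eq_continuous_at[OF open_V], clarify)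
  fix v assume "v \<in> V"
  then obtain \<xi> where \<xi>: "\<xi> \<in> S" "v = Q \<xi>" by (auto simp: V_def)
  obtain \<psi> W u where p: "chart \<psi> W" "u \<in> W" "\<xi> = \<psi> u"
    using parametrisation_exists[OF \<xi>(1)] .
  show "isCont s v"
    using chart_Q(6)[OF p(1)] chart_Q(3)[OF p(1)] p \<xi>(2) by (auto simp: continuous_on_eq_continuous_at)
qed

text \<open>A curve \<open>\<gamma>\<close> in \<open>S\<close> is pulled back by the local inverse
  of \<open>Q\<close> composed with \<open>\<psi>\<close>, which is differentiable at the base point
  by the inverse function theorem. Near \<open>0\<close> it has the form \<open>\<psi>\<close> of a
  curve in the parameter domain, so the chain rule puts its velocity into the range of the
  Jacobian.\<close>

lemma tangent_space_chart:
  assumes p: "chart \<psi> W" and u: "u \<in> W"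
  shows "tangent_space S (\<psi> u) = range ((*v) (jacobian \<psi> (at u)))"
proof (intro equalityI range_jacobian_subset_tangent_space[OF p u] subsetI)
  let ?D = "jacobian \<psi> (at u)" and ?h = "\<lambda>u. Q (\<psi> u)"
  note P = C1_parametrisationD[OF p] and C = chart_Q[OF p]
  have uS: "\<psi> u \<in> S" using P(3) u by blast
  \<comment> \<open>(T) enters here: a kernel vector is mapped by the Jacobian to a tangent vector
    orthogonal to the plane. This yields the invertible derivative that the inverse function theorem
    asks for.\<close>
  have "x = 0" if x: "((\<chi> i. b i) ** ?D) *v x = 0" for x
  proof -
    have "?D *v x \<in> tangent_space S (\<psi> u) \<inter> \<pi>\<^sup>\<bottom>"
      using x range_jacobian_subset_tangent_space[OF p u] by (auto simp: Q_def matrix_vector_mul_assoc intro!: Q_eq_0)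
    then have "?D *v x = ?D *v 0" unfolding T[OF uS] by simp
    then show "x = 0" using P(8)[OF u] unfolding full_rank_injective by (rule injD[rotated])
  qed
  then obtain B where "B ** ((\<chi> i. b i) ** ?D) = mat 1"
    using matrix_left_invertible_ker[of "(\<chi> i. b i) ** ?D"] by blast
  then have B: "((\<chi> i. b i) ** ?D) ** B = mat 1" by (simp only: matrix_left_right_inverse)
  have g: "(inv_into W ?h has_derivative (*v) B) (at (?h u))"
  proof (rule has_derivative_inverse_strong[OF P(1) u C(1) _ C(4)[OF u]])
    show "inv_into W ?h (?h x) = x" if "x \<in> W" for x using inv_into_f_f[OF C(2) that] .
    show "(*v) ((\<chi> i. b i) ** ?D) \<circ> (*v) B = id" by (simp add: fun_eq_iff matrix_vector_mul_assoc B)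
  qed
  fix v assume "v \<in> tangent_space S (\<psi> u)"
  then obtain \<gamma> :: "real \<Rightarrow> real^'n"
      where \<gamma>: "\<gamma> 0 = \<psi> u" "\<forall>\<^sub>F t in nhds 0. \<gamma> t \<in> S" "(\<gamma> has_vector_derivative v) (at 0)"
    by (auto simp: tangent_space_def)
  have "bounded_linear Q" using Q_linear by (simp add: linear_conv_bounded_linear)
  from has_derivative_compose[OF \<gamma>(3)[unfolded has_vector_derivative_def] bounded_linear_imp_has_derivative[OF this]]
  have Q\<gamma>: "((\<lambda>t. Q (\<gamma> t)) has_derivative (\<lambda>t. t *\<^sub>R Q v)) (at 0)" by (simp add: linear_cmul[OF Q_linear])
  have "inv_into W ?h (?h u) = u" by (rule inv_into_f_f[OF C(2) u])
  then have "((\<lambda>t. \<psi> (inv_into W ?h (Q (\<gamma> t)))) has_derivative (\<lambda>t. ?D *v (B *v (t *\<^sub>R Q v)))) (at 0)"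
    using g by (intro has_derivative_compose[OF has_derivative_compose[OF Q\<gamma>]]) (simp_all add: P(6)[OF u] \<gamma>(1))
  moreover have "\<forall>\<^sub>F t in at 0. \<psi> (inv_into W ?h (Q (\<gamma> t))) = \<gamma> t"
  proof -
    have "((\<lambda>t. Q (\<gamma> t)) \<longlongrightarrow> ?h u) (at 0)"
      using has_derivative_continuous[OF Q\<gamma>] by (simp add: continuous_within \<gamma>(1))
    then have "\<forall>\<^sub>F t in at 0. Q (\<gamma> t) \<in> ?h ` W" by (rule topological_tendstoD[OF _ C(3)]) (use u in blast)
    moreover have "\<forall>\<^sub>F t in at 0. \<gamma> t \<in> S" using \<gamma>(2) by (simp add: eventually_at_filter eventually_mono)
    ultimately show ?thesis
    proof eventually_elim
      case (elim t)
      then obtain w where w: "w \<in> W" "Q (\<gamma> t) = ?h w" by blast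
      then have "\<gamma> t = \<psi> w" using elim P(3) by (intro inj_onD[OF Q_inj]) auto
      then show ?case using w inv_into_f_f[OF C(2) w(1)] by simp
    qed
  qed
  ultimately have "(\<gamma> has_derivative (\<lambda>t. ?D *v (B *v (t *\<^sub>R Q v)))) (at 0)"
    by (rule has_derivative_transform_eventually) (simp_all add: \<gamma>(1) \<open>inv_into W ?h (?h u) = u\<close>)
  then have "(\<gamma> has_vector_derivative ?D *v (B *v Q v)) (at 0)"
    by (simp add: has_vector_derivative_def matrix_vector_mult_scaleR)
  then have "v = ?D *v (B *v Q v)" using \<gamma>(3) by (rule vector_derivative_unique_at[rotated])
  then show "v \<in> range ((*v) ?D)" by blast
qed

lemma tangent_props:
  assumes \<xi>: "\<xi> \<in> S"
  shows "subspace (tangent_space S \<xi>)" "dim (tangent_space S \<xi>) = CARD('k)" "J \<xi> > 0"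
    "dim ((tangent_space S \<xi>)\<^sup>\<bottom>) = CARD('n) - CARD('k)" "dim ((tangent_space S \<xi>)\<^sup>\<bottom>) + dim \<pi> = CARD('n)"
    "(tangent_space S \<xi>)\<^sup>\<bottom> \<inter> \<pi> = {0}"
proof -
  obtain \<psi> W u where p: "chart \<psi> W" "u \<in> W" "\<xi> = \<psi> u"
    using parametrisation_exists[OF \<xi>] .
  have t: "tangent_space S \<xi> = range ((*v) (jacobian \<psi> (at u)))" using tangent_space_chart[OF p(1,2)] p(3) by simp
  show s: "subspace (tangent_space S \<xi>)" unfolding t
    by (intro linear_subspace_image matrix_vector_mul_linear subspace_UNIV)
  show d: "dim (tangent_space S \<xi>) = CARD('k)" unfolding t using C1_parametrisationD(8)[OF p(1,2)]
    by (simp add: rank_dim_range)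
  show d': "dim ((tangent_space S \<xi>)\<^sup>\<bottom>) = CARD('n) - CARD('k)" "dim ((tangent_space S \<xi>)\<^sup>\<bottom>) + dim \<pi> = CARD('n)"
    using dim_orthogonal_comp[OF s] d pi_dim by auto
  show t': "(tangent_space S \<xi>)\<^sup>\<bottom> \<inter> \<pi> = {0}"
    using transverse_orthogonal_comp[OF s pi_dim(1)] d pi_dim T[OF \<xi>] by simp
  show "J \<xi> > 0" unfolding J_def by (rule wedge_abs_pos[OF subspace_orthogonal_comp pi_dim(1) d'(2) t'])
qed

lemma J_sqrt: "\<xi> \<in> S \<Longrightarrow> J \<xi> = sqrt (det (projection_matrix ((tangent_space S \<xi>)\<^sup>\<bottom>) + projection_matrix \<pi>))"
  unfolding J_def using tangent_props(5) by (intro wedge_abs_eq subspace_orthogonal_comp pi_dim) auto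

text \<open>In a chart the normal projection is a continuous function of the parameter, and the
  inverse homeomorphism carries this to the image of the chart. That image is relatively open in
  \<open>S\<close>, so limits within it and within \<open>S\<close> agree.\<close>

lemma normal_projection_continuous: "continuous_on S (\<lambda>\<xi>. projection_matrix ((tangent_space S \<xi>)\<^sup>\<bottom>))"
  unfolding continuous_on_eq_continuous_within
proof
  let ?P = "\<lambda>\<xi>. projection_matrix ((tangent_space S \<xi>)\<^sup>\<bottom>)"
  fix \<xi> assume "\<xi> \<in> S"
  obtain \<psi> W u where p: "chart \<psi> W" "u \<in> W" "\<xi> = \<psi> u"
    using parametrisation_exists[OF \<open>\<xi> \<in> S\<close>] .
  note P = C1_parametrisationD[OF p(1)]
  obtain \<phi> where h: "homeomorphism W (\<psi> ` W) \<psi> \<phi>" using p by (auto simp: C1_parametrisation_def)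
  have "continuous_on W (\<lambda>u. projection_matrix ((range ((*v) (jacobian \<psi> (at u))))\<^sup>\<bottom>))"
    by (rule continuous_on_projection_matrix_range_comp[OF P(7,8)])
  then have "continuous_on W (\<lambda>u. ?P (\<psi> u))"
    by (rule continuous_on_eq) (simp add: tangent_space_chart[OF p(1)])
  then have "continuous_on (\<psi> ` W) (\<lambda>x. ?P (\<psi> (\<phi> x)))"
    by (rule continuous_on_compose2) (use h in \<open>auto simp: homeomorphism_def\<close>)
  then have "continuous_on (\<psi> ` W) ?P"
    by (rule continuous_on_eq) (use h in \<open>auto simp: homeomorphism_def\<close>)
  then have c: "continuous (at \<xi> within \<psi> ` W) ?P"
    using p by (auto simp: continuous_on_eq_continuous_within)
  obtain G where G: "open G" "\<psi> ` W = S \<inter> G" using P(2) by (auto simp: openin_open)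
  have "\<xi> \<in> G" using G p by blast
  then have "at \<xi> within \<psi> ` W = at \<xi> within S" by (rule at_within_nhd[OF _ G(1)]) (use G(2) in auto)
  then show "continuous (at \<xi> within S) ?P" using c by (simp add: continuous_within)
qed

lemma J_continuous: "continuous_on S J"
proof -
  have "continuous_on S (\<lambda>\<xi>. sqrt (det (projection_matrix ((tangent_space S \<xi>)\<^sup>\<bottom>) + projection_matrix \<pi>)))"
    by (intro continuous_intros continuous_on_det normal_projection_continuous)
  then show ?thesis by (rule continuous_on_eq) (simp add: J_sqrt)
qed

lemma Js_continuous: "continuous_on V (\<lambda>v. J (s v))"
  by (rule continuous_on_compose2[OF J_continuous s_continuous]) auto

section \<open>The surface measure in the single chart\<close>

lemma V_borel[measurable]: "V \<in> sets borel"
  using open_V by simp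

definition weight :: "real^'k \<Rightarrow> real" where "weight v = indicator V v * (1 / J (s v))"

lemma weight_measurable[measurable]: "weight \<in> borel_measurable borel"
proof -
  have "continuous_on V (\<lambda>v. 1 / J (s v))"
    using tangent_props(3) by (intro continuous_on_divide continuous_on_const Js_continuous) (metis less_irrefl s_in)
  then have "(\<lambda>v. indicator V v *\<^sub>R (1 / J (s v))) \<in> borel_measurable borel"
    by (intro borel_measurable_continuous_on_indicator) auto
  then show ?thesis by (simp add: weight_def[abs_def])
qed

lemma s_measurable: "s \<in> restrict_space lborel V \<rightarrow>\<^sub>M restrict_space borel S"
proof -
  have "s \<in> borel_measurable (restrict_space borel V)"
    by (rule borel_measurable_continuous_on_restrict[OF s_continuous])
  then have "s \<in> borel_measurable (restrict_space lborel V)"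
    by (simp cong: measurable_cong_sets add: sets_restrict_space)
  then show ?thesis by (intro measurable_restrict_space2) (auto simp: space_restrict_space)
qed

text \<open>The candidate for the definite description \<open>surface_measure\<close>; that it has
  the prescribed densities, and that nothing else does, remains to be shown.\<close>

definition sigma :: "(real^'n) measure" where
  "sigma = distr (density (restrict_space lborel V) (\<lambda>v. ennreal (weight v))) (restrict_space borel S) s"

lemma sets_sigma: "sets sigma = sets (restrict_space borel S)"
  by (simp add: sigma_def)

lemma weight_measurable': "weight \<in> borel_measurable (restrict_space lborel V)"
  by (intro measurable_restrict_space1) simp

lemma s_measurable': "s \<in> density (restrict_space lborel V) w \<rightarrow>\<^sub>M restrict_space borel S"
  using s_measurable by (simp cong: measurable_cong_sets)

lemma nn_integral_sigma:
  assumes f: "f \<in> borel_measurable (restrict_space borel S)"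
  shows "(\<integral>\<^sup>+\<xi>. f \<xi> \<partial>sigma) = (\<integral>\<^sup>+v. ennreal (weight v) * f (s v) * indicator V v \<partial>lborel)"
proof -
  have "(\<integral>\<^sup>+\<xi>. f \<xi> \<partial>sigma) = (\<integral>\<^sup>+v. f (s v) \<partial>density (restrict_space lborel V) (\<lambda>v. ennreal (weight v)))"
    unfolding sigma_def by (rule nn_integral_distr[OF s_measurable']) (simp add: f)
  also have "\<dots> = (\<integral>\<^sup>+v. ennreal (weight v) * f (s v) \<partial>restrict_space lborel V)"
    by (rule nn_integral_density[OF measurable_compose[OF weight_measurable' measurable_ennreal]
      measurable_compose[OF s_measurable f]])
  also have "\<dots> = (\<integral>\<^sup>+v. ennreal (weight v) * f (s v) * indicator V v \<partial>lborel)"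
    by (rule nn_integral_restrict_space) simp
  finally show ?thesis .
qed

text \<open>Substituting \<open>v = Q (\<psi> u)\<close> produces the factor \<open>|det|\<close> of
  the projected Jacobian. By \<open>wedge_abs_jacobian\<close> this is \<open>J\<close> times the
  Gram density, and the weight \<open>1 / J\<close> cancels the first factor.\<close>

lemma sigma_parametrisation:
  assumes p: "chart \<psi> W" and A: "A \<in> sets sigma" "A \<subseteq> \<psi> ` W"
  shows "emeasure sigma A = (\<integral>\<^sup>+u\<in>{u\<in>W. \<psi> u
      \<in> A}. ennreal (sqrt (det (transpose (jacobian \<psi> (at u)) ** jacobian \<psi> (at u)))) \<partial>lborel)"
proof -
  note P = C1_parametrisationD[OF p] and C = chart_Q[OF p]
  let ?h = "\<lambda>u. Q (\<psi> u)" and ?D = "\<lambda>u. jacobian \<psi> (at u)"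
  let ?E = "{u\<in>W. \<psi> u \<in> A}"
  have A': "A \<in> sets (restrict_space borel S)" using A by (simp add: sets_sigma)
  have \<psi>m: "\<psi> \<in> restrict_space borel W \<rightarrow>\<^sub>M restrict_space borel S"
    using P(3) by (intro measurable_restrict_space2 borel_measurable_continuous_on_restrict P(4))
      (auto simp: space_restrict_space)
  have E: "?E \<in> sets borel"
  proof -
    have "\<psi> -` A \<inter> space (restrict_space borel W) \<in> sets (restrict_space borel W)" by (rule measurable_sets[OF \<psi>m A'])
    moreover have "\<psi> -` A \<inter> space (restrict_space borel W) = ?E" by (auto simp: space_restrict_space)
    ultimately show ?thesis using P(1) by (simp add: sets_restrict_space_iff)
  qed
  have "emeasure sigma A = (\<integral>\<^sup>+\<xi>. indicator A \<xi> \<partial>sigma)" using A by simp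
  also have "\<dots> = (\<integral>\<^sup>+v. ennreal (weight v) * indicator A (s v) * indicator V v \<partial>lborel)"
    by (rule nn_integral_sigma) (use A' in simp)
  also have "\<dots> = (\<integral>\<^sup>+v. ennreal (weight v) * indicator (?h ` ?E) v \<partial>lborel)"
  proof (rule nn_integral_cong)
    fix v
    have "(v \<in> V \<and> s v \<in> A) \<longleftrightarrow> v \<in> ?h ` ?E"
    proof
      assume v: "v \<in> V \<and> s v \<in> A"
      then obtain u where "u \<in> W" "s v = \<psi> u" using A by blast
      then show "v \<in> ?h ` ?E" using v Q_s[of v] by (intro image_eqI[of _ _ u]) auto
    next
      assume "v \<in> ?h ` ?E"
      then show "v \<in> V \<and> s v \<in> A" using P(3) by auto
    qed
    then show "ennreal (weight v) * indicator A (s v) * indicator V v = ennreal (weight v) * indicator (?h ` ?E) v"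
      by (auto split: split_indicator simp: indicator_def)
  qed
  also have "\<dots> = (\<integral>\<^sup>+u. ennreal \<bar>det (matrix ((*v) ((\<chi> i. b i) ** ?D u)))\<bar> * ennreal (weight (?h u))
      * indicator ?E u \<partial>lborel)"
  proof (rule nn_integral_change_of_variables[OF E])
    show "?h \<in> borel_measurable (restrict_space borel ?E)"
      using C(1) by (intro borel_measurable_continuous_on_restrict) (auto intro: continuous_on_subset)
    show "inj_on ?h ?E" using C(2) by (rule inj_on_subset) auto
    show "(?h has_derivative (*v) ((\<chi> i. b i) ** ?D u)) (at u within ?E)" if "u \<in> ?E" for u
      using C(4)[of u] that by (auto intro: has_derivative_at_withinI)
    show "?h ` B \<in> sets borel" if B: "B \<in> sets borel" "B \<subseteq> ?E" for B
    proof -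
      have "?h ` B = inv_into W ?h -` B \<inter> space (restrict_space borel (?h ` W))"
        using B(2) C(2) by (auto simp: space_restrict_space image_iff)
          (metis (mono_tags, lifting) C(2) B(2) inv_into_f_f mem_Collect_eq subsetD)+
      also have "\<dots> \<in> sets (restrict_space borel (?h ` W))"
        by (rule measurable_sets[OF borel_measurable_continuous_on_restrict[OF C(5)] B(1)])
      finally show ?thesis using C(3) by (simp add: sets_restrict_space_iff)
    qed
    have "continuous_on W (\<lambda>u. det ((\<chi> i. b i) ** ?D u))"
    proof -
      have "continuous_on W (\<lambda>u. ((\<chi> i. b i) ** ?D u) $ i $ j)" for i j
        unfolding matrix_matrix_mult_def by (simp, intro continuous_intros P(7))
      then show ?thesis by (rule continuous_on_det)
    qed
    then have "(\<lambda>u. indicator W u *\<^sub>R det ((\<chi> i. b i) ** ?D u)) \<in> borel_measurable borel"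
      using P(1) by (intro borel_measurable_continuous_on_indicator) auto
    then have "(\<lambda>u. indicator W u *\<^sub>R det ((\<chi> i. b i) ** ?D u) * indicator ?E u) \<in> borel_measurable borel"
      using E by simp
    moreover have "(\<lambda>u. indicator W u *\<^sub>R det ((\<chi> i. b i) ** ?D u) * indicator ?E u)
        = (\<lambda>u. det (matrix ((*v) ((\<chi> i. b i) ** ?D u))) * indicator ?E u)"
      by (auto split: split_indicator)
    ultimately show "(\<lambda>u. det (matrix ((*v) ((\<chi> i. b i) ** ?D u))) * indicator ?E u) \<in> borel_measurable borel" by simp
  qed simp
  also have "\<dots> = (\<integral>\<^sup>+u\<in>?E. ennreal (sqrt (det (transpose (?D u) ** ?D u))) \<partial>lborel)"
  proof (rule nn_integral_cong)
    fix u
    show "ennreal \<bar>det (matrix ((*v) ((\<chi> i. b i) ** ?D u)))\<bar> * ennreal (weight (?h u)) * indicator ?E u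
        = ennreal (sqrt (det (transpose (?D u) ** ?D u))) * indicator ?E u"
    proof (cases "u \<in> ?E")
      case True
      then have u: "u \<in> W" by simp
      then have uS: "\<psi> u \<in> S" using P(3) by blast
      have "J (\<psi> u) * sqrt (det (transpose (?D u) ** ?D u)) = \<bar>det ((\<chi> i. b i) ** ?D u)\<bar>"
        unfolding J_def tangent_space_chart[OF p u] by (rule wedge_abs_jacobian[OF b P(8)[OF u]])
      then have "sqrt (det (transpose (?D u) ** ?D u)) = \<bar>det ((\<chi> i. b i) ** ?D u)\<bar> * (1 / J (\<psi> u))"
        using tangent_props(3)[OF uS] by (simp add: field_simps)
      then show ?thesis using uS True by (simp add: weight_def ennreal_mult'[symmetric])
    qed simp
  qed
  finally show ?thesis .
qed

text \<open>For uniqueness, Lindelof's theorem selects countably many chart images covering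
  \<open>S\<close>. A Borel subset of \<open>S\<close> then splits into disjoint pieces, each inside
  one chart image, where both measures are prescribed.\<close>

lemma surface_measure_eq: "surface_measure TYPE('k) S = sigma"
  unfolding surface_measure_def
proof (rule the_equality)
  let ?is_surface = "\<lambda>M. sets M = sets (restrict_space borel S) \<and>
    (\<forall>\<psi> W. chart \<psi> W \<longrightarrow> (\<forall>A\<in>sets M. A \<subseteq> \<psi> ` W \<longrightarrow>
       emeasure M A = (\<integral>\<^sup>+u\<in>{u\<in>W. \<psi> u \<in> A}. ennreal (sqrt (det (transpose (jacobian \<psi> (at u)) ** jacobian \<psi> (at u))))
           \<partial>lborel)))"
  show "?is_surface sigma" using sets_sigma sigma_parametrisation by blast
  fix M assume M: "?is_surface M"
  have loc: "emeasure M A = emeasure sigma A" if "chart \<psi> W" "A \<in> sets sigma" "A \<subseteq> \<psi> ` W" for \<psi> W A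
    using M that sigma_parametrisation[OF that] by (simp add: sets_sigma)
  let ?\<F> = "{\<psi> ` W |\<psi> W. chart \<psi> W}"
  obtain \<F> where \<F>: "\<F> \<subseteq> ?\<F>" "countable \<F>" "\<Union>\<F> = \<Union>?\<F>"
  proof (rule Lindelof_openin[of ?\<F> S])
    fix X assume "X \<in> ?\<F>"
    then obtain \<psi> W where "chart \<psi> W" "X = \<psi> ` W" by blast
    then show "openin (top_of_set S) X" using C1_parametrisationD(2)[of \<psi> W S] by simp
  qed
  have U: "\<Union>\<F> = S"
    unfolding \<F>(3)
  proof (intro equalityI subsetI)
    fix x assume "x \<in> \<Union>?\<F>"
    then obtain \<psi> W where "chart \<psi> W" "x \<in> \<psi> ` W" by blast
    then show "x \<in> S" using C1_parametrisationD(3)[of \<psi> W S] by blast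
  next
    fix x assume "x \<in> S"
    from parametrisation_exists[OF this] obtain \<psi> W u where "chart \<psi> W" "u \<in> W" "x = \<psi> u" .
    then show "x \<in> \<Union>?\<F>" by blast
  qed
  show "M = sigma"
  proof (rule measure_eqI)
    show "sets M = sets sigma" using M sets_sigma by simp
    fix A assume "A \<in> sets M"
    then have A: "A \<in> sets sigma" using M sets_sigma by simp
    have AS: "A \<subseteq> S" using sets.sets_into_space[OF A] by (simp add: sigma_def space_restrict_space)
    show "emeasure M A = emeasure sigma A"
    \<comment> \<open>\<open>from_nat_into\<close> enumerates nonempty families only; the empty
      family means that \<open>S\<close> itself is empty.\<close>
    proof (cases "\<F> = {}")
      case True
      then have "A = {}" using U AS by blast
      then show ?thesis by simp
    next
      case False
      define B where "B = from_nat_into \<F>"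
      have rB: "range B = \<F>" unfolding B_def using False \<F>(2) by (rule range_from_nat_into)
      have Bs: "B i \<in> sets (restrict_space borel S)" for i
      proof -
        have "B i \<in> ?\<F>" using rB \<F>(1) by blast
        then obtain \<psi> W where "chart \<psi> W" "B i = \<psi> ` W" by blast
        then have "openin (top_of_set S) (B i)" using C1_parametrisationD(2)[of \<psi> W S] by simp
        then obtain G where "open G" "B i = S \<inter> G" by (auto simp: openin_open)
        then show ?thesis by (auto simp: sets_restrict_space)
      qed
      define d where "d i = A \<inter> disjointed B i" for i
      have ds: "d i \<in> sets sigma" for i
      proof -
        have "range (disjointed B) \<subseteq> sets (restrict_space borel S)"
          by (rule sets.range_disjointed_sets) (use Bs in blast)
        then have "disjointed B i \<in> sets (restrict_space borel S)" by blast
        then show ?thesis unfolding d_def using A by (simp add: sets_sigma sets.Int)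
      qed
      have disj: "disjoint_family d" unfolding d_def using disjoint_family_disjointed[of B]
        by (auto simp: disjoint_family_on_def)
      have un: "(\<Union>i. d i) = A" using AS unfolding d_def using UN_disjointed_eq[of B] rB U by auto
      have "emeasure M (d i) = emeasure sigma (d i)" for i
      proof -
        obtain \<psi> W where p: "chart \<psi> W" "B i = \<psi> ` W" using rB \<F>(1) by blast
        have "d i \<subseteq> \<psi> ` W" using p(2) disjointed_subset[of B i] by (auto simp: d_def)
        then show ?thesis by (rule loc[OF p(1) ds])
      qed
      then have "(\<Sum>i. emeasure M (d i)) = (\<Sum>i. emeasure sigma (d i))" by simp
      moreover have "(\<Sum>i. emeasure M (d i)) = emeasure M A"
        using ds M sets_sigma by (subst suminf_emeasure[OF _ disj]) (auto simp: un)
      moreover have "(\<Sum>i. emeasure sigma (d i)) = emeasure sigma A"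
        using ds by (subst suminf_emeasure[OF _ disj]) (auto simp: un)
      ultimately show ?thesis by simp
    qed
  qed
qed

end

section \<open>Plane measures and products of delta masses\<close>

abbreviation lborel_Pi :: "'i set \<Rightarrow> ('i \<Rightarrow> real) measure" where
  "lborel_Pi I \<equiv> Pi\<^sub>M I (\<lambda>_. lborel)"

text \<open>\<open>subspace_lebesgue\<close> uses the basis vectors themselves as coordinate
  indices, whereas the computations index by \<open>'k\<close> or by subsets of \<open>'n\<close>.
  This lemma mediates between the two.\<close>

lemma PiM_lborel_reindex:
  fixes f :: "'i \<Rightarrow> 'j"
  assumes I: "finite I" and f: "inj_on f I"
  shows "distr (lborel_Pi I) (lborel_Pi (f ` I)) (\<lambda>x. \<lambda>b\<in>f ` I. x (inv_into I f b)) = lborel_Pi (f ` I)"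
proof -
  interpret product_sigma_finite "\<lambda>_::'i. lborel::real measure" ..
  interpret J: product_sigma_finite "\<lambda>_::'j. lborel::real measure" ..
  let ?T = "\<lambda>x. \<lambda>b\<in>f ` I. x (inv_into I f b)"
  have T: "?T \<in> lborel_Pi I \<rightarrow>\<^sub>M lborel_Pi (f ` I)"
    by (intro measurable_restrict measurable_component_singleton inv_into_into)
  show ?thesis
  proof (rule J.PiM_eqI)
    show "finite (f ` I)" using I by simp
    fix A :: "'j \<Rightarrow> real set" assume A: "\<And>i. i \<in> f ` I \<Longrightarrow> A i \<in> sets lborel"
    have "?T -` (Pi\<^sub>E (f ` I) A) \<inter> space (lborel_Pi I) = Pi\<^sub>E I (\<lambda>i. A (f i))"
      using f by (auto simp: space_PiM PiE_iff)
    then have "emeasure (distr (lborel_Pi I) (lborel_Pi (f ` I)) ?T) (Pi\<^sub>E (f ` I) A)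
        = emeasure (lborel_Pi I) (Pi\<^sub>E I (\<lambda>i. A (f i)))"
      using A I by (subst emeasure_distr[OF T]) (auto intro!: sets_PiM_I_finite)
    also have "\<dots> = (\<Prod>i\<in>I. emeasure lborel (A (f i)))"
      using A I by (intro emeasure_PiM) auto
    also have "\<dots> = (\<Prod>j\<in>f ` I. emeasure lborel (A j))" using f by (simp add: prod.reindex)
    finally show "emeasure (distr (lborel_Pi I) (lborel_Pi (f ` I)) ?T) (Pi\<^sub>E (f ` I) A)
        = (\<Prod>j\<in>f ` I. emeasure lborel (A j))" .
  qed simp
qed

lemma distr_PiM_reindex_sum:
  fixes f :: "'i \<Rightarrow> 'j" and g :: "'j \<Rightarrow> 'a::euclidean_space"
  assumes I: "finite I" and f: "inj_on f I"
  shows "distr (lborel_Pi (f ` I)) borel (\<lambda>c. \<Sum>b\<in>f ` I. c b *\<^sub>R g b)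
       = distr (lborel_Pi I) borel (\<lambda>x. \<Sum>i\<in>I. x i *\<^sub>R g (f i))"
proof -
  let ?T = "\<lambda>x. \<lambda>b\<in>f ` I. x (inv_into I f b)"
  have T: "?T \<in> lborel_Pi I \<rightarrow>\<^sub>M lborel_Pi (f ` I)"
    by (intro measurable_restrict measurable_component_singleton inv_into_into)
  have "(\<lambda>c. \<Sum>b\<in>f ` I. c b *\<^sub>R g b) \<in> borel_measurable (lborel_Pi (f ` I))"
    by measurable
  then have "distr (lborel_Pi (f ` I)) borel (\<lambda>c. \<Sum>b\<in>f ` I. c b *\<^sub>R g b)
     = distr (lborel_Pi I) borel ((\<lambda>c. \<Sum>b\<in>f ` I. c b *\<^sub>R g b) \<circ> ?T)"
    by (subst PiM_lborel_reindex[OF I f, symmetric]) (rule distr_distr[OF _ T])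
  also have "(\<lambda>c. \<Sum>b\<in>f ` I. c b *\<^sub>R g b) \<circ> ?T = (\<lambda>x. \<Sum>i\<in>I. x i *\<^sub>R g (f i))"
    using f by (auto simp: sum.reindex fun_eq_iff intro!: sum.cong)
  finally show ?thesis .
qed

lemma lborel_cart_PiM:
  "(lborel :: (real^'k) measure) = distr (lborel_Pi UNIV) borel (\<lambda>x. \<chi> i. x i)"
proof -
  have B: "(Basis :: (real^'k) set) = range (\<lambda>i. axis i 1)" by (auto simp: Basis_vec_def)
  have i: "inj (\<lambda>i::'k. axis i (1::real))" by (auto simp: inj_def axis_eq_axis)
  have "(lborel :: (real^'k) measure)
      = distr (Pi\<^sub>M (range (\<lambda>i. axis i 1)) (\<lambda>_. lborel)) borel (\<lambda>f. \<Sum>b\<in>range (\<lambda>i. axis i 1). f b *\<^sub>R b)"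
    unfolding B[symmetric] by (rule lborel_eq)
  also have "\<dots> = distr (lborel_Pi UNIV) borel (\<lambda>x. \<Sum>i\<in>UNIV. x i *\<^sub>R (axis i 1 :: real^'k))"
    by (rule distr_PiM_reindex_sum[OF _ i]) simp
  also have "(\<lambda>x. \<Sum>i\<in>UNIV. x i *\<^sub>R (axis i 1 :: real^'k)) = (\<lambda>x. \<chi> i. x i)"
    by (auto simp: fun_eq_iff vec_eq_iff axis_def if_distrib cong: if_cong)
  finally show ?thesis .
qed

lemma vec_measurable_PiM[measurable]: "(\<lambda>x. \<chi> i. x i) \<in> lborel_Pi (UNIV :: 'k::finite set) \<rightarrow>\<^sub>M borel"
proof -
  have "(\<lambda>x. \<Sum>i\<in>UNIV. x i *\<^sub>R (axis i 1 :: real^'k)) \<in> lborel_Pi UNIV \<rightarrow>\<^sub>M borel" by measurable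
  moreover have "(\<lambda>x. \<Sum>i\<in>UNIV. x i *\<^sub>R (axis i 1 :: real^'k)) = (\<lambda>x. \<chi> i. x i)"
    by (auto simp: fun_eq_iff vec_eq_iff axis_def if_distrib cong: if_cong)
  ultimately show ?thesis by simp
qed

text \<open>The very basis chosen inside \<open>subspace_lebesgue\<close>. All coordinates on planes
  are taken along it, so no change of basis has to be discussed.\<close>

definition standard_basis :: "(real^'n) set \<Rightarrow> (real^'n) set" where
  "standard_basis V = (SOME B. orthonormal_basis B V)"

lemma standard_basis: "subspace V \<Longrightarrow> orthonormal_basis (standard_basis V) V"
  unfolding standard_basis_def using orthonormal_basis_exists[of V] by (metis someI)

lemma subspace_lebesgue_frame:
  assumes "finite I" "inj_on f I" "f ` I = standard_basis V"
  shows "subspace_lebesgue V = distr (lborel_Pi I) borel (\<lambda>x. \<Sum>i\<in>I. x i *\<^sub>R f i)"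
  unfolding subspace_lebesgue_def Let_def standard_basis_def[symmetric] assms(3)[symmetric]
  by (rule distr_PiM_reindex_sum[OF assms(1,2)])

lemma subspace_lebesgue_coordinates:
  fixes b :: "'k::finite \<Rightarrow> real^'n"
  assumes "inj b" "range b = standard_basis V"
  shows "subspace_lebesgue V = distr lborel borel (\<lambda>c::real^'k. \<Sum>i\<in>UNIV. c $ i *\<^sub>R b i)"
proof -
  have m: "(\<lambda>c::real^'k. \<Sum>i\<in>UNIV. c $ i *\<^sub>R b i) \<in> borel_measurable borel"
    by (intro borel_measurable_continuous_onI continuous_intros)
  have "subspace_lebesgue V = distr (lborel_Pi UNIV) borel ((\<lambda>c::real^'k. \<Sum>i\<in>UNIV. c $ i *\<^sub>R b i) \<circ> (\<lambda>x. \<chi> i. x i))"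
    using subspace_lebesgue_frame[OF _ assms] by (simp add: o_def)
  also have "\<dots> = distr (distr (lborel_Pi UNIV) borel (\<lambda>x. \<chi> i. x i)) borel (\<lambda>c::real^'k. \<Sum>i\<in>UNIV. c $ i *\<^sub>R b i)"
    by (rule distr_distr[symmetric, OF m]) measurable
  finally show ?thesis unfolding lborel_cart_PiM[symmetric] .
qed

section \<open>Mollified deltas on transverse planes\<close>

lemma mollifier_exists: "\<exists>\<rho> :: real^'n \<Rightarrow> real. mollifier \<rho>"
proof -
  define r where "r = (\<lambda>x::real^'n. max 0 (1 - norm x))"
  have rc: "continuous_on UNIV r" unfolding r_def by (intro continuous_intros)
  have [measurable]: "r \<in> borel_measurable borel" by (rule borel_measurable_continuous_onI[OF rc])
  let ?c = "\<integral>\<^sup>+x. ennreal (r x) \<partial>lborel"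
  have "?c \<le> (\<integral>\<^sup>+x. indicator (cball (0::real^'n) 1) x \<partial>lborel)"
    by (rule nn_integral_mono) (auto simp: r_def indicator_def ennreal_le_1 ennreal_neg)
  also have "\<dots> < \<infinity>" using emeasure_bounded_finite[OF bounded_cball[of "0::real^'n" 1]] by simp
  finally have fin: "?c < \<infinity>" .
  have pos: "?c \<noteq> 0"
  proof
    assume "?c = 0"
    then have "AE x in lborel. ennreal (r x) = 0" by (subst (asm) nn_integral_0_iff_AE) auto
    then have "AE x in lborel. x \<notin> ball (0::real^'n) 1" by eventually_elim (auto simp: r_def ennreal_eq_0_iff)
    then have "emeasure lborel (ball (0::real^'n) 1) = 0" by (subst (asm) AE_iff_measurable[where N="ball 0 1"]) auto
    then show False using content_ball_pos[of 1 "0::real^'n"] by (simp add: measure_def)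
  qed
  define c where "c = enn2real ?c"
  have c: "ennreal c = ?c" "c > 0" using fin pos
    by (auto simp: c_def enn2real_positive_iff less_top zero_less_iff_neq_zero)
  have "mollifier (\<lambda>x. r x / c)"
    unfolding mollifier_def
  proof (intro conjI allI)
    show "continuous_on UNIV (\<lambda>x. r x / c)" using c by (intro continuous_intros rc) auto
    have "{x. r x / c \<noteq> 0} \<subseteq> cball 0 1" by (auto simp: r_def max_def split: if_splits)
    then show "bounded {x. r x / c \<noteq> 0}" using bounded_subset[OF bounded_cball] by blast
    show "0 \<le> r x / c" for x using c by (simp add: r_def)
    have "(\<integral>\<^sup>+x. ennreal (r x / c) \<partial>lborel) = (\<integral>\<^sup>+x. ennreal (1 / c) * ennreal (r x) \<partial>lborel)"
      using c by (intro nn_integral_cong) (simp add: ennreal_mult'[symmetric])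
    also have "\<dots> = ennreal (1 / c) * ennreal c" unfolding c(1) by (rule nn_integral_cmult) auto
    also have "\<dots> = 1" using c(2) by (simp add: ennreal_mult'[symmetric])
    finally show "(\<integral>\<^sup>+x. ennreal (r x / c) \<partial>lborel) = 1" .
  qed
  then show ?thesis by blast
qed

lemma mollifier_scaled_integral:
  fixes \<rho> :: "real^'n \<Rightarrow> real"
  assumes \<rho>: "mollifier \<rho>" and e: "\<epsilon> > 0"
  shows "(\<integral>\<^sup>+v. ennreal (\<rho> ((v - a) /\<^sub>R \<epsilon>) / \<epsilon> ^ CARD('n)) \<partial>lborel) = 1"
proof -
  have [measurable]: "\<rho> \<in> borel_measurable borel" using \<rho>
    by (auto simp: mollifier_def intro: borel_measurable_continuous_onI)
  let ?A = "matrix ((*\<^sub>R) (inverse \<epsilon>)) :: real^'n^'n"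
  have A: "?A *v v = v /\<^sub>R \<epsilon>" for v
    by (simp add: matrix_def matrix_vector_mult_def vec_eq_iff axis_def if_distrib if_distribR cong: if_cong)
  have dA: "det ?A = inverse \<epsilon> ^ CARD('n)" by (rule det_matrix_scaleR)
  have "(\<integral>\<^sup>+v. ennreal (\<rho> ((v - a) /\<^sub>R \<epsilon>) / \<epsilon> ^ CARD('n)) \<partial>lborel)
      = (\<integral>\<^sup>+v. ennreal (\<rho> (v /\<^sub>R \<epsilon>) / \<epsilon> ^ CARD('n)) \<partial>lborel)"
    by (rule nn_integral_lborel_shift[of "\<lambda>v. ennreal (\<rho> (v /\<^sub>R \<epsilon>) / \<epsilon> ^ CARD('n))"]) measurable
  also have "\<dots> = (\<integral>\<^sup>+v. ennreal (1 / \<epsilon> ^ CARD('n)) * ennreal (\<rho> (?A *v v)) \<partial>lborel)"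
    using e by (intro nn_integral_cong) (simp add: A ennreal_mult'[symmetric])
  also have "\<dots> = ennreal (1 / \<epsilon> ^ CARD('n)) * (\<integral>\<^sup>+v. ennreal (\<rho> (?A *v v)) \<partial>lborel)"
    by (rule nn_integral_cmult) (simp add: A)
  also have "(\<integral>\<^sup>+v. ennreal (\<rho> (?A *v v)) \<partial>lborel) = ennreal (1 / \<bar>det ?A\<bar>) * (\<integral>\<^sup>+v. ennreal (\<rho> v) \<partial>lborel)"
    by (rule nn_integral_linear_image) (use e dA in auto)
  also have "(\<integral>\<^sup>+v. ennreal (\<rho> v) \<partial>lborel) = 1" using \<rho> by (simp add: mollifier_def)
  finally show ?thesis using e by (simp add: dA ennreal_mult'[symmetric] power_inverse)
qed

lemma nn_integral_transverse_pair:
  fixes \<theta> \<pi> :: "(real^'n) set"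
  assumes \<theta>: "subspace \<theta>" and \<pi>: "subspace \<pi>" and d: "dim \<theta> + dim \<pi> = CARD('n)" and t: "\<theta> \<inter> \<pi> = {0}"
    and h[measurable]: "h \<in> borel_measurable borel"
  shows "(\<integral>\<^sup>+x. \<integral>\<^sup>+w. h (x - w) \<partial>subspace_lebesgue \<theta> \<partial>subspace_lebesgue \<pi>)
      = ennreal (1 / wedge_abs \<theta> \<pi>) * (\<integral>\<^sup>+v. h v \<partial>lborel)"
proof -
  interpret product_sigma_finite "\<lambda>_::'n. lborel::real measure" ..
  note b\<theta> = orthonormal_basisD[OF standard_basis[OF \<theta>]] and b\<pi> = orthonormal_basisD[OF standard_basis[OF \<pi>]]
  obtain I :: "'n set" where I: "card I = dim \<theta>" using d obtain_subset_with_card_n[of "dim \<theta>" "UNIV :: 'n set"]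
    by auto
  obtain f1 where f1: "bij_betw f1 I (standard_basis \<theta>)" using I b\<theta> finite_same_card_bij[of I "standard_basis \<theta>"]
    by auto
  have "card (- I) = dim \<pi>" using I d card_add_card_Compl[of I] by simp
  then obtain f2 where f2: "bij_betw f2 (- I) (standard_basis \<pi>)"
    using b\<pi> finite_same_card_bij[of "- I" "standard_basis \<pi>"] by auto
  define f where "f i = (if i \<in> I then f1 i else f2 i)" for i
  have f: "inj_on f I" "f ` I = standard_basis \<theta>" "inj_on f (- I)" "f ` (- I) = standard_basis \<pi>"
    using f1 f2 by (auto simp: f_def bij_betw_def inj_on_def)
  have fr: "wedge_frame \<theta> \<pi> f I" unfolding wedge_frame_def using f standard_basis[OF \<theta>] standard_basis[OF \<pi>] by simp
  \<comment> \<open>The columns of \<open>A\<close> are the frame vectors, with a minus sign for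
    those of \<open>\<theta>\<close>, because the argument is \<open>x - w\<close> with
    \<open>w\<close> in \<open>\<theta>\<close>. The signs leave \<open>\<bar>det A\<bar>\<close>
    unchanged.\<close>
  define c where "c i = (if i \<in> I then -1 else 1 :: real)" for i
  define A where "A = transpose (\<chi> i. c i *s f i)"
  have "det A = prod c UNIV * det (\<chi> i. f i)" unfolding A_def det_transpose by (rule det_rows_mul)
  moreover have "\<bar>prod c UNIV\<bar> = 1" unfolding abs_prod by (rule prod.neutral) (simp add: c_def)
  ultimately have dA: "\<bar>det A\<bar> = wedge_abs \<theta> \<pi>" unfolding wedge_abs_frame[OF fr] by (simp add: abs_mult)
  then have nz: "det A \<noteq> 0" using wedge_abs_pos[OF \<theta> \<pi> d t] by auto
  have Av: "A *v (\<chi> i. x i) = (\<Sum>i\<in>-I. x i *\<^sub>R f i) - (\<Sum>i\<in>I. x i *\<^sub>R f i)" for x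
  proof -
    have "A *v (\<chi> i. x i) = (\<Sum>i\<in>UNIV. (c i * x i) *\<^sub>R f i)"
      by (simp add: A_def matrix_vector_mult_def transpose_def vec_eq_iff mult_ac)
    also have "\<dots> = (\<Sum>i\<in>I. (c i * x i) *\<^sub>R f i) + (\<Sum>i\<in>-I. (c i * x i) *\<^sub>R f i)"
      by (metis (no_types, lifting) Compl_partition Compl_disjoint finite sum.union_disjoint)
    also have "(\<Sum>i\<in>I. (c i * x i) *\<^sub>R f i) = - (\<Sum>i\<in>I. x i *\<^sub>R f i)" by (simp add: c_def sum_negf)
    also have "(\<Sum>i\<in>-I. (c i * x i) *\<^sub>R f i) = (\<Sum>i\<in>-I. x i *\<^sub>R f i)" by (simp add: c_def)
    finally show ?thesis by simp
  qed
  have m1: "(\<lambda>x. \<Sum>i\<in>J. x i *\<^sub>R f i) \<in> borel_measurable (lborel_Pi J)" for J by measurable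
  have "(\<integral>\<^sup>+w. h (x - w) \<partial>subspace_lebesgue \<theta>) = (\<integral>\<^sup>+q. h (x - (\<Sum>i\<in>I. q i *\<^sub>R f i)) \<partial>lborel_Pi I)" for x
    unfolding subspace_lebesgue_frame[OF _ f(1,2), OF finite] by (rule nn_integral_distr[OF m1]) measurable
  moreover have "(\<lambda>x. \<integral>\<^sup>+q. h (x - (\<Sum>i\<in>I. q i *\<^sub>R f i)) \<partial>lborel_Pi I) \<in> borel_measurable borel"
  proof -
    interpret I: sigma_finite_measure "lborel_Pi I" by (rule sigma_finite) simp
    show ?thesis by measurable
  qed
  ultimately have "(\<integral>\<^sup>+x. \<integral>\<^sup>+w. h (x - w) \<partial>subspace_lebesgue \<theta> \<partial>subspace_lebesgue \<pi>)
     = (\<integral>\<^sup>+p. \<integral>\<^sup>+q. h ((\<Sum>i\<in>-I. p i *\<^sub>R f i) - (\<Sum>i\<in>I. q i *\<^sub>R f i)) \<partial>lborel_Pi I \<partial>lborel_Pi (- I))"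
    unfolding subspace_lebesgue_frame[OF _ f(3,4), OF finite] by (simp add: nn_integral_distr[OF m1])
  also have "\<dots> = (\<integral>\<^sup>+p. \<integral>\<^sup>+q. h (A *v (\<chi> i. merge (- I) I (p, q) i)) \<partial>lborel_Pi I \<partial>lborel_Pi (- I))"
    unfolding Av by (intro nn_integral_cong arg_cong[where f=h] arg_cong2[where f="(-)"] sum.cong)
      (auto simp: merge_def)
  also have "\<dots> = (\<integral>\<^sup>+x. h (A *v (\<chi> i. x i)) \<partial>lborel_Pi (- I \<union> I))"
    by (rule product_nn_integral_fold[symmetric]) (auto simp: Compl_partition2)
  also have "\<dots> = (\<integral>\<^sup>+x. h (A *v (\<chi> i. x i)) \<partial>lborel_Pi UNIV)" by (simp add: Compl_partition2)
  also have "\<dots> = (\<integral>\<^sup>+v. h (A *v v) \<partial>lborel)"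
    by (subst lborel_cart_PiM, rule nn_integral_distr[symmetric]) measurable
  also have "\<dots> = ennreal (1 / \<bar>det A\<bar>) * (\<integral>\<^sup>+v. h v \<partial>lborel)" by (rule nn_integral_linear_image[OF nz h])
  finally show ?thesis unfolding dA .
qed

lemma delta_product_integral_transverse:
  fixes \<theta> \<pi> :: "(real^'n) set"
  assumes \<theta>: "subspace \<theta>" and \<pi>: "subspace \<pi>" and d: "dim \<theta> + dim \<pi> = CARD('n)" and t: "\<theta> \<inter> \<pi> = {0}"
  shows "delta_product_integral \<pi> y \<theta> z = ennreal (1 / wedge_abs \<theta> \<pi>)"
proof -
  let ?c = "ennreal (1 / wedge_abs \<theta> \<pi>)"
  have eq: "k_plane_transform (mollify \<rho> \<epsilon> (plane_delta \<theta> z)) \<pi> y = ?c" if \<rho>: "mollifier \<rho>" and e: "\<epsilon> > 0" for \<rho> \<epsilon>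
  proof -
    have [measurable]: "\<rho> \<in> borel_measurable borel" using \<rho>
      by (auto simp: mollifier_def intro: borel_measurable_continuous_onI)
    \<comment> \<open>The offsets \<open>y\<close> and \<open>z\<close> enter only through a
      translation of the mollifier, which Lebesgue measure does not see. This is why the result
      depends on neither.\<close>
    let ?h = "\<lambda>v. ennreal (\<rho> ((v - (z - y)) /\<^sub>R \<epsilon>) / \<epsilon> ^ CARD('n))"
    have s\<theta>: "sets (subspace_lebesgue \<theta>) = sets borel" by (simp add: subspace_lebesgue_def Let_def)
    have "mollify \<rho> \<epsilon> (plane_delta \<theta> z) (x + y) = (\<integral>\<^sup>+w. ?h (x - w) \<partial>subspace_lebesgue \<theta>)" for x
    proof -
      have "(\<lambda>x. x + z) \<in> subspace_lebesgue \<theta> \<rightarrow>\<^sub>M borel" by (simp cong: measurable_cong_sets add: s\<theta>)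
      then have "mollify \<rho> \<epsilon> (plane_delta \<theta> z) (x + y)
          = (\<integral>\<^sup>+w. ennreal (\<rho> ((x + y - (w + z)) /\<^sub>R \<epsilon>) / \<epsilon> ^ CARD('n)) \<partial>subspace_lebesgue \<theta>)"
        unfolding mollify_def plane_delta_def by (rule nn_integral_distr) measurable
      then show ?thesis by (simp add: algebra_simps)
    qed
    then have "k_plane_transform (mollify \<rho> \<epsilon> (plane_delta \<theta> z)) \<pi> y
        = (\<integral>\<^sup>+x. \<integral>\<^sup>+w. ?h (x - w) \<partial>subspace_lebesgue \<theta> \<partial>subspace_lebesgue \<pi>)"
      unfolding k_plane_transform_def by (simp only:)
    also have "\<dots> = ?c * (\<integral>\<^sup>+v. ?h v \<partial>lborel)" by (rule nn_integral_transverse_pair[OF \<theta> \<pi> d t]) measurable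
    also have "\<dots> = ?c" unfolding mollifier_scaled_integral[OF \<rho> e] by simp
    finally show ?thesis .
  qed
  have lim: "((\<lambda>\<epsilon>. k_plane_transform (mollify \<rho> \<epsilon> (plane_delta \<theta> z)) \<pi> y) \<longlongrightarrow> ?c) (at_right 0)" if "mollifier \<rho>" for \<rho>
  proof (rule tendsto_eventually)
    show "\<forall>\<^sub>F \<epsilon> in at_right 0. k_plane_transform (mollify \<rho> \<epsilon> (plane_delta \<theta> z)) \<pi> y = ?c"
      unfolding eventually_at_right_field using eq[OF that] by (intro exI[of _ 1]) auto
  qed
  \<comment> \<open>The limit condition quantifies over all mollifiers, so it determines
    \<open>c\<close> only because at least one exists.\<close>
  obtain \<rho>0 :: "real^'n \<Rightarrow> real" where "mollifier \<rho>0" using mollifier_exists by blast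
  show ?thesis unfolding delta_product_integral_def
  proof (rule the_equality)
    fix c assume "\<forall>\<rho>. mollifier \<rho> \<longrightarrow> ((\<lambda>\<epsilon>. k_plane_transform (mollify \<rho> \<epsilon> (plane_delta \<theta> z)) \<pi> y) \<longlongrightarrow> c) (at_right 0)"
    then have "((\<lambda>\<epsilon>. k_plane_transform (mollify \<rho>0 \<epsilon> (plane_delta \<theta> z)) \<pi> y) \<longlongrightarrow> c) (at_right 0)" using \<open>mollifier \<rho>0\<close>
      by blast
    then show "c = ?c" by (rule tendsto_unique[OF trivial_limit_at_right_real _ lim[OF \<open>mollifier \<rho>0\<close>]])
  qed (use lim in blast)
qed

section \<open>The two identities\<close>

text \<open>The identity between the parts of a signed measure is used in the form "positive part
  equals negative part plus a third measure", which makes sense for infinite values and passes to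
  integrals.\<close>

lemma nn_integral_sum_measure:
  assumes sets: "sets q = sets p" "sets r = sets p"
    and em: "\<And>A. A \<in> sets p \<Longrightarrow> emeasure p A = emeasure q A + emeasure r A"
    and f: "f \<in> borel_measurable p"
  shows "(\<integral>\<^sup>+x. f x \<partial>p) = (\<integral>\<^sup>+x. f x \<partial>q) + (\<integral>\<^sup>+x. f x \<partial>r)"
  using f
proof (induction rule: borel_measurable_induct)
  case (cong f g)
  have "(\<integral>\<^sup>+x. f x \<partial>p') = (\<integral>\<^sup>+x. g x \<partial>p')" if "sets p' = sets p" for p'
    using cong(3) sets_eq_imp_space_eq[OF that] by (intro nn_integral_cong) auto
  then show ?case using cong(4) sets by simp
next
  case (set A)
  then show ?case using em[OF set] sets by simp
next
  case (mult u c)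
  have "(\<integral>\<^sup>+x. c * u x \<partial>p') = c * (\<integral>\<^sup>+x. u x \<partial>p')" if "sets p' = sets p" for p'
    using mult(2) by (intro nn_integral_cmult) (simp cong: measurable_cong_sets add: that)
  then show ?case using mult(4) sets by (simp add: distrib_left)
next
  case (add u v)
  have uv: "u \<in> borel_measurable p" "v \<in> borel_measurable p" using add by auto
  have "(\<integral>\<^sup>+x. v x + u x \<partial>p') = (\<integral>\<^sup>+x. v x \<partial>p') + (\<integral>\<^sup>+x. u x \<partial>p')" if "sets p' = sets p" for p'
    using uv by (intro nn_integral_add) (simp_all cong: measurable_cong_sets add: that)
  then show ?case using add.IH sets by (simp add: add_ac)
next
  case (seq U)
  have *: "(\<integral>\<^sup>+x. (SUP i. U i) x \<partial>p') = (SUP i. \<integral>\<^sup>+x. U i x \<partial>p')" if "sets p' = sets p" for p'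
    unfolding SUP_apply using seq(1,3)
    by (intro nn_integral_monotone_convergence_SUP) (simp_all cong: measurable_cong_sets add: that)
  have inc: "incseq (\<lambda>i. \<integral>\<^sup>+x. U i x \<partial>p')" for p'
    using seq(3) by (auto simp: incseq_def le_fun_def intro!: nn_integral_mono)
  have "(SUP i. (\<integral>\<^sup>+x. U i x \<partial>q) + (\<integral>\<^sup>+x. U i x \<partial>r)) = (SUP i. \<integral>\<^sup>+x. U i x \<partial>q) + (SUP i. \<integral>\<^sup>+x. U i x \<partial>r)"
    by (rule ennreal_SUP_add[OF inc inc])
  then show ?case using * sets seq.IH by simp
qed

context transverse_manifold
begin

lemma J_measurable: "J \<in> borel_measurable (restrict_space borel S)"
  by (rule borel_measurable_continuous_on_restrict[OF J_continuous])

lemma weight_nonneg: "weight v \<ge> 0"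
proof (cases "v \<in> V")
  case True
  then show ?thesis using tangent_props(3)[OF s_in[OF True]] by (simp add: weight_def)
qed (simp add: weight_def)

lemma integral_sigma:
  fixes f :: "real^'n \<Rightarrow> complex"
  assumes f: "f \<in> borel_measurable (restrict_space borel S)"
  shows "integral\<^sup>L sigma f = (\<integral>v. indicator V v *\<^sub>R weight v *\<^sub>R f (s v) \<partial>lborel)"
    and "integrable sigma f \<longleftrightarrow> integrable lborel (\<lambda>v. indicator V v *\<^sub>R weight v *\<^sub>R f (s v))"
proof -
  have fs: "(\<lambda>v. f (s v)) \<in> borel_measurable (restrict_space lborel V)"
    by (rule measurable_compose[OF s_measurable f])
  have "integral\<^sup>L sigma f = (\<integral>v. f (s v) \<partial>density (restrict_space lborel V) (\<lambda>v. ennreal (weight v)))"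
    unfolding sigma_def by (rule integral_distr[OF s_measurable' f])
  also have "\<dots> = (\<integral>v. weight v *\<^sub>R f (s v) \<partial>restrict_space lborel V)"
    by (rule integral_density[OF fs weight_measurable']) (simp add: weight_nonneg)
  also have "\<dots> = (\<integral>v. indicator V v *\<^sub>R weight v *\<^sub>R f (s v) \<partial>lborel)"
    by (rule integral_restrict_space) simp
  finally show "integral\<^sup>L sigma f = (\<integral>v. indicator V v *\<^sub>R weight v *\<^sub>R f (s v) \<partial>lborel)" .
  have "integrable sigma f \<longleftrightarrow> integrable (density (restrict_space lborel V) (\<lambda>v. ennreal (weight v))) (\<lambda>v. f (s v))"
    unfolding sigma_def by (rule integrable_distr_eq[OF s_measurable' f])
  also have "\<dots> \<longleftrightarrow> integrable (restrict_space lborel V) (\<lambda>v. weight v *\<^sub>R f (s v))"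
    by (rule integrable_density[OF fs weight_measurable']) (simp add: weight_nonneg)
  also have "\<dots> \<longleftrightarrow> integrable lborel (\<lambda>v. indicator V v *\<^sub>R weight v *\<^sub>R f (s v))"
    by (rule integrable_restrict_space) simp
  finally show "integrable sigma f \<longleftrightarrow> integrable lborel (\<lambda>v. indicator V v *\<^sub>R weight v *\<^sub>R f (s v))" .
qed

lemma measurable_sigma_iff: "f \<in> borel_measurable sigma \<longleftrightarrow> f \<in> borel_measurable (restrict_space borel S)"
  using sets_sigma by (simp cong: measurable_cong_sets)

section \<open>The plane transform of the squared extension operator\<close>

abbreviation weighted_energy :: "(real^'n \<Rightarrow> complex) \<Rightarrow> ennreal" where
  "weighted_energy g \<equiv> \<integral>\<^sup>+\<xi>. ennreal ((cmod (g \<xi>))\<^sup>2 / J \<xi>) \<partial>sigma"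

lemma plane_transform_extension:
  assumes std: "range b = standard_basis \<pi>" and g: "integrable sigma g"
  shows "k_plane_transform (\<lambda>x. ennreal ((cmod (fourier_extension sigma g x))\<^sup>2)) \<pi> y =
     weighted_energy g"
proof -
  define e where "e = (\<lambda>r. unit_wave r)"
  have em[measurable]: "e \<in> borel_measurable borel"
    unfolding e_def by measurable
  have e_add: "e (r + q) = e r * e q" for r q
    unfolding e_def exp_add[symmetric] by (simp add: algebra_simps)
  have norm_e: "cmod (e r) = 1" for r unfolding e_def by (rule norm_exp_i)
  have gm: "g \<in> borel_measurable (restrict_space borel S)"
    using borel_measurable_integrable[OF g] by (simp only: measurable_sigma_iff)
  define G where "G v = indicator V v *\<^sub>R weight v *\<^sub>R g (s v)" for v
  \<comment> \<open>Cutting \<open>s\<close> off outside \<open>V\<close> makes it Borel on the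
    whole space. \<open>G\<close> vanishes there, so no integral changes.\<close>
  define s' where "s' v = indicator V v *\<^sub>R s v" for v
  have Gi: "integrable lborel G" using g integral_sigma(2)[OF gm] unfolding G_def by blast
  then have Gm[measurable]: "G \<in> borel_measurable borel" by auto
  have s'm[measurable]: "s' \<in> borel_measurable borel"
    unfolding s'_def by (rule borel_measurable_continuous_on_indicator[OF V_borel s_continuous])
  have fe: "fourier_extension sigma g x = (\<integral>v. G v * e (x \<bullet> s' v) \<partial>lborel)" for x
  proof -
    have "(\<lambda>\<xi>. e (x \<bullet> \<xi>)) \<in> borel_measurable (restrict_space borel S)"
      by (intro measurable_restrict_space1) measurable
    then have "(\<lambda>\<xi>. g \<xi> * e (x \<bullet> \<xi>)) \<in> borel_measurable (restrict_space borel S)"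
      by (intro borel_measurable_times gm)
    from integral_sigma(1)[OF this]
    have "fourier_extension sigma g x = (\<integral>v. indicator V v *\<^sub>R weight v *\<^sub>R (g (s v) * e (x \<bullet> s v)) \<partial>lborel)"
      unfolding fourier_extension_def e_def .
    also have "\<dots> = (\<integral>v. G v * e (x \<bullet> s' v) \<partial>lborel)"
      by (rule Bochner_Integration.integral_cong) (auto simp: G_def s'_def split: split_indicator)
    finally show ?thesis .
  qed
  have fem: "fourier_extension sigma g \<in> borel_measurable borel"
    unfolding fe by measurable
  \<comment> \<open>Translation by \<open>y\<close> multiplies the integrand by a unimodular factor,
    which changes the function to be transformed but not its modulus.\<close>
  define h where "h v = G v * e (y \<bullet> s' v)" for v
  have hm[measurable]: "h \<in> borel_measurable borel" unfolding h_def by measurable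
  have hn: "cmod (h v) = cmod (G v)" for v by (simp add: h_def norm_mult norm_e)
  have hi: "integrable lborel h"
    by (rule Bochner_Integration.integrable_bound[OF Gi]) (auto simp: hn)
  have fh: "fourier_extension sigma g ((\<Sum>i\<in>UNIV. c $ i *\<^sub>R b i) + y) = fourier h c" for c :: "real^'k"
  proof -
    have "G v * e (((\<Sum>i\<in>UNIV. c $ i *\<^sub>R b i) + y) \<bullet> s' v) = h v * e (c \<bullet> v)" for v
    proof (cases "v \<in> V")
      case True
      \<comment> \<open>Pairing with a vector of the plane sees only the coordinates
        \<open>Q (s v) = v\<close>. The phase is therefore linear in \<open>v\<close>, and the
        extension operator becomes a genuine Fourier transform.\<close>
      have "(\<Sum>i\<in>UNIV. c $ i *\<^sub>R b i) \<bullet> s v = c \<bullet> v"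
      proof -
        have "(\<Sum>i\<in>UNIV. c $ i *\<^sub>R b i) \<bullet> s v = (\<Sum>i\<in>UNIV. c $ i * Q (s v) $ i)"
          by (simp add: inner_sum_left Q_nth)
        then show ?thesis using True by (simp add: inner_vec_def)
      qed
      then show ?thesis using True by (simp add: h_def s'_def inner_add_left e_add mult_ac)
    qed (simp add: h_def G_def)
    then show ?thesis unfolding fe fourier_def e_def by simp
  qed
  have Lm: "(\<lambda>c::real^'k. \<Sum>i\<in>UNIV. c $ i *\<^sub>R b i) \<in> lborel \<rightarrow>\<^sub>M borel"
  proof -
    have "(\<lambda>c::real^'k. \<Sum>i\<in>UNIV. c $ i *\<^sub>R b i) \<in> borel_measurable borel"
      by (intro borel_measurable_continuous_onI continuous_intros)
    then show ?thesis by simp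
  qed
  have "k_plane_transform (\<lambda>x. ennreal ((cmod (fourier_extension sigma g x))\<^sup>2)) \<pi> y
     = (\<integral>\<^sup>+c. ennreal ((cmod (fourier_extension sigma g ((\<Sum>i\<in>UNIV. c $ i *\<^sub>R b i) + y)))\<^sup>2)
         \<partial>(lborel :: (real^'k) measure))"
    unfolding k_plane_transform_def subspace_lebesgue_coordinates[OF b(1) std]
    by (rule nn_integral_distr[OF Lm]) (use fem in measurable)
  also have "\<dots> = (\<integral>\<^sup>+c. ennreal ((cmod (fourier h c))\<^sup>2) \<partial>lborel)" unfolding fh ..
  also have "\<dots> = (\<integral>\<^sup>+v. ennreal ((cmod (h v))\<^sup>2) \<partial>lborel)" by (rule plancherel[OF hi])
  also have "\<dots> = (\<integral>\<^sup>+v. ennreal (weight v) * ennreal ((cmod (g (s v)))\<^sup>2 / J (s v)) * indicator V v \<partial>lborel)"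
  proof (rule nn_integral_cong)
    fix v
    show "ennreal ((cmod (h v))\<^sup>2) = ennreal (weight v) * ennreal ((cmod (g (s v)))\<^sup>2 / J (s v)) * indicator V v"
    proof (cases "v \<in> V")
      case True
      then have J: "J (s v) > 0" using tangent_props(3) by simp
      \<comment> \<open>The square carries two factors \<open>1 / J\<close>: one is the density of
        \<open>sigma\<close>, the other remains in the integrand.\<close>
      have "(cmod (h v))\<^sup>2 = (1 / J (s v)) * ((cmod (g (s v)))\<^sup>2 / J (s v))"
        using True J by (simp add: hn G_def weight_def norm_divide power_divide power2_eq_square)
      then show ?thesis using True J by (simp add: weight_def ennreal_mult[symmetric])
    qed (simp add: hn G_def)
  qed
  also have "\<dots> = weighted_energy g"
    by (rule nn_integral_sigma[symmetric]) (use gm J_measurable in measurable)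
  finally show ?thesis .
qed

section \<open>The pushforward to normal planes and the second identity\<close>

definition normal_plane :: "(real^'n) \<times> (real^'n) \<Rightarrow> (real^'n) set \<times> (real^'n)" where
  "normal_plane = (\<lambda>(\<xi>, v). ((tangent_space S \<xi>)\<^sup>\<bottom>, v))"

abbreviation planes :: "((real^'n) set \<times> (real^'n)) measure" where
  "planes \<equiv> plane_space (CARD('n) - dim \<pi>)"

lemma fst_bundle_measurable: "fst \<in> restrict_space borel (tangent_bundle S) \<rightarrow>\<^sub>M restrict_space borel S"
proof (rule measurable_restrict_space2)
  show "fst \<in> space (restrict_space borel (tangent_bundle S)) \<rightarrow> S"
    by (auto simp: space_restrict_space tangent_bundle_def)
  show "fst \<in> borel_measurable (restrict_space borel (tangent_bundle S))"
    by (intro measurable_restrict_space1 borel_measurable_continuous_onI continuous_intros)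
qed

text \<open>A map into the vimage algebra is measurable once its composition with the embedding by
  projection matrices is, and this reduces to continuity of the normal projection along
  \<open>S\<close>. The tangent vector is an admissible translation parameter because a subspace
  equals its double orthogonal complement.\<close>

lemma normal_plane_measurable: "normal_plane \<in> restrict_space borel (tangent_bundle S) \<rightarrow>\<^sub>M planes"
  unfolding plane_space_def
proof (rule measurable_vimage_algebra2)
  let ?TB = "restrict_space borel (tangent_bundle S)"
  show "normal_plane \<in> space ?TB \<rightarrow> affine_planes (CARD('n) - dim \<pi>)"
  proof
    fix p assume "p \<in> space ?TB"
    then obtain \<xi> v where p: "p = (\<xi>, v)" "\<xi> \<in> S" "v \<in> tangent_space S \<xi>"
      by (auto simp: space_restrict_space tangent_bundle_def)
    then show "normal_plane p \<in> affine_planes (CARD('n) - dim \<pi>)"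
      using tangent_props(4)[OF p(2)] pi_dim(2) orthogonal_comp_self[OF tangent_props(1)[OF p(2)]]
      by (simp add: normal_plane_def affine_planes_def subspace_orthogonal_comp)
  qed
  have "(\<lambda>\<xi>. projection_matrix ((tangent_space S \<xi>)\<^sup>\<bottom>)) \<in> borel_measurable (restrict_space borel S)"
    by (rule borel_measurable_continuous_on_restrict[OF normal_projection_continuous])
  from measurable_compose[OF fst_bundle_measurable this]
  have 1: "(\<lambda>p. projection_matrix ((tangent_space S (fst p))\<^sup>\<bottom>)) \<in> borel_measurable ?TB" .
  have 2: "snd \<in> borel_measurable ?TB"
    by (intro measurable_restrict_space1 borel_measurable_continuous_onI continuous_intros)
  have "(\<lambda>p. (projection_matrix ((tangent_space S (fst p))\<^sup>\<bottom>), snd p)) \<in> borel_measurable ?TB"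
    by (rule borel_measurable_Pair[OF 1 2])
  then show "(\<lambda>p. case normal_plane p of (\<theta>, z) \<Rightarrow> (matrix (closest_point \<theta>), z)) \<in> borel_measurable ?TB"
    by (simp add: normal_plane_def case_prod_beta projection_matrix_def)
qed

lemma space_planes: "space planes = affine_planes (CARD('n) - dim \<pi>)"
  by (simp add: plane_space_def)

text \<open>On planes of complementary dimension this is the square of the wedge product with
  \<open>\<pi>\<close>. It is continuous in the projection matrix and is nonzero exactly on the
  transverse planes.\<close>

definition plane_det :: "(real^'n) set \<times> (real^'n) \<Rightarrow> real" where
  "plane_det p = det (projection_matrix (fst p) + projection_matrix \<pi>)"

lemma plane_det_measurable: "plane_det \<in> borel_measurable planes"
proof -
  let ?E = "\<lambda>(\<theta>, z). (matrix (closest_point \<theta>), z) :: (real^'n^'n) \<times> (real^'n)"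
  have "?E \<in> planes \<rightarrow>\<^sub>M borel" unfolding plane_space_def by (rule measurable_vimage_algebra1) simp
  moreover have "(\<lambda>q :: (real^'n^'n) \<times> (real^'n). det (fst q + projection_matrix \<pi>)) \<in> borel_measurable borel"
    by (intro borel_measurable_continuous_onI continuous_on_det continuous_intros)
  ultimately have "(\<lambda>p. det (fst (?E p) + projection_matrix \<pi>)) \<in> borel_measurable planes"
    by (rule measurable_compose)
  then show ?thesis by (simp add: plane_det_def[abs_def] case_prod_beta projection_matrix_def)
qed

lemma delta_product_plane_det:
  assumes p: "p \<in> affine_planes (CARD('n) - dim \<pi>)" and nz: "plane_det p \<noteq> 0"
  shows "(case p of (\<theta>, z) \<Rightarrow> delta_product_integral \<pi> y \<theta> z) = ennreal (1 / sqrt (plane_det p))"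
proof -
  obtain \<theta> z where pe: "p = (\<theta>, z)" by (cases p)
  have \<theta>: "subspace \<theta>" "dim \<theta> = CARD('n) - dim \<pi>" using p pe by (auto simp: affine_planes_def)
  have "CARD('k) \<le> CARD('n)" using dim_subset_UNIV[of \<pi>] pi_dim by simp
  then have d: "dim \<theta> + dim \<pi> = CARD('n)" using \<theta> pi_dim by simp
  have t: "\<theta> \<inter> \<pi> = {0}" using nz by (intro wedge_frame_det_nonzeroD[OF \<theta>(1) pi_dim(1) d]) (simp add: plane_det_def pe)
  show ?thesis
    using delta_product_integral_transverse[OF \<theta>(1) pi_dim(1) d t] wedge_abs_eq[OF \<theta>(1) pi_dim(1) d]
    by (simp add: pe plane_det_def)
qed

lemma plane_det_normal_plane:
  assumes "p \<in> tangent_bundle S"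
  shows "plane_det (normal_plane p) \<noteq> 0" "sqrt (plane_det (normal_plane p)) = J (fst p)"
proof -
  have \<xi>: "fst p \<in> S" using assms by (auto simp: tangent_bundle_def)
  show 1: "sqrt (plane_det (normal_plane p)) = J (fst p)"
    using J_sqrt[OF \<xi>] by (simp add: plane_det_def normal_plane_def case_prod_beta)
  show "plane_det (normal_plane p) \<noteq> 0" using 1 tangent_props(3)[OF \<xi>] by auto
qed

text \<open>\<open>delta_product_integral\<close> is unspecified on planes that are not transverse to \<open>\<pi>\<close>, and no measurability is
  known there. The pushforward measure does not charge them.\<close>

lemma nn_integral_delta_product:
  assumes N: "sets N = sets (restrict_space borel (tangent_bundle S))"
  shows "(\<integral>\<^sup>+p. (case p of (\<theta>, z) \<Rightarrow> delta_product_integral \<pi> y \<theta> z) \<partial>distr N planes normal_plane)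
     = (\<integral>\<^sup>+\<xi>. ennreal (1 / J \<xi>) \<partial>distr N (restrict_space borel S) fst)"
proof -
  have spN: "space N = tangent_bundle S" using sets_eq_imp_space_eq[OF N] by (simp add: space_restrict_space)
  have nm: "normal_plane \<in> N \<rightarrow>\<^sub>M planes" using normal_plane_measurable N by (simp cong: measurable_cong_sets)
  have fm: "fst \<in> N \<rightarrow>\<^sub>M restrict_space borel S" using fst_bundle_measurable N by (simp cong: measurable_cong_sets)
  let ?D = "\<lambda>p. case p of (\<theta>, z) \<Rightarrow> delta_product_integral \<pi> y \<theta> z"
  let ?D' = "\<lambda>p. ennreal (1 / sqrt (plane_det p))"
  have D'm: "?D' \<in> borel_measurable planes" using plane_det_measurable by measurable
  \<comment> \<open>Transversality is phrased as a measurable condition so that it can be pulled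
    back along \<open>normal_plane\<close>; on the bundle it holds everywhere.\<close>
  have "AE p in distr N planes normal_plane. plane_det p \<noteq> 0"
  proof (subst AE_distr_iff[OF nm])
    show "{p \<in> space planes. plane_det p \<noteq> 0} \<in> sets planes" using plane_det_measurable by measurable
    show "AE p in N. plane_det (normal_plane p) \<noteq> 0" by (rule AE_I2) (simp add: spN plane_det_normal_plane)
  qed
  moreover have "AE p in distr N planes normal_plane. p \<in> affine_planes (CARD('n) - dim \<pi>)"
    by (rule AE_I2) (simp add: space_planes)
  ultimately have "AE p in distr N planes normal_plane. ?D p = ?D' p"
    by eventually_elim (rule delta_product_plane_det)
  then have "(\<integral>\<^sup>+p. ?D p \<partial>distr N planes normal_plane) = (\<integral>\<^sup>+p. ?D' p \<partial>distr N planes normal_plane)"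
    by (rule nn_integral_cong_AE)
  also have "\<dots> = (\<integral>\<^sup>+p. ?D' (normal_plane p) \<partial>N)" by (rule nn_integral_distr[OF nm]) (simp add: D'm)
  also have "\<dots> = (\<integral>\<^sup>+p. ennreal (1 / J (fst p)) \<partial>N)"
    by (rule nn_integral_cong) (simp add: spN plane_det_normal_plane)
  also have "\<dots> = (\<integral>\<^sup>+\<xi>. ennreal (1 / J \<xi>) \<partial>distr N (restrict_space borel S) fst)"
    by (rule nn_integral_distr[OF fm, symmetric]) (use J_measurable in \<open>simp, measurable\<close>)
  finally show ?thesis .
qed

text \<open>Let \<open>p\<close> and \<open>q\<close> be the pushforwards to \<open>S\<close> of the
  two parts of \<open>\<nu>\<close>, and \<open>m\<close> the measure with density
  \<open>|g|\<^sup>2\<close>. The hypothesis on \<open>\<nu>\<close> says \<open>p = q + m\<close>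
  on every Borel set of \<open>S\<close>. Integrating \<open>1 / J\<close> and subtracting the
  integral over \<open>q\<close> gives the claim.\<close>

lemma transform_adjoint_normal_planes:
  assumes g: "integrable sigma g"
    and \<nu>: "signed_measure_on (restrict_space borel (tangent_bundle S)) \<nu>"
    and \<nu>_S: "\<And>A. A \<in> sets (restrict_space borel S) \<Longrightarrow>
          signed_emeasure (signed_distr \<nu> (restrict_space borel S) fst) A =
            enn2ereal (emeasure (density sigma (\<lambda>\<xi>. ennreal ((cmod (g \<xi>))\<^sup>2))) A)"
    and ex: "transform_adjoint_exists (signed_distr \<nu> planes normal_plane) \<pi> y"
  shows "enn2ereal (weighted_energy g) = transform_adjoint (signed_distr \<nu> planes normal_plane) \<pi> y"
proof -
  let ?RS = "restrict_space borel S"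
  define p where "p = distr (fst \<nu>) ?RS fst"
  define q where "q = distr (snd \<nu>) ?RS fst"
  define m where "m = density sigma (\<lambda>\<xi>. ennreal ((cmod (g \<xi>))\<^sup>2))"
  have sets: "sets q = sets p" "sets m = sets p" "sets p = sets ?RS"
    by (simp_all add: p_def q_def m_def sets_sigma)
  have s\<nu>: "sets (fst \<nu>) = sets (restrict_space borel (tangent_bundle S))" "sets (snd \<nu>)
      = sets (restrict_space borel (tangent_bundle S))"
    "finite_measure (fst \<nu>) \<or> finite_measure (snd \<nu>)" using \<nu> by (auto simp: signed_measure_on_def)
  have fm: "fst \<in> fst \<nu> \<rightarrow>\<^sub>M ?RS" "fst \<in> snd \<nu> \<rightarrow>\<^sub>M ?RS"
    using fst_bundle_measurable s\<nu> by (simp_all cong: measurable_cong_sets)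
  have fin: "(\<forall>A. emeasure p A \<noteq> \<infinity>) \<or> (\<forall>A. emeasure q A \<noteq> \<infinity>)"
    using s\<nu>(3)
  proof
    assume "finite_measure (fst \<nu>)"
    then have "finite_measure p" unfolding p_def by (rule finite_measure.finite_measure_distr[OF _ fm(1)])
    then show ?thesis using finite_measure.emeasure_finite by auto
  next
    assume "finite_measure (snd \<nu>)"
    then have "finite_measure q" unfolding q_def by (rule finite_measure.finite_measure_distr[OF _ fm(2)])
    then show ?thesis using finite_measure.emeasure_finite by auto
  qed
  have em: "emeasure p A = emeasure q A + emeasure m A" if "A \<in> sets p" for A
  proof -
    have "enn2ereal (emeasure p A) - enn2ereal (emeasure q A) = enn2ereal (emeasure m A)"
      using \<nu>_S[of A] that sets by (simp add: signed_emeasure_def signed_distr_def p_def q_def m_def)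
    moreover have "emeasure p A \<noteq> \<infinity> \<or> emeasure q A \<noteq> \<infinity>" using fin by blast
    ultimately show ?thesis
      by (cases "emeasure p A"; cases "emeasure q A"; cases "emeasure m A") (auto simp flip: ennreal_plus)
  qed
  let ?I = "\<lambda>M. \<integral>\<^sup>+\<xi>. ennreal (1 / J \<xi>) \<partial>M"
  have Jm: "(\<lambda>\<xi>. ennreal (1 / J \<xi>)) \<in> borel_measurable ?RS" using J_measurable by measurable
  have gm: "g \<in> borel_measurable sigma" using g by (rule borel_measurable_integrable)
  have sum: "?I p = ?I q + ?I m"
    by (rule nn_integral_sum_measure[OF sets(1,2) em]) (use Jm sets(3) in \<open>simp_all cong: measurable_cong_sets\<close>)
  have Im: "?I m = weighted_energy g"
  proof -
    have "?I m = (\<integral>\<^sup>+\<xi>. ennreal ((cmod (g \<xi>))\<^sup>2) * ennreal (1 / J \<xi>) \<partial>sigma)"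
      unfolding m_def by (rule nn_integral_density) (use gm Jm in \<open>simp_all add: measurable_sigma_iff\<close>)
    also have "\<dots> = weighted_energy g"
      by (rule nn_integral_cong) (simp add: ennreal_mult'[symmetric])
    finally show ?thesis .
  qed
  have ta: "transform_adjoint (signed_distr \<nu> planes normal_plane) \<pi> y = enn2ereal (?I p) - enn2ereal (?I q)"
    unfolding transform_adjoint_def signed_integral_def signed_distr_def fst_conv snd_conv p_def q_def
    by (simp only: nn_integral_delta_product[OF s\<nu>(1)] nn_integral_delta_product[OF s\<nu>(2)])
  have "?I p < \<infinity> \<or> ?I q < \<infinity>"
    using ex unfolding transform_adjoint_exists_def signed_integral_exists_def signed_distr_def fst_conv snd_conv
      p_def q_def
    by (simp only: nn_integral_delta_product[OF s\<nu>(1)] nn_integral_delta_product[OF s\<nu>(2)])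
  \<comment> \<open>If \<open>?I p\<close> is finite, so is its summand \<open>?I q\<close>. Thus
    \<open>?I q\<close> is finite in either case, and subtracting it from the sum leaves
    \<open>?I m\<close>.\<close>
  then have "?I q \<noteq> \<infinity>" using sum by auto
  then show ?thesis unfolding ta Im[symmetric] sum
    by (cases "?I q"; cases "?I m") (auto simp flip: ennreal_plus)
qed

end

theorem theorem1:
  fixes S \<pi> :: "(real^'n) set"
    and g :: "real^'n \<Rightarrow> complex"
    and \<sigma> :: "(real^'n) measure"
    and \<nu> :: "((real^'n) \<times> (real^'n)) signed_measure"
    and \<mu> :: "((real^'n) set \<times> (real^'n)) signed_measure"
    and y :: "real^'n"
  assumes S: "C1_submanifold TYPE('k::finite) S"
    and \<pi>: "subspace \<pi>" "dim \<pi> = CARD('k)"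
    and T: "\<And>\<xi>. \<xi> \<in> S \<Longrightarrow> tangent_space S \<xi> \<inter> \<pi>\<^sup>\<bottom> = {0}"
    and GT: "\<And>\<xi> \<eta>. \<xi> \<in> S \<Longrightarrow> \<eta> \<in> S \<Longrightarrow> span {\<xi> - \<eta>} \<inter> \<pi>\<^sup>\<bottom> = {0}"
    and \<sigma>: "\<sigma> = surface_measure TYPE('k) S"
    and g: "integrable \<sigma> g"
    and \<nu>: "signed_measure_on (restrict_space borel (tangent_bundle S)) \<nu>"
    and \<nu>_S: "\<And>A. A \<in> sets (restrict_space borel S) \<Longrightarrow>
          signed_emeasure (signed_distr \<nu> (restrict_space borel S) fst) A =
            enn2ereal (emeasure (density \<sigma> (\<lambda>\<xi>. ennreal ((cmod (g \<xi>))\<^sup>2))) A)"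
    and \<mu>: "\<mu> = signed_distr \<nu> (plane_space (CARD('n) - CARD('k)))
                (\<lambda>(\<xi>, v). ((tangent_space S \<xi>)\<^sup>\<bottom>, v))"
    and y: "y \<in> \<pi>\<^sup>\<bottom>"
  shows "k_plane_transform (\<lambda>x. ennreal ((cmod (fourier_extension \<sigma> g x))\<^sup>2)) \<pi> y =
           (\<integral>\<^sup>+\<xi>. ennreal ((cmod (g \<xi>))\<^sup>2 / wedge_abs ((tangent_space S \<xi>)\<^sup>\<bottom>) \<pi>) \<partial>\<sigma>) \<and>
         (transform_adjoint_exists \<mu> \<pi> y \<longrightarrow>
           enn2ereal (\<integral>\<^sup>+\<xi>. ennreal ((cmod (g \<xi>))\<^sup>2 / wedge_abs ((tangent_space S \<xi>)\<^sup>\<bottom>) \<pi>) \<partial>\<sigma>) =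
             transform_adjoint \<mu> \<pi> y)"
proof -
  note B = orthonormal_basisD[OF standard_basis[OF \<pi>(1)]]
  \<comment> \<open>An enumeration of the basis inside \<open>subspace_lebesgue\<close>, so that the
    integral over the plane becomes one over \<open>real^'k\<close> in exactly the coordinates of
    \<open>Q\<close>.\<close>
  obtain b :: "'k \<Rightarrow> real^'n" where b: "bij_betw b UNIV (standard_basis \<pi>)"
    using finite_same_card_bij[of "UNIV :: 'k set" "standard_basis \<pi>"] B(1,2) \<pi>(2) by auto
  then have b': "inj b" "range b = standard_basis \<pi>" by (auto simp: bij_betw_def)
  interpret transverse_manifold S \<pi> b
    by unfold_locales (use S T GT b' standard_basis[OF \<pi>(1)] in auto)
  have \<sigma>': "\<sigma> = sigma" using \<sigma> surface_measure_eq by simp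
  have \<mu>': "\<mu> = signed_distr \<nu> planes normal_plane" unfolding \<mu> normal_plane_def \<pi>(2) ..
  have "k_plane_transform (\<lambda>x. ennreal ((cmod (fourier_extension \<sigma> g x))\<^sup>2)) \<pi> y =
           (\<integral>\<^sup>+\<xi>. ennreal ((cmod (g \<xi>))\<^sup>2 / J \<xi>) \<partial>\<sigma>)"
    unfolding \<sigma>' by (rule plane_transform_extension[OF b'(2) g[unfolded \<sigma>']])
  moreover have "enn2ereal (\<integral>\<^sup>+\<xi>. ennreal ((cmod (g \<xi>))\<^sup>2 / J \<xi>) \<partial>\<sigma>) = transform_adjoint \<mu> \<pi> y"
    if "transform_adjoint_exists \<mu> \<pi> y"
    unfolding \<sigma>' \<mu>' by (rule transform_adjoint_normal_planes[OF g[unfolded \<sigma>'] \<nu> \<nu>_S[unfolded \<sigma>'] that[unfolded \<mu>']])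
  ultimately show ?thesis unfolding J_def by blast
qed

end
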